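(* Assume that $f(t,\cdot,\cdot,\cdot)$ (for every $t\in\mathcal T$) and $g$ are continuous, that $(x,a)\mapsto\mathbb P_t^0(x,a,\cdot)$ is weakly continuous for every $t\in\mathcal T$, and that the policy class is regular (see context). Fix $\theta\in\Theta$, $t\in\mathcal T$, $(x,a)\in\mathcal X\times A$ and a feasible direction $r\in\mathbb R^{d_\theta}$. Suppose there is $h_0>0$ such that for every $s\in\bar{\mathcal T}$ the family $$\Big\{x\mapsto\tfrac{V_s^{\theta+hr}(x)-V_s^\theta(x)}{h}:\ 0<|h|\le h_0,\ \theta+hr\in\Theta\Big\}$$ is equicontinuous on $\mathcal X$, and for every $s\in\mathcal T$ the family $$\Big\{(x,a,\lambda)\mapsto\tfrac{F_s^{\theta+hr}(\lambda;x,a)-F_s^\theta(\lambda;x,a)}{h}:\ 0<|h|\le h_0,\ \theta+hr\in\Theta\Big\}$$ is equicontinuous on $\mathcal X\times A\times[0,\Lambda]$. Then $\theta\mapsto G_t^\theta(x,a)$ admits one-sided directional derivatives in direction $r$, and $$D_\theta^+G_t^\theta(x,a)[r]=\sup_{\lambda\in\Lambda_t^{*,\theta}(x,a)}\int_{\mathcal X}\Big[\inf_{y\in Y_{t,\theta,\lambda}^*(x,a;x')}D_\theta^+V_{t+1}^\theta(y)[r]\Big]\mathbb P_t^0(x,a,dx'),$$ $$D_\theta^-G_t^\theta(x,a)[r]=\inf_{\lambda\in\Lambda_t^{*,\theta}(x,a)}\int_{\mathcal X}\Big[\sup_{y\in Y_{t,\theta,\lambda}^*(x,a;x')}D_\theta^-V_{t+1}^\theta(y)[r]\Big]\mathbb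 P_t^0(x,a,dx').$$
   Context: Model. $\mathcal X\subset\mathbb R^d$, $A\subset\mathbb R^m$ are nonempty compact sets, $T\ge1$ an integer, $\mathcal T=\{0,\dots,T-1\}$, $\bar{\mathcal T}=\{0,\dots,T\}$, $q\ge1$ an integer, $\varepsilon>0$, $c(x,y)=\|x-y\|^q$ (Euclidean norm). $\mathcal P(\mathcal X)$ is the set of Borel probability measures on $\mathcal X$ and $W_q$ the $q$-Wasserstein distance for the Euclidean metric. Rewards: Borel $f:\mathcal T\times\mathcal X\times A\times\mathcal X\to\mathbb R$, $g:\mathcal X\to\mathbb R$. For $t\in\mathcal T$, $\mathbb P_t^0$ is a Borel (nominal) transition kernel from $\mathcal X\times A$ to $\mathcal X$, and $\mathbb B_t(x,a)=\{\mathbb P\in\mathcal P(\mathcal X):W_q(\mathbb P,\mathbb P_t^0(x,a,\cdot))\le\varepsilon\}$. Policies. $\Theta\subset\mathbb R^{d_\theta}$ is compact, $\nu$ is a reference measure on $A$, and for $\theta\in\Theta$, $\pi_t^\theta(x,da)=\pi_t^\theta(x,a)\,\nu(da)$ is a probability measure on $A$ for each $(t,x)\in\mathcal T\times\mathcal X$. The policy class is regular if for each $t$: $(\theta,x)\mapsto\pi_t^\theta(x,\cdot)$ is weakly continuous on $\Theta\times\mathcal X$; for every $\varphi\in C(A)$, $\theta\mapsto\int_A\varphi(a)\pi_t^\theta(x,da)$ is $C^1$ on $\Theta$ with derivative continuous in $(\theta,x)$; and the score $\nabla_\theta\log\pi_t^\theta(x,a)$ exists with $\sup_{\theta,t,x,a}\|\nabla_\theta\log\pi_t^\theta(x,a)\|<\infty$.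 Value functions. $V_t^\theta(x)=\inf\mathbb E\big[\sum_{l=t}^{T-1}f(l,X_l,a_l,X_{l+1})+g(X_T)\big]$, the infimum being over path laws $\delta_x(dx_t)\prod_{l=t}^{T-1}\pi_l^\theta(x_l,da_l)\mathbb P_l(x_l,a_l,dx_{l+1})$ with Borel kernels $\mathbb P_l$ such that $\mathbb P_l(x',a',\cdot)\in\mathbb B_l(x',a')$ for all $(x',a')$. Dual objects. For $\lambda\ge0$, $$F_t^\theta(\lambda;x,a)=\int_{\mathcal X}\inf_{y\in\mathcal X}\{f(t,x,a,y)+V_{t+1}^\theta(y)+\lambda c(x',y)\}\,\mathbb P_t^0(x,a,dx')-\varepsilon^q\lambda,$$ $Y_{t,\theta,\lambda}^*(x,a;x')=\arg\min_{y\in\mathcal X}\{f(t,x,a,y)+V_{t+1}^\theta(y)+\lambda c(x',y)\}$, $\Lambda_t^{*,\theta}(x,a)=\arg\max_{\lambda\ge0}F_t^\theta(\lambda;x,a)$, and $G_t^\theta(x,a)=\sup_{\lambda\ge0}F_t^\theta(\lambda;x,a)$. The dynamic programming recursion is $V_T^\theta=g$, $V_t^\theta(x)=\int_AG_t^\theta(x,a)\pi_t^\theta(x,da)$. $\Lambda<\infty$ is a fixed constant, independent of $(t,\theta,x,a)$, with $\Lambda_t^{*,\theta}(x,a)=\arg\max_{\lambda\in[0,\Lambda]}F_t^\theta(\lambda;x,a)$ for all $(t,\theta,x,a)$ (such a constant exists). Directional derivatives. $D_\theta^+\phi(\theta)[r]=\lim_{h\downarrow0}(\phi(\theta+hr)-\phi(\theta))/h$,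 $D_\theta^-\phi(\theta)[r]=\lim_{h\uparrow0}(\phi(\theta+hr)-\phi(\theta))/h$. Derivatives are taken at $\theta\in\mathrm{int}(\Theta)$; if $\theta\in\partial\Theta$, the statement for each side is understood only for directions $r$ feasible on that side ($\theta+hr\in\Theta$ for all sufficiently small $h$ of the corresponding sign). *)

theory Defs
  imports "HOL-Probability.Probability"
begin

text \<open>
  The measurable space of a Borel set \<open>S\<close>. Thus \<open>space (prob_algebra (bsp S))\<close> is the set
  of Borel probability measures on \<open>S\<close>, and a Borel kernel from \<open>S\<close> to \<open>S'\<close> is a
  measurable map from \<open>bsp S\<close> to \<open>prob_algebra (bsp S')\<close>.
\<close>

abbreviation bsp :: "'a::topological_space set \<Rightarrow> 'a measure" where
  "bsp S \<equiv> restrict_space borel S"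

definition couplings :: "'a measure \<Rightarrow> 'a measure \<Rightarrow> ('a \<times> 'a) measure set" where
  "couplings \<mu> \<nu> = {\<gamma> \<in> space (prob_algebra (\<mu> \<Otimes>\<^sub>M \<nu>)). distr \<gamma> \<mu> fst = \<mu> \<and> distr \<gamma> \<nu> snd = \<nu>}"

text \<open>
  The transport costs are Bochner integrals and real infima, so this is the Wasserstein distance
  only for probability measures on a bounded set. It is used only on the compact state space.
\<close>

definition wasserstein ::
  "nat \<Rightarrow> 'a::euclidean_space measure \<Rightarrow> 'a measure \<Rightarrow> real" where
  "wasserstein q \<mu> \<nu> = root q (INF \<gamma>\<in>couplings \<mu> \<nu>. \<integral>z. norm (fst z - snd z) ^ q \<partial>\<gamma>)"

text \<open>
  Weak continuity of \<open>z \<mapsto> \<kappa> z\<close> on \<open>Z\<close>, for probability measures \<open>\<kappa> z\<close> on a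
  compact set \<open>K\<close> (so that all continuous test functions are bounded).
\<close>

definition weakly_continuous_on ::
  "'z::topological_space set \<Rightarrow> 'k::topological_space set \<Rightarrow> ('z \<Rightarrow> 'k measure) \<Rightarrow> bool" where
  "weakly_continuous_on Z K \<kappa> \<longleftrightarrow>
     (\<forall>\<phi>::'k \<Rightarrow> real. continuous_on K \<phi> \<longrightarrow> continuous_on Z (\<lambda>z. \<integral>k. \<phi> k \<partial>\<kappa> z))"

definition equicontinuous_on ::
  "'a::metric_space set \<Rightarrow> ('a \<Rightarrow> 'b::metric_space) set \<Rightarrow> bool" where
  "equicontinuous_on S \<F> \<longleftrightarrow>
     (\<forall>x\<in>S. \<forall>e>0. \<exists>d>0. \<forall>\<phi>\<in>\<F>. \<forall>y\<in>S. dist y x < d \<longrightarrow> dist (\<phi> y) (\<phi> x) < e)"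


subsection \<open>One-sided directional derivatives\<close>

definition diff_quot :: "('c::real_vector \<Rightarrow> real) \<Rightarrow> 'c \<Rightarrow> 'c \<Rightarrow> real \<Rightarrow> real" where
  "diff_quot \<phi> \<theta> r h = (\<phi> (\<theta> + h *\<^sub>R r) - \<phi> \<theta>) / h"

definition has_right_dderiv :: "('c::real_vector \<Rightarrow> real) \<Rightarrow> 'c \<Rightarrow> 'c \<Rightarrow> bool" where
  "has_right_dderiv \<phi> \<theta> r \<longleftrightarrow> (\<exists>L. (diff_quot \<phi> \<theta> r \<longlongrightarrow> L) (at_right 0))"

definition has_left_dderiv :: "('c::real_vector \<Rightarrow> real) \<Rightarrow> 'c \<Rightarrow> 'c \<Rightarrow> bool" where
  "has_left_dderiv \<phi> \<theta> r \<longleftrightarrow> (\<exists>L. (diff_quot \<phi> \<theta> r \<longlongrightarrow> L) (at_left 0))"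

definition right_dderiv :: "('c::real_vector \<Rightarrow> real) \<Rightarrow> 'c \<Rightarrow> 'c \<Rightarrow> real" where
  "right_dderiv \<phi> \<theta> r = Lim (at_right 0) (diff_quot \<phi> \<theta> r)"

definition left_dderiv :: "('c::real_vector \<Rightarrow> real) \<Rightarrow> 'c \<Rightarrow> 'c \<Rightarrow> real" where
  "left_dderiv \<phi> \<theta> r = Lim (at_left 0) (diff_quot \<phi> \<theta> r)"

definition right_feasible :: "'c::real_vector set \<Rightarrow> 'c \<Rightarrow> 'c \<Rightarrow> bool" where
  "right_feasible \<Theta> \<theta> r \<longleftrightarrow> (\<forall>\<^sub>F h in at_right 0. \<theta> + h *\<^sub>R r \<in> \<Theta>)"

definition left_feasible :: "'c::real_vector set \<Rightarrow> 'c \<Rightarrow> 'c \<Rightarrow> bool" where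
  "left_feasible \<Theta> \<theta> r \<longleftrightarrow> (\<forall>\<^sub>F h in at_left 0. \<theta> + h *\<^sub>R r \<in> \<Theta>)"


subsection \<open>The model\<close>

text \<open>
  \<open>pdens M t \<theta> x\<close> is the density of the policy at time \<open>t\<close> in state \<open>x\<close> with respect to
  \<open>refmeas M\<close>.
\<close>

record ('a, 'b, 'c) rmdp =
  states :: "'a set"
  actions :: "'b set"
  horizon :: nat
  worder :: nat
  radius :: real
  reward :: "nat \<Rightarrow> 'a \<Rightarrow> 'b \<Rightarrow> 'a \<Rightarrow> real"
  terminal :: "'a \<Rightarrow> real"
  nominal :: "nat \<Rightarrow> 'a \<Rightarrow> 'b \<Rightarrow> 'a measure"
  params :: "'c set"
  refmeas :: "'b measure"
  pdens :: "nat \<Rightarrow> 'c \<Rightarrow> 'a \<Rightarrow> 'b \<Rightarrow> real"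

type_synonym ('a, 'b) kernels = "nat \<Rightarrow> 'a \<Rightarrow> 'b \<Rightarrow> 'a measure"

definition policy ::
  "('a, 'b, 'c) rmdp \<Rightarrow> nat \<Rightarrow> 'c \<Rightarrow> 'a \<Rightarrow> 'b measure" where
  "policy M t \<theta> x = density (refmeas M) (\<lambda>a. ennreal (pdens M t \<theta> x a))"

definition transition_kernel ::
  "('a::euclidean_space, 'b::euclidean_space, 'c) rmdp \<Rightarrow> ('a \<Rightarrow> 'b \<Rightarrow> 'a measure) \<Rightarrow> bool" where
  "transition_kernel M \<kappa> \<longleftrightarrow>
     (\<lambda>(x, a). \<kappa> x a) \<in> bsp (states M) \<Otimes>\<^sub>M bsp (actions M) \<rightarrow>\<^sub>M prob_algebra (bsp (states M))"

definition robust_mdp ::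
  "('a::euclidean_space, 'b::euclidean_space, 'c::euclidean_space) rmdp \<Rightarrow> bool" where
  "robust_mdp M \<longleftrightarrow>
     compact (states M) \<and> states M \<noteq> {} \<and> compact (actions M) \<and> actions M \<noteq> {} \<and>
     horizon M \<ge> 1 \<and> worder M \<ge> 1 \<and> radius M > 0 \<and>
     (\<forall>t<horizon M. (\<lambda>(x, a, y). reward M t x a y)
        \<in> borel_measurable (bsp (states M) \<Otimes>\<^sub>M bsp (actions M) \<Otimes>\<^sub>M bsp (states M))) \<and>
     terminal M \<in> borel_measurable (bsp (states M)) \<and>
     (\<forall>t<horizon M. transition_kernel M (nominal M t)) \<and>
     compact (params M) \<and>
     sets (refmeas M) = sets (bsp (actions M)) \<and>
     (\<forall>t<horizon M. \<forall>\<theta>\<in>params M. \<forall>x\<in>states M.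
        pdens M t \<theta> x \<in> borel_measurable (refmeas M) \<and>
        (\<forall>a\<in>actions M. 0 \<le> pdens M t \<theta> x a) \<and>
        prob_space (policy M t \<theta> x))"

text \<open>
  Derivatives on \<open>params M\<close> are taken within this set, since it need not be open. The score is
  the gradient of \<open>ln\<close> of the density, which must therefore be positive: HOL's total \<open>ln\<close> would
  otherwise assign a junk value.
\<close>

definition regular_policy ::
  "('a::euclidean_space, 'b::euclidean_space, 'c::euclidean_space) rmdp \<Rightarrow> bool" where
  "regular_policy M \<longleftrightarrow>
     (\<forall>t<horizon M.
        weakly_continuous_on (params M \<times> states M) (actions M) (\<lambda>(\<theta>, x). policy M t \<theta> x)) \<and>
     (\<forall>t<horizon M. \<forall>\<phi>::'b \<Rightarrow> real. continuous_on (actions M) \<phi> \<longrightarrow>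
        (\<exists>D :: 'c \<Rightarrow> 'a \<Rightarrow> 'c.
           continuous_on (params M \<times> states M) (\<lambda>(\<theta>, x). D \<theta> x) \<and>
           (\<forall>\<theta>\<in>params M. \<forall>x\<in>states M.
              ((\<lambda>\<theta>'. \<integral>a. \<phi> a \<partial>policy M t \<theta>' x) has_derivative (\<lambda>v. D \<theta> x \<bullet> v))
                (at \<theta> within params M)))) \<and>
     (\<exists>score :: nat \<Rightarrow> 'c \<Rightarrow> 'a \<Rightarrow> 'b \<Rightarrow> 'c. \<exists>C::real.
        \<forall>t<horizon M. \<forall>\<theta>\<in>params M. \<forall>x\<in>states M. \<forall>a\<in>actions M.
          0 < pdens M t \<theta> x a \<and>
          ((\<lambda>\<theta>'. ln (pdens M t \<theta>' x a)) has_derivative (\<lambda>v. score t \<theta> x a \<bullet> v))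
             (at \<theta> within params M) \<and>
          norm (score t \<theta> x a) \<le> C)"


subsection \<open>Value functions\<close>

definition ambiguity_ball ::
  "('a::euclidean_space, 'b, 'c) rmdp \<Rightarrow> nat \<Rightarrow> 'a \<Rightarrow> 'b \<Rightarrow> 'a measure set" where
  "ambiguity_ball M t x a =
     {P \<in> space (prob_algebra (bsp (states M))).
        wasserstein (worder M) P (nominal M t x a) \<le> radius M}"

definition admissible_kernels ::
  "('a::euclidean_space, 'b::euclidean_space, 'c) rmdp \<Rightarrow> nat \<Rightarrow> ('a, 'b) kernels set" where
  "admissible_kernels M t =
     {P. \<forall>l\<in>{t..<horizon M}. transition_kernel M (P l) \<and>
           (\<forall>x\<in>states M. \<forall>a\<in>actions M. P l x a \<in> ambiguity_ball M l x a)}"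

text \<open>
  Trajectories with \<open>k\<close> transitions started at time \<open>t\<close>: the states at times \<open>t, \<dots>, t+k\<close> paired
  with the actions at times \<open>t, \<dots>, t+k-1\<close>.
\<close>

definition traj_space ::
  "('a::euclidean_space, 'b::euclidean_space, 'c) rmdp \<Rightarrow> nat \<Rightarrow> nat \<Rightarrow>
     ((nat \<Rightarrow> 'a) \<times> (nat \<Rightarrow> 'b)) measure" where
  "traj_space M t k =
     (\<Pi>\<^sub>M i\<in>{t..t + k}. bsp (states M)) \<Otimes>\<^sub>M (\<Pi>\<^sub>M i\<in>{t..<t + k}. bsp (actions M))"

primrec path_law ::
  "('a::euclidean_space, 'b::euclidean_space, 'c) rmdp \<Rightarrow> 'c \<Rightarrow> ('a, 'b) kernels \<Rightarrow> nat \<Rightarrow> 'a \<Rightarrow>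
     nat \<Rightarrow> ((nat \<Rightarrow> 'a) \<times> (nat \<Rightarrow> 'b)) measure" where
  "path_law M \<theta> P t x 0 =
     return (traj_space M t 0) ((\<lambda>i. undefined)(t := x), \<lambda>i. undefined)"
| "path_law M \<theta> P t x (Suc k) =
     path_law M \<theta> P t x k \<bind> (\<lambda>(\<xi>, \<alpha>).
       policy M (t + k) \<theta> (\<xi> (t + k)) \<bind> (\<lambda>a.
         P (t + k) (\<xi> (t + k)) a \<bind> (\<lambda>y.
           return (traj_space M t (Suc k)) (\<xi>(t + Suc k := y), \<alpha>(t + k := a)))))"

definition expected_reward ::
  "('a::euclidean_space, 'b::euclidean_space, 'c) rmdp \<Rightarrow> 'c \<Rightarrow> ('a, 'b) kernels \<Rightarrow> nat \<Rightarrow> 'a \<Rightarrow>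
     real" where
  "expected_reward M \<theta> P t x =
     (\<integral>\<omega>. (case \<omega> of (\<xi>, \<alpha>) \<Rightarrow>
          (\<Sum>l\<in>{t..<horizon M}. reward M l (\<xi> l) (\<alpha> l) (\<xi> (Suc l))) + terminal M (\<xi> (horizon M)))
        \<partial>path_law M \<theta> P t x (horizon M - t))"

definition V ::
  "('a::euclidean_space, 'b::euclidean_space, 'c) rmdp \<Rightarrow> nat \<Rightarrow> 'c \<Rightarrow> 'a \<Rightarrow> real" where
  "V M t \<theta> x = (INF P\<in>admissible_kernels M t. expected_reward M \<theta> P t x)"


subsection \<open>Dual objects\<close>

definition inner_obj ::
  "('a::euclidean_space, 'b::euclidean_space, 'c) rmdp \<Rightarrow> nat \<Rightarrow> 'c \<Rightarrow> real \<Rightarrow>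
     'a \<Rightarrow> 'b \<Rightarrow> 'a \<Rightarrow> 'a \<Rightarrow> real" where
  "inner_obj M t \<theta> lam x a x' y =
     reward M t x a y + V M (Suc t) \<theta> y + lam * norm (x' - y) ^ worder M"

definition F ::
  "('a::euclidean_space, 'b::euclidean_space, 'c) rmdp \<Rightarrow> nat \<Rightarrow> 'c \<Rightarrow> real \<Rightarrow> 'a \<Rightarrow> 'b \<Rightarrow> real" where
  "F M t \<theta> lam x a =
     (\<integral>x'. (INF y\<in>states M. inner_obj M t \<theta> lam x a x' y) \<partial>nominal M t x a)
       - radius M ^ worder M * lam"

definition G ::
  "('a::euclidean_space, 'b::euclidean_space, 'c) rmdp \<Rightarrow> nat \<Rightarrow> 'c \<Rightarrow> 'a \<Rightarrow> 'b \<Rightarrow> real" where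
  "G M t \<theta> x a = (SUP lam\<in>{0..}. F M t \<theta> lam x a)"

definition Ystar ::
  "('a::euclidean_space, 'b::euclidean_space, 'c) rmdp \<Rightarrow> nat \<Rightarrow> 'c \<Rightarrow> real \<Rightarrow>
     'a \<Rightarrow> 'b \<Rightarrow> 'a \<Rightarrow> 'a set" where
  "Ystar M t \<theta> lam x a x' =
     {y. is_arg_min (inner_obj M t \<theta> lam x a x') (\<lambda>y. y \<in> states M) y}"

definition Lstar ::
  "('a::euclidean_space, 'b::euclidean_space, 'c) rmdp \<Rightarrow> nat \<Rightarrow> 'c \<Rightarrow> 'a \<Rightarrow> 'b \<Rightarrow> real set" where
  "Lstar M t \<theta> x a = {lam. is_arg_max (\<lambda>lam. F M t \<theta> lam x a) (\<lambda>lam. 0 \<le> lam) lam}"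

definition multiplier_bound ::
  "('a::euclidean_space, 'b::euclidean_space, 'c) rmdp \<Rightarrow> real \<Rightarrow> bool" where
  "multiplier_bound M L \<longleftrightarrow>
     0 \<le> L \<and>
     (\<forall>t<horizon M. \<forall>\<theta>\<in>params M. \<forall>x\<in>states M. \<forall>a\<in>actions M.
        Lstar M t \<theta> x a = {lam. is_arg_max (\<lambda>lam. F M t \<theta> lam x a) (\<lambda>lam. lam \<in> {0..L}) lam})"

end

theory Submission
  imports Defs
begin

text \<open>
  Fix a sequence of steps \<open>h\<^sub>n \<down> 0\<close>. If the difference quotients of \<open>V\<^sub>t\<^sub>+\<^sub>1\<close> converge pointwise, then by
  equicontinuity they converge uniformly, and Danskin's theorem for the inner infimum together with
  dominated convergence gives the limit of the difference quotients of \<open>F\<^sub>t\<close> for each multiplier.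
  Equicontinuity in the multiplier makes this limit uniform on \<open>[0, \<Lambda>]\<close>, and Danskin's theorem for the
  outer supremum yields the formula for \<open>G\<^sub>t\<close>. The convergence for \<open>V\<^sub>t\<close> itself follows by
  backward induction from \<open>V\<^sub>t = \<integral> G\<^sub>t d\<pi>\<^sub>t\<close>, splitting the quotient into a change of \<open>G\<^sub>t\<close>
  and a change of \<open>\<pi>\<^sub>t\<close>. The left derivative in direction \<open>r\<close> is the negative of the right derivative
  in direction \<open>-r\<close>.

  The recursion \<open>V\<^sub>t = \<integral> G\<^sub>t d\<pi>\<^sub>t\<close> rests on strong duality for the transport ball. Separating the
  convex set of attainable pairs (cost, objective) from a quadrant in the plane produces near-optimal
  transport plans that are finite mixtures of point masses with weights continuous in the source
  point.
\<close>

text \<open>\<open>V\<close> is an infimum over path laws of arbitrary Borel kernels, so its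
  recursion must be proved before anything can be differentiated. One inequality is weak duality at
  each stage; the other needs a single Borel kernel that is near-optimal at all state-action pairs
  at once. Continuous weights provide it: for fixed weights, cost and objective depend continuously
  on the pair, so strict inequalities persist nearby. Strict feasibility is available because
  staying put costs nothing and the radius is positive. Derivatives are taken along sequences
  because the integrand of the derivative is an infimum over a set that moves with
  \<open>x'\<close>. Its measurability is not visible from the formula; it comes from being a
  pointwise limit of continuous quotients. The limits are expressed through the derivative of the
  next value function alone, so all sequences agree and a one-sided limit results. Two multiplier
  bounds occur: \<open>L\<close> from the hypothesis, which matches the argmax sets of
  \<open>G\<close>, and one computed from the data in \<open>dual_sup_compact\<close>, which serves
  the recursion for arbitrary continuous continuation values.\<close>

section \<open>Infima and suprema over a compact index set\<close>

lemma bdd_below_image_compact: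
  fixes f :: "'k::topological_space \<Rightarrow> real"
  assumes "compact K" "continuous_on K f"
  shows "bdd_below (f ` K)"
  using assms by (intro bounded_imp_bdd_below compact_imp_bounded compact_continuous_image)

lemma bdd_above_image_compact:
  fixes f :: "'k::topological_space \<Rightarrow> real"
  assumes "compact K" "continuous_on K f"
  shows "bdd_above (f ` K)"
  using assms by (intro bounded_imp_bdd_above compact_imp_bounded compact_continuous_image)

lemma abs_INF_diff_le:
  fixes f g :: "'k \<Rightarrow> real"
  assumes "K \<noteq> {}" "bdd_below (f ` K)" "bdd_below (g ` K)" "\<And>k. k \<in> K \<Longrightarrow> \<bar>f k - g k\<bar> \<le> e"
  shows "\<bar>(INF k\<in>K. f k) - (INF k\<in>K. g k)\<bar> \<le> e"
proof -
  have "(INF k\<in>K. f k) - e \<le> g k" if "k \<in> K" for k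
    using cINF_lower[OF assms(2) that] assms(4)[OF that] by linarith
  then have 1: "(INF k\<in>K. f k) - e \<le> (INF k\<in>K. g k)"
    using assms(1) by (intro cINF_greatest)
  have "(INF k\<in>K. g k) - e \<le> f k" if "k \<in> K" for k
    using cINF_lower[OF assms(3) that] assms(4)[OF that] by linarith
  then have "(INF k\<in>K. g k) - e \<le> (INF k\<in>K. f k)"
    using assms(1) by (intro cINF_greatest)
  with 1 show ?thesis by linarith
qed

text \<open>On the reals \<open>Inf\<close> is defined as the negated \<open>Sup\<close> of the
  negated set, hence no boundedness or nonemptiness assumption.\<close>

lemma uminus_cSUP:
  fixes f :: "'k \<Rightarrow> real"
  shows "- (SUP k\<in>K. f k) = (INF k\<in>K. - f k)"
  by (simp add: Inf_real_def image_image)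

lemma uminus_cINF:
  fixes f :: "'k \<Rightarrow> real"
  shows "- (INF k\<in>K. f k) = (SUP k\<in>K. - f k)"
  by (simp add: Inf_real_def image_image)

lemma abs_SUP_diff_le:
  fixes f g :: "'k \<Rightarrow> real"
  assumes "K \<noteq> {}" "bdd_above (f ` K)" "bdd_above (g ` K)" "\<And>k. k \<in> K \<Longrightarrow> \<bar>f k - g k\<bar> \<le> e"
  shows "\<bar>(SUP k\<in>K. f k) - (SUP k\<in>K. g k)\<bar> \<le> e"
proof -
  have bdd: "bdd_below ((\<lambda>k. - h k) ` K)" if "bdd_above (h ` K)" for h :: "'k \<Rightarrow> real"
    using that by (auto simp: bdd_above_def bdd_below_def intro: le_imp_neg_le)
  have "\<bar>(INF k\<in>K. - f k) - (INF k\<in>K. - g k)\<bar> \<le> e"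
    using assms by (intro abs_INF_diff_le bdd) (simp_all add: abs_minus_commute)
  then show ?thesis by (simp add: uminus_cSUP[symmetric] abs_minus_commute)
qed

lemma continuous_on_slice:
  assumes "continuous_on (S \<times> K) (\<lambda>(s, k). f s k)" "s \<in> S"
  shows "continuous_on K (f s)"
proof -
  have "continuous_on K ((\<lambda>(s, k). f s k) \<circ> (\<lambda>k. (s, k)))"
    using assms by (intro continuous_on_compose continuous_intros continuous_on_subset[OF assms(1)]) auto
  then show ?thesis by (simp add: o_def)
qed

lemma continuous_on_realI:
  fixes f :: "'s::topological_space \<Rightarrow> real"
  assumes "\<And>s e. s \<in> S \<Longrightarrow> e > 0 \<Longrightarrow> \<exists>U. open U \<and> s \<in> U \<and> (\<forall>s'\<in>U \<inter> S. \<bar>f s' - f s\<bar> \<le> e)"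
  shows "continuous_on S f"
  unfolding continuous_on_def tendsto_iff
proof (intro ballI allI impI)
  fix s and e :: real assume "s \<in> S" "e > 0"
  then obtain U where "open U" "s \<in> U" "\<And>s'. s' \<in> U \<inter> S \<Longrightarrow> \<bar>f s' - f s\<bar> \<le> e / 2"
    using assms[of s "e / 2"] by auto
  then show "\<forall>\<^sub>F s' in at s within S. dist (f s') (f s) < e"
    unfolding eventually_at_topological
    by (intro exI[of _ U]) (use \<open>e > 0\<close> in \<open>fastforce simp: dist_real_def\<close>)
qed

text \<open>Compactness of \<open>K\<close> makes joint continuity uniform in \<open>k\<close> near
  each \<open>s\<close>, and the infimum is nonexpansive for the supremum distance.\<close>

lemma continuous_on_INF_compact:
  fixes f :: "'s::topological_space \<Rightarrow> 'k::topological_space \<Rightarrow> real"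
  assumes f: "continuous_on (S \<times> K) (\<lambda>(s, k). f s k)" and K: "compact K" "K \<noteq> {}"
  shows "continuous_on S (\<lambda>s. INF k\<in>K. f s k)"
proof (rule continuous_on_realI)
  fix s and e :: real assume s: "s \<in> S" and e: "e > 0"
  obtain U where U: "s \<in> U" "open U" "\<forall>s'\<in>U \<inter> S. \<forall>k\<in>K. dist (f s' k) (f s k) \<le> e"
    using continuous_on_prod_compactE[OF f K(1) s e] by auto
  show "\<exists>U. open U \<and> s \<in> U \<and> (\<forall>s'\<in>U \<inter> S. \<bar>(INF k\<in>K. f s' k) - (INF k\<in>K. f s k)\<bar> \<le> e)"
    using U s by (intro exI[of _ U] conjI ballI abs_INF_diff_le K bdd_below_image_compact
        continuous_on_slice[OF f]) (auto simp: dist_real_def)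
qed

lemma continuous_on_SUP_compact:
  fixes f :: "'s::topological_space \<Rightarrow> 'k::topological_space \<Rightarrow> real"
  assumes f: "continuous_on (S \<times> K) (\<lambda>(s, k). f s k)" and K: "compact K" "K \<noteq> {}"
  shows "continuous_on S (\<lambda>s. SUP k\<in>K. f s k)"
proof -
  have "continuous_on S (\<lambda>s. INF k\<in>K. - f s k)"
    using continuous_on_minus[OF f] by (intro continuous_on_INF_compact K) (simp add: case_prod_beta')
  from continuous_on_minus[OF this] show ?thesis
    by (simp add: uminus_cINF)
qed

section \<open>Probability measures and weakly continuous kernels on a compact set\<close>

lemma space_bsp [simp]: "space (bsp S) = S"
  by (simp add: space_restrict_space)

lemma bsp_measurableI:
  "continuous_on S f \<Longrightarrow> f \<in> borel_measurable (bsp S)"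
  by (rule borel_measurable_continuous_on_restrict)

abbreviation pms :: "'a::topological_space set \<Rightarrow> 'a measure set" where
  "pms S \<equiv> space (prob_algebra (bsp S))"

lemma pmsD:
  assumes "P \<in> pms S"
  shows "prob_space P" "sets P = sets (bsp S)" "space P = S"
  using assms sets_eq_imp_space_eq[of P "bsp S"] by (auto simp: space_prob_algebra)

lemma compact_abs_bound:
  fixes f :: "'k::topological_space \<Rightarrow> real"
  assumes "compact K" "continuous_on K f"
  obtains B where "B \<ge> 0" "\<And>k. k \<in> K \<Longrightarrow> \<bar>f k\<bar> \<le> B"
proof -
  have "bounded (f ` K)"
    using assms by (intro compact_imp_bounded compact_continuous_image)
  then obtain B where "\<And>k. k \<in> K \<Longrightarrow> \<bar>f k\<bar> \<le> B"
    by (auto simp: bounded_iff)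
  then have "\<bar>f k\<bar> \<le> max 0 B" if "k \<in> K" for k using that by fastforce
  then show thesis by (intro that[of "max 0 B"]) auto
qed

lemma pms_integrable_bounded:
  fixes f :: "'a::topological_space \<Rightarrow> real"
  assumes P: "P \<in> pms S" and f: "f \<in> borel_measurable (bsp S)" and B: "\<And>x. x \<in> S \<Longrightarrow> \<bar>f x\<bar> \<le> B"
  shows "integrable P f"
proof -
  interpret prob_space P using pmsD[OF P] by simp
  show ?thesis
    using f B pmsD[OF P]
    by (intro integrable_const_bound[where B=B] AE_I2) (auto cong: measurable_cong_sets)
qed

lemma pms_integrable:
  fixes f :: "'a::topological_space \<Rightarrow> real"
  assumes P: "P \<in> pms S" and "compact S" "continuous_on S f"
  shows "integrable P f"
proof -
  obtain B where "\<And>x. x \<in> S \<Longrightarrow> \<bar>f x\<bar> \<le> B"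
    using compact_abs_bound[OF assms(2,3)] by auto
  then show ?thesis by (intro pms_integrable_bounded[OF P bsp_measurableI[OF assms(3)]])
qed

lemma pms_integral_mono:
  fixes f g :: "'a::topological_space \<Rightarrow> real"
  assumes "P \<in> pms S" "integrable P f" "integrable P g" "\<And>x. x \<in> S \<Longrightarrow> f x \<le> g x"
  shows "integral\<^sup>L P f \<le> integral\<^sup>L P g"
  using assms pmsD[OF assms(1)] by (intro integral_mono) auto

lemma pms_integral_const:
  assumes "P \<in> pms S"
  shows "(\<integral>x. (c::real) \<partial>P) = c"
proof -
  interpret prob_space P using pmsD[OF assms] by simp
  show ?thesis by (simp add: prob_space)
qed

lemma pms_integral_bound:
  fixes f :: "'a::topological_space \<Rightarrow> real"
  assumes P: "P \<in> pms S" and f: "integrable P f" and B: "\<And>x. x \<in> S \<Longrightarrow> \<bar>f x\<bar> \<le> B"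
  shows "\<bar>integral\<^sup>L P f\<bar> \<le> B"
proof -
  interpret prob_space P using pmsD[OF P] by simp
  have "integral\<^sup>L P f \<le> integral\<^sup>L P (\<lambda>_. B)" "integral\<^sup>L P (\<lambda>_. - B) \<le> integral\<^sup>L P f"
    using B by (intro pms_integral_mono[OF P] f integrable_const; force simp: abs_le_iff)+
  then show ?thesis unfolding pms_integral_const[OF P] by linarith
qed

text \<open>Integrand and measure move together. The move of the integrand is uniformly small on the
  compact \<open>K\<close>, whatever the probability measure; with the integrand frozen at
  \<open>z\<close>, weak continuity handles the move of the measure.\<close>

lemma continuous_on_integral_kernel:
  fixes \<psi> :: "'z::topological_space \<Rightarrow> 'k::topological_space \<Rightarrow> real"
  assumes \<psi>: "continuous_on (Z \<times> K) (\<lambda>(z, k). \<psi> z k)" and K: "compact K"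
    and \<kappa>: "weakly_continuous_on Z K \<kappa>" "\<And>z. z \<in> Z \<Longrightarrow> \<kappa> z \<in> pms K"
  shows "continuous_on Z (\<lambda>z. \<integral>k. \<psi> z k \<partial>\<kappa> z)"
proof (rule continuous_on_realI)
  fix z and e :: real assume z: "z \<in> Z" and e: "e > 0"
  have e2: "e / 2 > 0" using e by simp
  obtain U where U: "z \<in> U" "open U" "\<forall>z'\<in>U \<inter> Z. \<forall>k\<in>K. dist (\<psi> z' k) (\<psi> z k) \<le> e / 2"
    using continuous_on_prod_compactE[OF \<psi> K z e2] by auto
  have c: "continuous_on K (\<psi> z')" if "z' \<in> Z" for z'
    using continuous_on_slice[OF \<psi> that] .
  have "continuous_on Z (\<lambda>z'. \<integral>k. \<psi> z k \<partial>\<kappa> z')"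
    using \<kappa>(1) c[OF z] unfolding weakly_continuous_on_def by blast
  then have "\<forall>\<^sub>F z' in at z within Z. dist (\<integral>k. \<psi> z k \<partial>\<kappa> z') (\<integral>k. \<psi> z k \<partial>\<kappa> z) < e / 2"
    using z e2 unfolding continuous_on_def tendsto_iff by blast
  then obtain W where W: "open W" "z \<in> W"
    "\<And>z'. z' \<in> W \<Longrightarrow> z' \<in> Z \<Longrightarrow> z' \<noteq> z \<Longrightarrow> dist (\<integral>k. \<psi> z k \<partial>\<kappa> z') (\<integral>k. \<psi> z k \<partial>\<kappa> z) < e / 2"
    unfolding eventually_at_topological by blast
  have "\<bar>(\<integral>k. \<psi> z' k \<partial>\<kappa> z') - (\<integral>k. \<psi> z k \<partial>\<kappa> z)\<bar> \<le> e" if z': "z' \<in> (U \<inter> W) \<inter> Z" for z'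
  proof -
    have i: "integrable (\<kappa> z') (\<psi> z'')" if "z'' \<in> Z" for z''
      using pms_integrable[OF \<kappa>(2) K c[OF that]] z' by auto
    have d: "\<bar>\<integral>k. \<psi> z' k - \<psi> z k \<partial>\<kappa> z'\<bar> \<le> e / 2"
      using z' z U by (intro pms_integral_bound[OF \<kappa>(2)] Bochner_Integration.integrable_diff i)
        (auto simp: dist_real_def)
    have "(\<integral>k. \<psi> z' k - \<psi> z k \<partial>\<kappa> z') = (\<integral>k. \<psi> z' k \<partial>\<kappa> z') - (\<integral>k. \<psi> z k \<partial>\<kappa> z')"
      using z z' i by simp
    moreover have "\<bar>(\<integral>k. \<psi> z k \<partial>\<kappa> z') - (\<integral>k. \<psi> z k \<partial>\<kappa> z)\<bar> \<le> e / 2"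
      using W(3)[of z'] z' e by (cases "z' = z") (auto simp: dist_real_def)
    ultimately show ?thesis using d by linarith
  qed
  then show "\<exists>U. open U \<and> z \<in> U \<and> (\<forall>z'\<in>U \<inter> Z. \<bar>(\<integral>k. \<psi> z' k \<partial>\<kappa> z') - (\<integral>k. \<psi> z k \<partial>\<kappa> z)\<bar> \<le> e)"
    using U W by (intro exI[of _ "U \<inter> W"]) auto
qed

lemma weakly_continuous_on_compose:
  assumes "weakly_continuous_on Z K \<kappa>" "continuous_on Y g" "g ` Y \<subseteq> Z"
  shows "weakly_continuous_on Y K (\<lambda>y. \<kappa> (g y))"
  using assms unfolding weakly_continuous_on_def
  by (auto intro: continuous_on_compose2)

text \<open>Relatively closed sets form an intersection-stable generator, and the indicator of a
  closed set is the pointwise limit of the continuous functions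
  \<open>max 0 (1 - n * infdist k C)\<close>. So the measure of such a set is a limit of functions
  continuous in \<open>z\<close>.\<close>

lemma weakly_continuous_measurable:
  fixes \<kappa> :: "'z::topological_space \<Rightarrow> 'k::metric_space measure"
  assumes K: "closed K" and \<kappa>: "weakly_continuous_on Z K \<kappa>" "\<And>z. z \<in> Z \<Longrightarrow> \<kappa> z \<in> pms K"
  shows "\<kappa> \<in> bsp Z \<rightarrow>\<^sub>M prob_algebra (bsp K)"
proof (rule measurable_prob_algebra_generated[where \<Omega>=K and G="(\<inter>) K ` Collect closed"])
  have "K \<in> sigma_sets UNIV (Collect closed)" using K by auto
  then have "sigma_sets K ((\<inter>) K ` Collect closed) = (\<inter>) K ` sigma_sets UNIV (Collect closed)"
    by (intro sigma_sets_Int[symmetric]) auto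
  then show "sets (bsp K) = sigma_sets K ((\<inter>) K ` Collect closed)"
    by (simp add: sets_restrict_space borel_eq_closed)
  show "Int_stable ((\<inter>) K ` Collect closed)"
  proof (rule Int_stableI)
    fix a b assume "a \<in> (\<inter>) K ` Collect closed" "b \<in> (\<inter>) K ` Collect closed"
    then obtain c d where "closed c" "closed d" "a = K \<inter> c" "b = K \<inter> d" by auto
    then show "a \<inter> b \<in> (\<inter>) K ` Collect closed"
      by (intro image_eqI[of _ _ "c \<inter> d"]) auto
  qed
  show "(\<inter>) K ` Collect closed \<subseteq> Pow K" by auto
  show "prob_space (\<kappa> z)" "sets (\<kappa> z) = sets (bsp K)" if "z \<in> space (bsp Z)" for z
    using \<kappa>(2)[of z] that pmsD[of "\<kappa> z" K] by auto
  fix A assume "A \<in> (\<inter>) K ` Collect closed"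
  then obtain C where C: "closed C" "A = K \<inter> C" by auto
  show "(\<lambda>z. emeasure (\<kappa> z) A) \<in> borel_measurable (bsp Z)"
  \<comment> \<open>\<open>infdist\<close> to the empty set is 0 by convention, so the approximation
    below would converge to 1 instead of 0.\<close>
  proof (cases "C = {}")
    case False
    define \<phi> where "\<phi> n k = max 0 (1 - real n * infdist k C)" for n and k :: 'k
    have \<phi>c: "continuous_on K (\<phi> n)" for n
      unfolding \<phi>_def by (intro continuous_intros)
    have \<phi>b: "\<bar>\<phi> n k\<bar> \<le> 1" for n k
      unfolding \<phi>_def using infdist_nonneg[of k C] by (auto simp: max_def)
    have lim: "(\<lambda>n. \<phi> n k) \<longlonglongrightarrow> indicator C k" for k
    proof (cases "k \<in> C")
      case True then show ?thesis by (simp add: \<phi>_def)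
    next
      case notin: False
      then have d: "infdist k C > 0"
        using in_closed_iff_infdist_zero[OF C(1) False] infdist_nonneg[of k C] by (simp add: less_le)
      obtain N where N: "real N * infdist k C > 1"
        using reals_Archimedean3[OF d] by auto
      have "\<phi> n k = 0" if "n \<ge> N" for n
      proof -
        have "real N * infdist k C \<le> real n * infdist k C"
          using that d by (intro mult_right_mono) auto
        then show ?thesis using N by (simp add: \<phi>_def)
      qed
      then have "\<forall>\<^sub>F n in sequentially. \<phi> n k = 0"
        unfolding eventually_sequentially by blast
      then show ?thesis using notin by (auto intro: tendsto_eventually)
    qed
    have "(\<lambda>n. \<integral>k. \<phi> n k \<partial>\<kappa> z) \<longlonglongrightarrow> measure (\<kappa> z) A" if z: "z \<in> Z" for z
    proof -
      note p = pmsD[OF \<kappa>(2)[OF z]]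
      interpret prob_space "\<kappa> z" using p by simp
      have Cm: "C \<inter> K \<in> sets (\<kappa> z)"
        using C by (auto simp: p sets_restrict_space)
      have "(\<lambda>n. \<integral>k. \<phi> n k \<partial>\<kappa> z) \<longlonglongrightarrow> (\<integral>k. indicator (C \<inter> K) k \<partial>\<kappa> z)"
      proof (rule integral_dominated_convergence[where w="\<lambda>_. 1"])
        show "\<phi> n \<in> borel_measurable (\<kappa> z)" for n
          using bsp_measurableI[OF \<phi>c[of n]] p by (simp cong: measurable_cong_sets)
        show "(\<lambda>k. indicator (C \<inter> K) k :: real) \<in> borel_measurable (\<kappa> z)"
          using Cm by simp
        show "AE k in \<kappa> z. (\<lambda>n. \<phi> n k) \<longlonglongrightarrow> indicator (C \<inter> K) k"
        proof (rule AE_I2)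
          fix k assume "k \<in> space (\<kappa> z)"
          then have "indicator (C \<inter> K) k = (indicator C k :: real)"
            using p by (auto simp: indicator_def)
          then show "(\<lambda>n. \<phi> n k) \<longlonglongrightarrow> indicator (C \<inter> K) k"
            using lim[of k] by simp
        qed
      qed (use \<phi>b in auto)
      then show ?thesis using Cm C by (simp add: Int_commute)
    qed
    moreover have "(\<lambda>z. \<integral>k. \<phi> n k \<partial>\<kappa> z) \<in> borel_measurable (bsp Z)" for n
      using \<kappa>(1) \<phi>c[of n] unfolding weakly_continuous_on_def by (intro bsp_measurableI) auto
    ultimately have "(\<lambda>z. measure (\<kappa> z) A) \<in> borel_measurable (bsp Z)"
      by (rule borel_measurable_LIMSEQ_metric[rotated]) auto
    then have "(\<lambda>z. ennreal (measure (\<kappa> z) A)) \<in> borel_measurable (bsp Z)" by simp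
    then show ?thesis
    proof (rule measurable_cong[THEN iffD1, rotated])
      fix z assume "z \<in> space (bsp Z)"
      then interpret prob_space "\<kappa> z" using pmsD(1)[OF \<kappa>(2)[of z]] by simp
      show "ennreal (measure (\<kappa> z) A) = emeasure (\<kappa> z) A" by (simp add: emeasure_eq_measure)
    qed
  qed (use C in simp)
qed

section \<open>Transport duality on a compact set\<close>

text \<open>The c-transform of \<open>\<phi>\<close> for the cost
  \<open>lam * norm (x' - y) ^ q\<close>.\<close>

definition dual_inf :: "'a::euclidean_space set \<Rightarrow> nat \<Rightarrow> ('a \<Rightarrow> real) \<Rightarrow> real \<Rightarrow> 'a \<Rightarrow> real" where
  "dual_inf X q \<phi> lam x' = (INF y\<in>X. \<phi> y + lam * norm (x' - y) ^ q)"

text \<open>The Lagrangian dual function of minimising the integral of \<open>\<phi>\<close> over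
  the transport ball of radius \<open>e\<close> around \<open>P\<close>; \<open>lam\<close> prices
  the budget \<open>e ^ q\<close>.\<close>

definition dual_val ::
  "'a::euclidean_space set \<Rightarrow> nat \<Rightarrow> real \<Rightarrow> 'a measure \<Rightarrow> ('a \<Rightarrow> real) \<Rightarrow> real \<Rightarrow> real" where
  "dual_val X q e P \<phi> lam = (\<integral>x'. dual_inf X q \<phi> lam x' \<partial>P) - e ^ q * lam"

definition dual_sup ::
  "'a::euclidean_space set \<Rightarrow> nat \<Rightarrow> real \<Rightarrow> 'a measure \<Rightarrow> ('a \<Rightarrow> real) \<Rightarrow> real" where
  "dual_sup X q e P \<phi> = (SUP lam\<in>{0..}. dual_val X q e P \<phi> lam)"

text \<open>
  Weights \<open>w y x'\<close> of a kernel sending \<open>x'\<close> to \<open>\<Sum>y\<in>D. w y x' \<cdot> \<delta>\<^sub>y\<close>. Continuity in \<open>x'\<close> is what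
  lets one kernel serve a whole neighbourhood of nominal measures in the weak topology.
\<close>

definition mixing :: "'a::euclidean_space set \<Rightarrow> 'a set \<Rightarrow> ('a \<Rightarrow> 'a \<Rightarrow> real) \<Rightarrow> bool" where
  "mixing X D w \<longleftrightarrow> finite D \<and> D \<subseteq> X \<and> (\<forall>y. continuous_on X (w y)) \<and>
     (\<forall>y. \<forall>x\<in>X. 0 \<le> w y x) \<and> (\<forall>y. y \<notin> D \<longrightarrow> (\<forall>x\<in>X. w y x = 0)) \<and> (\<forall>x\<in>X. (\<Sum>y\<in>D. w y x) = 1)"

text \<open>The weights live on \<open>count_space D\<close>, where every function is measurable;
  pushing forward along the identity moves the point masses to the Borel sets of
  \<open>X\<close>.\<close>

definition mix_kernel ::
  "'a::euclidean_space set \<Rightarrow> 'a set \<Rightarrow> ('a \<Rightarrow> 'a \<Rightarrow> real) \<Rightarrow> 'a \<Rightarrow> 'a measure" where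
  "mix_kernel X D w x' = distr (density (count_space D) (\<lambda>y. ennreal (w y x'))) (bsp X) (\<lambda>y. y)"

lemma continuous_on_cost:
  fixes X :: "'a::euclidean_space set"
  shows "continuous_on S (\<lambda>(x', y). norm (x' - y) ^ q :: real)"
  unfolding case_prod_beta' by (intro continuous_intros)

lemma mixingD:
  assumes "mixing X D w"
  shows "finite D" "D \<subseteq> X" "continuous_on X (w y)" "x \<in> X \<Longrightarrow> 0 \<le> w y x" "y \<notin> D \<Longrightarrow> x \<in> X \<Longrightarrow> w y x = 0"
    "x \<in> X \<Longrightarrow> (\<Sum>y\<in>D. w y x) = 1"
  using assms unfolding mixing_def by blast+

lemma mixing_sum_mono_neutral:
  assumes w: "mixing X D w" and E: "D \<subseteq> E" "finite E" and x: "x \<in> X"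
  shows "(\<Sum>y\<in>E. w y x * \<psi> y) = (\<Sum>y\<in>D. w y x * \<psi> y)"
  using mixingD[OF w] x by (intro sum.mono_neutral_right E) auto

text \<open>Weights vanish off their support, so both families can be summed over the union of the
  supports. This is what makes the set of attainable pairs convex.\<close>

lemma mixing_convex:
  assumes w: "mixing X D w" and v: "mixing X E v" and uv: "0 \<le> a" "0 \<le> b" "a + b = 1"
  shows "mixing X (D \<union> E) (\<lambda>y x. a * w y x + b * v y x)"
proof -
  have 1: "(\<Sum>y\<in>D \<union> E. w y x) = 1" "(\<Sum>y\<in>D \<union> E. v y x) = 1" if "x \<in> X" for x
    using mixing_sum_mono_neutral[OF w, of "D \<union> E" x "\<lambda>_. 1"] mixing_sum_mono_neutral[OF v, of "D \<union> E" x "\<lambda>_. 1"]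
      mixingD(1,6)[OF w] mixingD(1,6)[OF v] that by auto
  show ?thesis
    unfolding mixing_def
    using mixingD(1-5)[OF w] mixingD(1-5)[OF v] uv 1
    by (auto intro!: continuous_intros simp: sum.distrib sum_distrib_left[symmetric])
qed

lemma mixing_sum_continuous:
  assumes w: "mixing X D w" and \<psi>: "continuous_on (X \<times> X) (\<lambda>(x', y). \<psi> x' y)"
  shows "continuous_on X (\<lambda>x'. \<Sum>y\<in>D. w y x' * \<psi> x' y)"
proof (intro continuous_intros mixingD[OF w])
  fix y assume "y \<in> D"
  then have "continuous_on X ((\<lambda>(x', y). \<psi> x' y) \<circ> (\<lambda>x'. (x', y)))"
    using mixingD(2)[OF w]
    by (intro continuous_on_compose continuous_intros continuous_on_subset[OF \<psi>]) auto
  then show "continuous_on X (\<lambda>x'. \<psi> x' y)" by (simp add: o_def)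
qed

text \<open>A partition of unity: on a finite net \<open>D\<close>, the point \<open>y\<close> is
  weighted by its slack \<open>m x' + \<delta> - \<psi> x' y\<close>, cut off at 0. Only points
  within \<delta> of the infimum receive weight, and by uniform continuity a net point close to a
  minimiser has positive slack, so the total never vanishes.\<close>

lemma mixing_near_inf:
  fixes X :: "'a::euclidean_space set" and \<psi> :: "'a \<Rightarrow> 'a \<Rightarrow> real"
  assumes X: "compact X" "X \<noteq> {}" and \<psi>: "continuous_on (X \<times> X) (\<lambda>(x', y). \<psi> x' y)" and \<delta>: "\<delta> > 0"
  shows "\<exists>D w. mixing X D w \<and> (\<forall>x'\<in>X. (\<Sum>y\<in>D. w y x' * \<psi> x' y) \<le> (INF y\<in>X. \<psi> x' y) + \<delta>)"
proof -
  have "uniformly_continuous_on (X \<times> X) (\<lambda>(x', y). \<psi> x' y)"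
    by (intro compact_uniformly_continuous \<psi> compact_Times X)
  then obtain d where d: "d > 0"
    "\<And>p p'. p \<in> X \<times> X \<Longrightarrow> p' \<in> X \<times> X \<Longrightarrow> dist p' p < d \<Longrightarrow>
       dist (case p' of (x', y) \<Rightarrow> \<psi> x' y) (case p of (x', y) \<Rightarrow> \<psi> x' y) < \<delta> / 2"
    unfolding uniformly_continuous_on_def using \<delta> by (meson half_gt_zero)
  obtain D where D: "finite D" "D \<subseteq> X" "X \<subseteq> (\<Union>y\<in>D. ball y d)"
    using seq_compact_imp_totally_bounded[of X] X(1) d(1) by (auto simp: compact_eq_seq_compact_metric)
  define m where "m x' = (INF y\<in>X. \<psi> x' y)" for x'
  define g where "g y x' = (if y \<in> D then max 0 (m x' + \<delta> - \<psi> x' y) else 0)" for y x'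
  define S where "S x' = (\<Sum>y\<in>D. g y x')" for x'
  define w where "w y x' = g y x' / S x'" for y x'
  have mc: "continuous_on X m"
    unfolding m_def by (rule continuous_on_INF_compact[OF \<psi> X])
  have \<psi>y: "continuous_on X (\<lambda>x'. \<psi> x' y)" if "y \<in> X" for y
  proof -
    have "continuous_on X ((\<lambda>(x', y). \<psi> x' y) \<circ> (\<lambda>x'. (x', y)))"
      using that by (intro continuous_on_compose continuous_intros continuous_on_subset[OF \<psi>]) auto
    then show ?thesis by (simp add: o_def)
  qed
  have gc: "continuous_on X (g y)" for y
  proof (cases "y \<in> D")
    case True
    then have "continuous_on X (\<lambda>x'. max 0 (m x' + \<delta> - \<psi> x' y))"
      using D(2) by (intro continuous_intros mc \<psi>y) auto
    then show ?thesis using True by (simp add: g_def[abs_def])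
  qed (simp add: g_def[abs_def])
  have g0: "g y x' \<ge> 0" for y x' by (simp add: g_def)
  have Spos: "S x' > 0" if x': "x' \<in> X" for x'
  proof -
    have "\<exists>y\<in>X. \<forall>z\<in>X. \<psi> x' y \<le> \<psi> x' z"
      using continuous_attains_inf[OF X continuous_on_slice[OF \<psi> x']] .
    then obtain y where y: "y \<in> X" "\<And>z. z \<in> X \<Longrightarrow> \<psi> x' y \<le> \<psi> x' z" by auto
    have my: "\<psi> x' y \<le> m x'" unfolding m_def using y X by (intro cINF_greatest) auto
    obtain y' where y': "y' \<in> D" "dist y' y < d" using y(1) D(3) by auto
    have "\<bar>\<psi> x' y' - \<psi> x' y\<bar> < \<delta> / 2"
      using d(2)[of "(x', y)" "(x', y')"] x' y y' D(2) by (auto simp: dist_prod_def dist_real_def)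
    then have "m x' + \<delta> - \<psi> x' y' > 0" using my \<delta> unfolding abs_less_iff by linarith
    then have "0 < g y' x'" using y' by (simp add: g_def)
    then show ?thesis unfolding S_def using g0 y'(1) D(1) by (intro sum_pos2) auto
  qed
  have mix: "mixing X D w"
    unfolding mixing_def
  proof (intro conjI allI ballI impI)
    show "continuous_on X (w y)" for y
      unfolding w_def S_def using Spos by (intro continuous_intros gc) (metis S_def less_irrefl)
    show "0 \<le> w y x" if "x \<in> X" for x y
      using g0 Spos[OF that] by (simp add: w_def)
    show "w y x = 0" if "y \<notin> D" for x y
      using that by (simp add: w_def g_def)
    show "(\<Sum>y\<in>D. w y x) = 1" if "x \<in> X" for x
      using Spos[OF that] by (simp add: w_def sum_divide_distrib[symmetric] S_def)
  qed (use D in auto)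
  moreover have "(\<Sum>y\<in>D. w y x' * \<psi> x' y) \<le> m x' + \<delta>" if x': "x' \<in> X" for x'
  proof -
    have "w y x' * \<psi> x' y \<le> w y x' * (m x' + \<delta>)" if "y \<in> D" for y
      using Spos[OF x'] that
      by (cases "m x' + \<delta> - \<psi> x' y \<le> 0")
        (auto simp: w_def g_def intro!: mult_left_mono divide_right_mono)
    then have "(\<Sum>y\<in>D. w y x' * \<psi> x' y) \<le> (\<Sum>y\<in>D. w y x' * (m x' + \<delta>))"
      by (intro sum_mono)
    also have "\<dots> = m x' + \<delta>"
      using mixingD(6)[OF mix x'] by (simp add: sum_distrib_right[symmetric])
    finally show ?thesis .
  qed
  ultimately show ?thesis unfolding m_def by blast
qed

section \<open>Weak and strong duality for the transport ball\<close>

locale transport_ball =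
  fixes X :: "'a::euclidean_space set" and q :: nat and e :: real
  assumes X: "compact X" "X \<noteq> {}" and q: "q \<ge> 1" and e: "e > 0"
begin

lemma eq_pos: "e ^ q > 0"
  using e by simp

lemma zero_power: "(0::real) ^ q = 0"
  using q by simp

lemma integrand_continuous:
  assumes "continuous_on X \<phi>"
  shows "continuous_on (X \<times> X) (\<lambda>(x', y). \<phi> y + lam * norm (x' - y) ^ q)"
  unfolding case_prod_beta'
  by (intro continuous_intros continuous_on_compose2[OF assms]) auto

lemma dual_inf_continuous:
  assumes "continuous_on X \<phi>"
  shows "continuous_on X (dual_inf X q \<phi> lam)"
  unfolding dual_inf_def[abs_def]
  by (rule continuous_on_INF_compact[OF integrand_continuous[OF assms] X])

lemma dual_inf_le:
  assumes "continuous_on X \<phi>" "y \<in> X"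
  shows "x' \<in> X \<Longrightarrow> dual_inf X q \<phi> lam x' \<le> \<phi> y + lam * norm (x' - y) ^ q"
  unfolding dual_inf_def
  by (intro cINF_lower assms bdd_below_image_compact X continuous_on_slice[OF integrand_continuous[OF assms(1)]])

text \<open>Choosing \<open>y = x'\<close> costs \<open>0 ^ q = 0\<close>. The remaining linear term
  forces the dual function down as \<open>lam\<close> grows, which later confines the supremum to a
  compact interval.\<close>

lemma dual_val_le:
  assumes "continuous_on X \<phi>" "P \<in> pms X" "\<And>x. x \<in> X \<Longrightarrow> \<phi> x \<le> B"
  shows "dual_val X q e P \<phi> lam \<le> B - e ^ q * lam"
proof -
  have "dual_inf X q \<phi> lam x \<le> B" if "x \<in> X" for x
    using dual_inf_le[OF assms(1) that that, of lam] assms(3)[OF that] zero_power by simp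
  then have "(\<integral>x'. dual_inf X q \<phi> lam x' \<partial>P) \<le> (\<integral>x'. B \<partial>P)"
    by (intro pms_integral_mono[OF assms(2)] pms_integrable[OF assms(2)] X dual_inf_continuous assms) auto
  then show ?thesis
    unfolding dual_val_def pms_integral_const[OF assms(2)] by simp
qed

lemma dual_val_bdd_above:
  assumes "continuous_on X \<phi>" "P \<in> pms X"
  shows "bdd_above (dual_val X q e P \<phi> ` {0..})"
proof -
  obtain B where B: "\<And>x. x \<in> X \<Longrightarrow> \<bar>\<phi> x\<bar> \<le> B"
    using compact_abs_bound[OF X(1) assms(1)] by auto
  show ?thesis
  proof (rule bdd_aboveI2)
    fix lam :: real assume "lam \<in> {0..}"
    then have "0 \<le> e ^ q * lam" using eq_pos by auto
    moreover have "dual_val X q e P \<phi> lam \<le> B - e ^ q * lam"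
      using B by (intro dual_val_le assms) (force simp: abs_le_iff)
    ultimately show "dual_val X q e P \<phi> lam \<le> B" by linarith
  qed
qed

lemma dual_val_le_sup:
  assumes "continuous_on X \<phi>" "P \<in> pms X" "0 \<le> lam"
  shows "dual_val X q e P \<phi> lam \<le> dual_sup X q e P \<phi>"
  unfolding dual_sup_def using assms by (intro cSUP_upper dual_val_bdd_above) auto

text \<open>Shows that the real infimum in \<open>wasserstein\<close> ranges over a nonempty
  set.\<close>

lemma product_coupling:
  assumes "P \<in> pms X" "Q \<in> pms X"
  shows "Q \<Otimes>\<^sub>M P \<in> couplings Q P"
proof -
  interpret P: prob_space P using pmsD[OF assms(1)] by simp
  interpret Q: prob_space Q using pmsD[OF assms(2)] by simp
  interpret QP: pair_prob_space Q P ..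
  have "distr (Q \<Otimes>\<^sub>M P) P snd = P"
  proof (intro measure_eqI)
    fix A assume A: "A \<in> sets (distr (Q \<Otimes>\<^sub>M P) P snd)"
    from A have "emeasure (distr (Q \<Otimes>\<^sub>M P) P snd) A = emeasure (Q \<Otimes>\<^sub>M P) (space Q \<times> A)"
      by (auto simp add: emeasure_distr space_pair_measure dest: sets.sets_into_space intro!: arg_cong2[where f=emeasure])
    with A show "emeasure (distr (Q \<Otimes>\<^sub>M P) P snd) A = emeasure P A"
      by (simp add: P.emeasure_pair_measure_Times Q.emeasure_space_1)
  qed simp
  then show ?thesis
    by (auto simp: couplings_def space_prob_algebra P.distr_pair_fst QP.P.prob_space_axioms)
qed

lemma couplingD:
  assumes "P \<in> pms X" "Q \<in> pms X" "\<gamma> \<in> couplings Q P"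
  shows "prob_space \<gamma>" "sets \<gamma> = sets (bsp X \<Otimes>\<^sub>M bsp X)" "space \<gamma> = X \<times> X"
proof -
  show 1: "sets \<gamma> = sets (bsp X \<Otimes>\<^sub>M bsp X)"
    using assms pmsD(2)[OF assms(1)] pmsD(2)[OF assms(2)]
    by (auto simp: couplings_def space_prob_algebra cong: sets_pair_measure_cong)
  show "space \<gamma> = X \<times> X"
    using sets_eq_imp_space_eq[OF 1] by (simp add: space_pair_measure)
  show "prob_space \<gamma>" using assms(3) by (auto simp: couplings_def space_prob_algebra)
qed

lemma cost_measurable: "(\<lambda>z. norm (fst z - snd z) ^ q :: real) \<in> borel_measurable (bsp X \<Otimes>\<^sub>M bsp X)"
proof -
  have [measurable]: "fst \<in> bsp X \<Otimes>\<^sub>M bsp X \<rightarrow>\<^sub>M (borel :: 'a measure)" "snd \<in> bsp X \<Otimes>\<^sub>M bsp X \<rightarrow>\<^sub>M (borel :: 'a measure)"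
    by (rule measurable_compose[OF measurable_fst] measurable_compose[OF measurable_snd],
        rule measurable_restrict_space1, simp)+
  show ?thesis by measurable
qed

lemma cost_bound: "\<exists>B. \<forall>x\<in>X. \<forall>y\<in>X. norm (x - y) ^ q \<le> B"
proof -
  obtain B where "\<And>k. k \<in> X \<times> X \<Longrightarrow> \<bar>case k of (x', y) \<Rightarrow> norm (x' - y) ^ q\<bar> \<le> B"
    using compact_abs_bound[OF compact_Times[OF X(1) X(1)] continuous_on_cost] by metis
  then show ?thesis by (intro exI[of _ B]) (fastforce simp: abs_le_iff)
qed

text \<open>Integrate the pointwise bound \<open>dual_inf_le\<close> against a coupling of
  \<open>Q\<close> and \<open>P\<close>. No optimal coupling is claimed to exist, so a near-optimal
  one is used and its excess cost is sent to 0.\<close>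

lemma weak_duality:
  assumes P: "P \<in> pms X" and Q: "Q \<in> pms X" and W: "wasserstein q Q P \<le> e"
    and \<phi>: "continuous_on X \<phi>"
  shows "dual_sup X q e P \<phi> \<le> integral\<^sup>L Q \<phi>"
  unfolding dual_sup_def
proof (rule cSUP_least)
  fix lam :: real assume "lam \<in> {0..}"
  then have lam: "lam \<ge> 0" by simp
  define c where "c \<gamma> = (\<integral>z. norm (fst z - snd z) ^ q \<partial>\<gamma>)" for \<gamma> :: "('a \<times> 'a) measure"
  have c0: "c \<gamma> \<ge> 0" for \<gamma> unfolding c_def by simp
  have ne: "couplings Q P \<noteq> {}" using product_coupling[OF P Q] by auto
  have bdd: "bdd_below (c ` couplings Q P)" using c0 by (intro bdd_belowI2[of _ 0])
  define I where "I = (INF \<gamma>\<in>couplings Q P. c \<gamma>)"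
  have I0: "I \<ge> 0" unfolding I_def using ne c0 by (intro cINF_greatest)
  have "root q I \<le> e" using W unfolding wasserstein_def I_def c_def .
  then have "root q I ^ q \<le> e ^ q" using I0 q by (intro power_mono) auto
  then have Ie: "I \<le> e ^ q" using I0 q by simp
  show "dual_val X q e P \<phi> lam \<le> integral\<^sup>L Q \<phi>"
  proof (rule field_le_epsilon)
    fix d :: real assume d: "d > 0"
    \<comment> \<open>The excess is multiplied by \<open>lam\<close>; adding 1 covers the case
      \<open>lam = 0\<close>.\<close>
    define d' where "d' = d / (lam + 1)"
    have d': "d' > 0" "lam * d' \<le> d" using d lam by (auto simp: d'_def field_simps)
    obtain \<gamma> where \<gamma>: "\<gamma> \<in> couplings Q P" "c \<gamma> < I + d'"
      using cINF_less_iff[OF ne bdd, of "I + d'"] d' unfolding I_def by auto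
    note gd = couplingD[OF P Q \<gamma>(1)]
    interpret g: prob_space \<gamma> by fact
    have dist: "distr \<gamma> Q fst = Q" "distr \<gamma> P snd = P" using \<gamma>(1) by (auto simp: couplings_def)
    have mfst: "fst \<in> \<gamma> \<rightarrow>\<^sub>M Q" and msnd: "snd \<in> \<gamma> \<rightarrow>\<^sub>M P"
      using gd(2) pmsD(2)[OF P] pmsD(2)[OF Q] by (simp_all cong: measurable_cong_sets)
    have \<phi>m: "\<phi> \<in> borel_measurable Q"
      using bsp_measurableI[OF \<phi>] pmsD(2)[OF Q] by (simp cong: measurable_cong_sets)
    have mm: "dual_inf X q \<phi> lam \<in> borel_measurable P"
      using bsp_measurableI[OF dual_inf_continuous[OF \<phi>]] pmsD(2)[OF P] by (simp cong: measurable_cong_sets)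
    have iQ: "integral\<^sup>L Q \<phi> = (\<integral>z. \<phi> (fst z) \<partial>\<gamma>)"
      by (subst dist(1)[symmetric], rule integral_distr[OF mfst \<phi>m])
    have iP: "integral\<^sup>L P (dual_inf X q \<phi> lam) = (\<integral>z. dual_inf X q \<phi> lam (snd z) \<partial>\<gamma>)"
      by (subst dist(2)[symmetric], rule integral_distr[OF msnd mm])
    have iiQ: "integrable \<gamma> (\<lambda>z. \<phi> (fst z))"
      using integrable_distr_eq[OF mfst \<phi>m] dist(1) pms_integrable[OF Q X(1) \<phi>] by simp
    have iiP: "integrable \<gamma> (\<lambda>z. dual_inf X q \<phi> lam (snd z))"
      using integrable_distr_eq[OF msnd mm] dist(2) pms_integrable[OF P X(1) dual_inf_continuous[OF \<phi>]] by simp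
    obtain B where B: "\<And>x y. x \<in> X \<Longrightarrow> y \<in> X \<Longrightarrow> norm (x - y) ^ q \<le> B" using cost_bound by auto
    have ic: "integrable \<gamma> (\<lambda>z. norm (fst z - snd z) ^ q)"
      using cost_measurable gd B by (intro g.integrable_const_bound[where B=B] AE_I2)
        (auto cong: measurable_cong_sets)
    have "(\<integral>z. dual_inf X q \<phi> lam (snd z) \<partial>\<gamma>) \<le> (\<integral>z. \<phi> (fst z) + lam * norm (fst z - snd z) ^ q \<partial>\<gamma>)"
      using gd(3) dual_inf_le[OF \<phi>]
      by (intro integral_mono iiP Bochner_Integration.integrable_add iiQ integrable_mult_right ic)
        (auto simp: norm_minus_commute)
    also have "\<dots> = integral\<^sup>L Q \<phi> + lam * c \<gamma>"
      using iiQ ic unfolding iQ c_def by simp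
    also have "\<dots> \<le> integral\<^sup>L Q \<phi> + lam * (e ^ q + d')"
      using \<gamma>(2) Ie lam by (intro add_left_mono mult_left_mono) auto
    finally show "dual_val X q e P \<phi> lam \<le> integral\<^sup>L Q \<phi> + d"
      using d'(2) unfolding dual_val_def iP by (simp add: algebra_simps)
  qed
qed simp

lemma mixing_integrable:
  assumes "mixing X D w" "P \<in> pms X" "continuous_on (X \<times> X) (\<lambda>(x', y). \<psi> x' y)"
  shows "integrable P (\<lambda>x'. \<Sum>y\<in>D. w y x' * \<psi> x' y)"
  by (intro pms_integrable[OF assms(2) X(1)] mixing_sum_continuous assms)

text \<open>Otherwise the attainable pairs avoid the open quadrant below the corner
  \<open>(e ^ q, g)\<close>. The separating normal \<open>(a, b)\<close> is nonnegative because the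
  quadrant is unbounded downwards, and \<open>b > 0\<close> because some mixture is strictly
  feasible. Then \<open>a / b\<close> is a multiplier whose dual value exceeds
  \<open>dual_sup\<close>, which is absurd.\<close>

lemma strong_duality_mixing:
  assumes P: "P \<in> pms X" and \<phi>: "continuous_on X \<phi>" and \<delta>: "\<delta> > 0"
  shows "\<exists>D w. mixing X D w \<and> (\<integral>x'. (\<Sum>y\<in>D. w y x' * norm (x' - y) ^ q) \<partial>P) < e ^ q \<and>
     (\<integral>x'. (\<Sum>y\<in>D. w y x' * \<phi> y) \<partial>P) < dual_sup X q e P \<phi> + \<delta>"
proof (rule ccontr)
  assume no: "\<not> ?thesis"
  define cost where "cost D w = (\<integral>x'. (\<Sum>y\<in>D. w y x' * norm (x' - y) ^ q) \<partial>P)" for D w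
  define obj where "obj D w = (\<integral>x'. (\<Sum>y\<in>D. w y x' * \<phi> y) \<partial>P)" for D w
  define g where "g = dual_sup X q e P \<phi> + \<delta>"
  define C where "C = {(cost D w, obj D w) | D w. mixing X D w}"
  have \<phi>2: "continuous_on (X \<times> X) (\<lambda>(x', y). \<phi> y)"
    unfolding case_prod_beta' by (intro continuous_intros continuous_on_compose2[OF \<phi>]) auto
  have cc: "continuous_on (X \<times> X) (\<lambda>(x', y::'a). norm (x' - y) ^ q)" by (rule continuous_on_cost)
  have lin: "(\<integral>x'. (\<Sum>y\<in>D \<union> E. (a * w y x' + b * v y x') * \<psi> x' y) \<partial>P)
      = a * (\<integral>x'. (\<Sum>y\<in>D. w y x' * \<psi> x' y) \<partial>P) + b * (\<integral>x'. (\<Sum>y\<in>E. v y x' * \<psi> x' y) \<partial>P)"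
    if w: "mixing X D w" and v: "mixing X E v" and \<psi>: "continuous_on (X \<times> X) (\<lambda>(x', y). \<psi> x' y)"
    for D E w v a b and \<psi> :: "'a \<Rightarrow> 'a \<Rightarrow> real"
  proof -
    have "(\<integral>x'. (\<Sum>y\<in>D \<union> E. (a * w y x' + b * v y x') * \<psi> x' y) \<partial>P)
      = (\<integral>x'. a * (\<Sum>y\<in>D. w y x' * \<psi> x' y) + b * (\<Sum>y\<in>E. v y x' * \<psi> x' y) \<partial>P)"
    proof (rule Bochner_Integration.integral_cong[OF refl])
      fix x assume "x \<in> space P"
      then have x: "x \<in> X" using pmsD[OF P] by simp
      have f: "finite (D \<union> E)" using mixingD(1)[OF w] mixingD(1)[OF v] by simp
      show "(\<Sum>y\<in>D \<union> E. (a * w y x + b * v y x) * \<psi> x y)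
          = a * (\<Sum>y\<in>D. w y x * \<psi> x y) + b * (\<Sum>y\<in>E. v y x * \<psi> x y)"
        using mixing_sum_mono_neutral[OF w _ f x, of "\<psi> x"] mixing_sum_mono_neutral[OF v _ f x, of "\<psi> x"]
        by (simp add: sum.distrib distrib_right mult.assoc flip: sum_distrib_left)
    qed
    also have "\<dots> = a * (\<integral>x'. (\<Sum>y\<in>D. w y x' * \<psi> x' y) \<partial>P) + b * (\<integral>x'. (\<Sum>y\<in>E. v y x' * \<psi> x' y) \<partial>P)"
      using mixing_integrable[OF w P \<psi>] mixing_integrable[OF v P \<psi>] by simp
    finally show ?thesis .
  qed
  have "convex C"
  proof (rule convexI)
    fix p p' and a b :: real assume "p \<in> C" "p' \<in> C" and ab: "0 \<le> a" "0 \<le> b" "a + b = 1"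
    then obtain D w E v where w: "mixing X D w" "p = (cost D w, obj D w)" and v: "mixing X E v" "p' = (cost E v, obj E v)"
      unfolding C_def by auto
    have "a *\<^sub>R p + b *\<^sub>R p' = (cost (D \<union> E) (\<lambda>y x. a * w y x + b * v y x), obj (D \<union> E) (\<lambda>y x. a * w y x + b * v y x))"
      unfolding w v cost_def obj_def lin[OF w(1) v(1) cc] lin[OF w(1) v(1) \<phi>2] by simp
    then show "a *\<^sub>R p + b *\<^sub>R p' \<in> C"
      unfolding C_def using mixing_convex[OF w(1) v(1) ab] by blast
  qed
  moreover have "convex ({..<e ^ q} \<times> {..<g})" by (intro convex_Times) auto
  \<comment> \<open>Used twice: with the bare cost to find a strictly feasible mixture, and with the
    Lagrangian integrand at the multiplier.\<close>
  moreover have near: "\<exists>D w. mixing X D w \<and>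
      (\<integral>x'. (\<Sum>y\<in>D. w y x' * \<psi> x' y) \<partial>P) \<le> (\<integral>x'. (INF y\<in>X. \<psi> x' y) \<partial>P) + d"
    if \<psi>: "continuous_on (X \<times> X) (\<lambda>(x', y). \<psi> x' y)" and d: "d > 0" for \<psi> :: "'a \<Rightarrow> 'a \<Rightarrow> real" and d
  proof -
    obtain D w where w: "mixing X D w" "\<And>x'. x' \<in> X \<Longrightarrow> (\<Sum>y\<in>D. w y x' * \<psi> x' y) \<le> (INF y\<in>X. \<psi> x' y) + d"
      using mixing_near_inf[OF X \<psi> d] by auto
    have i: "integrable P (\<lambda>x'. INF y\<in>X. \<psi> x' y)"
      by (intro pms_integrable[OF P X(1)] continuous_on_INF_compact[OF \<psi> X])
    interpret prob_space P using pmsD[OF P] by simp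
    have "(\<integral>x'. (\<Sum>y\<in>D. w y x' * \<psi> x' y) \<partial>P) \<le> (\<integral>x'. (INF y\<in>X. \<psi> x' y) + d \<partial>P)"
      using w(2) i by (intro pms_integral_mono[OF P] mixing_integrable[OF w(1) P \<psi>]) auto
    also have "\<dots> = (\<integral>x'. (INF y\<in>X. \<psi> x' y) \<partial>P) + d"
      using i by (simp add: prob_space)
    finally show ?thesis using w(1) by blast
  qed
  \<comment> \<open>The Slater point. The identity plan has cost 0 but need not be a finite mixture,
    so it is approximated to within half the budget.\<close>
  obtain D0 w0 where w0: "mixing X D0 w0" "cost D0 w0 < e ^ q"
  proof -
    obtain D w where w: "mixing X D w" "cost D w \<le> (\<integral>x'. (INF y\<in>X. norm (x' - y) ^ q) \<partial>P) + e ^ q / 2"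
      using near[OF cc, of "e ^ q / 2"] eq_pos unfolding cost_def by auto
    have "(INF y\<in>X. norm (x' - y) ^ q) \<le> norm (x' - x') ^ q" if "x' \<in> X" for x'
      using that by (intro cINF_lower bdd_below_image_compact X continuous_on_slice[OF cc])
    then have "(\<integral>x'. (INF y\<in>X. norm (x' - y) ^ q) \<partial>P) \<le> (\<integral>x'. 0 \<partial>P)"
      using zero_power by (intro pms_integral_mono[OF P] pms_integrable[OF P X(1)] continuous_on_INF_compact[OF cc X]) auto
    then have "cost D w < e ^ q" using w(2) eq_pos by simp
    then show thesis using that w(1) by blast
  qed
  moreover have "C \<noteq> {}" using w0(1) unfolding C_def by blast
  moreover have "{..<e ^ q} \<times> {..<g} \<noteq> {}" by (auto intro: lt_ex)
  moreover have "C \<inter> {..<e ^ q} \<times> {..<g} = {}"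
    using no unfolding C_def g_def cost_def obj_def by fastforce
  ultimately have "\<exists>ab k. ab \<noteq> 0 \<and> (\<forall>p\<in>{..<e ^ q} \<times> {..<g}. ab \<bullet> p \<le> k) \<and> (\<forall>p\<in>C. ab \<bullet> p \<ge> k)"
    by (intro separating_hyperplane_sets) auto
  then obtain ab k where ab: "ab \<noteq> 0" "\<And>p. p \<in> {..<e ^ q} \<times> {..<g} \<Longrightarrow> ab \<bullet> p \<le> k"
    "\<And>p. p \<in> C \<Longrightarrow> k \<le> ab \<bullet> p"
    by blast
  obtain a b where [simp]: "ab = (a, b)" by (cases ab)
  have quad: "a * s + b * u \<le> k" if "s < e ^ q" "u < g" for s u
    using ab(2)[of "(s, u)"] that by simp
  have Ck: "k \<le> a * cost D w + b * obj D w" if "mixing X D w" for D w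
    using ab(3)[of "(cost D w, obj D w)"] that unfolding C_def by auto
  have a0: "a \<ge> 0"
  proof (rule ccontr)
    assume "\<not> a \<ge> 0"
    then have an: "a < 0" by simp
    \<comment> \<open>With \<open>a < 0\<close>, moving far to the left inside the quadrant raises
      \<open>a * s\<close>; this \<open>s\<close> lifts the linear form to at least
      \<open>k + 1\<close>.\<close>
    define s where "s = min (e ^ q - 1) ((k + 1 - b * (g - 1)) / a)"
    have "s \<le> (k + 1 - b * (g - 1)) / a" by (simp add: s_def)
    then have "a * s \<ge> k + 1 - b * (g - 1)" using an by (simp add: field_simps)
    moreover have "a * s + b * (g - 1) \<le> k" by (rule quad) (auto simp: s_def)
    ultimately show False by linarith
  qed
  have b0: "b \<ge> 0"
  proof (rule ccontr)
    assume "\<not> b \<ge> 0"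
    then have an: "b < 0" by simp
    define s where "s = min (g - 1) ((k + 1 - a * (e ^ q - 1)) / b)"
    have "s \<le> (k + 1 - a * (e ^ q - 1)) / b" by (simp add: s_def)
    then have "b * s \<ge> k + 1 - a * (e ^ q - 1)" using an by (simp add: field_simps)
    moreover have "a * (e ^ q - 1) + b * s \<le> k" by (rule quad) (auto simp: s_def)
    ultimately show False by linarith
  qed
  have corner: "a * e ^ q + b * g \<le> k"
  proof (rule field_le_epsilon)
    fix d :: real assume d: "d > 0"
    \<comment> \<open>The corner itself is outside the open quadrant; stepping back by
      \<open>d'\<close> in both coordinates changes the linear form by
      \<open>(a + b) * d' \<le> d\<close>.\<close>
    define d' where "d' = d / (a + b + 1)"
    have d': "d' > 0" "(a + b) * d' \<le> d" using d a0 b0 by (auto simp: d'_def field_simps)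
    show "a * e ^ q + b * g \<le> k + d"
      using quad[of "e ^ q - d'" "g - d'"] d' by (simp add: algebra_simps)
  qed
  \<comment> \<open>A vertical line cannot separate, since the Slater point lies strictly on the
    quadrant's side of it.\<close>
  have b_pos: "b > 0"
  proof (rule ccontr)
    assume "\<not> b > 0"
    then have [simp]: "b = 0" using b0 by simp
    have "a > 0" using a0 ab(1) by (auto simp: zero_prod_def)
    moreover have "a * e ^ q \<le> a * cost D0 w0"
      using corner Ck[OF w0(1)] by simp
    ultimately have "e ^ q \<le> cost D0 w0" by simp
    then show False using w0(2) by simp
  qed
  \<comment> \<open>A mixture minimising the Lagrangian at \<open>lam\<close> up to
    \<open>\<delta> / 2\<close> yields
    \<open>g \<le> dual_sup X q e P \<phi> + \<delta> / 2\<close>, whereas \<open>g\<close> was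
    placed a full \<delta> above.\<close>
  define lam where "lam = a / b"
  have lam: "lam \<ge> 0" using a0 b_pos by (simp add: lam_def)
  have key: "lam * e ^ q + g \<le> lam * cost D w + obj D w" if "mixing X D w" for D w
  proof -
    have "a * e ^ q + b * g \<le> a * cost D w + b * obj D w" using corner Ck[OF that] by linarith
    then have "(a * e ^ q + b * g) / b \<le> (a * cost D w + b * obj D w) / b"
      using b_pos by (intro divide_right_mono) auto
    then show ?thesis using b_pos by (simp add: lam_def add_divide_distrib)
  qed
  have d2: "\<delta> / 2 > 0" using \<delta> by simp
  obtain D w where w: "mixing X D w" "(\<integral>x'. (\<Sum>y\<in>D. w y x' * (\<phi> y + lam * norm (x' - y) ^ q)) \<partial>P)
      \<le> (\<integral>x'. dual_inf X q \<phi> lam x' \<partial>P) + \<delta> / 2"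
    using near[OF integrand_continuous[OF \<phi>, of lam] d2] unfolding dual_inf_def by blast
  have "(\<integral>x'. (\<Sum>y\<in>D. w y x' * (\<phi> y + lam * norm (x' - y) ^ q)) \<partial>P)
      = (\<integral>x'. (\<Sum>y\<in>D. w y x' * \<phi> y) + lam * (\<Sum>y\<in>D. w y x' * norm (x' - y) ^ q) \<partial>P)"
    by (simp add: sum.distrib sum_distrib_left distrib_left mult.left_commute)
  also have "\<dots> = obj D w + lam * cost D w"
    unfolding obj_def cost_def
    using mixing_integrable[OF w(1) P \<phi>2] mixing_integrable[OF w(1) P cc] by simp
  finally have "lam * e ^ q + g \<le> (\<integral>x'. dual_inf X q \<phi> lam x' \<partial>P) + \<delta> / 2"
    using key[OF w(1)] w(2) by linarith
  then have "g \<le> dual_val X q e P \<phi> lam + \<delta> / 2"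
    by (simp add: dual_val_def mult.commute)
  also have "\<dots> \<le> dual_sup X q e P \<phi> + \<delta> / 2"
    using dual_val_le_sup[OF \<phi> P lam] by simp
  finally show False using \<delta> unfolding g_def by simp
qed

end

section \<open>Near-optimal kernels\<close>

lemma measurable_mix_kernel_weight:
  assumes "mixing X D w"
  shows "(\<lambda>y. y) \<in> density (count_space D) (\<lambda>y. ennreal (w y x')) \<rightarrow>\<^sub>M bsp X"
proof -
  have "(\<lambda>y. y) \<in> count_space D \<rightarrow>\<^sub>M bsp X"
    using mixingD(2)[OF assms] by (auto simp: measurable_count_space_eq1)
  then show ?thesis by simp
qed

lemma mix_kernel_integral:
  fixes \<psi> :: "'a::euclidean_space \<Rightarrow> real"
  assumes w: "mixing X D w" and x: "x' \<in> X" and \<psi>: "\<psi> \<in> borel_measurable (bsp X)"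
  shows "integral\<^sup>L (mix_kernel X D w x') \<psi> = (\<Sum>y\<in>D. w y x' * \<psi> y)"
proof -
  have "integral\<^sup>L (mix_kernel X D w x') \<psi> = (\<integral>y. \<psi> y \<partial>density (count_space D) (\<lambda>y. ennreal (w y x')))"
    unfolding mix_kernel_def
    by (rule integral_distr[OF measurable_mix_kernel_weight[OF w] \<psi>])
  also have "\<dots> = (\<integral>y. w y x' *\<^sub>R \<psi> y \<partial>count_space D)"
    using mixingD(4)[OF w x] by (intro integral_density) auto
  also have "\<dots> = (\<Sum>y\<in>D. w y x' * \<psi> y)"
    using mixingD(1)[OF w] by (simp add: lebesgue_integral_count_space_finite)
  finally show ?thesis .
qed

lemma mix_kernel_emeasure:
  assumes w: "mixing X D w" and x: "x' \<in> X" and A: "A \<in> sets (bsp X)"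
  shows "emeasure (mix_kernel X D w x') A = ennreal (\<Sum>y\<in>D. w y x' * indicator A y)"
proof -
  have "emeasure (mix_kernel X D w x') A = (\<integral>\<^sup>+y. indicator A y \<partial>mix_kernel X D w x')"
    using A by (intro nn_integral_indicator[symmetric]) (simp add: mix_kernel_def)
  also have "\<dots> = (\<integral>\<^sup>+y. indicator A y \<partial>density (count_space D) (\<lambda>y. ennreal (w y x')))"
    unfolding mix_kernel_def using A
    by (intro nn_integral_distr measurable_mix_kernel_weight[OF w]) simp
  also have "\<dots> = (\<integral>\<^sup>+y. ennreal (w y x') * indicator A y \<partial>count_space D)"
    by (intro nn_integral_density) auto
  also have "\<dots> = (\<Sum>y\<in>D. ennreal (w y x') * indicator A y)"
    using mixingD(1)[OF w] by (simp add: nn_integral_count_space_finite)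
  also have "\<dots> = (\<Sum>y\<in>D. ennreal (w y x' * indicator A y))"
    by (intro sum.cong refl) (simp split: split_indicator)
  also have "\<dots> = ennreal (\<Sum>y\<in>D. w y x' * indicator A y)"
    using mixingD(4)[OF w x] by (intro sum_ennreal) auto
  finally show ?thesis .
qed

lemma mix_kernel_measurable:
  assumes w: "mixing X D w"
  shows "mix_kernel X D w \<in> bsp X \<rightarrow>\<^sub>M prob_algebra (bsp X)"
proof (intro measurable_prob_algebraI measurable_subprob_algebra)
  fix x' assume x': "x' \<in> space (bsp X)"
  have "emeasure (mix_kernel X D w x') X = 1"
  proof -
    have "(\<Sum>y\<in>D. w y x' * indicator X y) = (\<Sum>y\<in>D. w y x')"
      using mixingD(2)[OF w] by (intro sum.cong) (auto simp: indicator_def)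
    then show ?thesis
      using mix_kernel_emeasure[OF w, of x' X] mixingD(6)[OF w, of x'] x' sets.top[of "bsp X"] by simp
  qed
  then show "prob_space (mix_kernel X D w x')"
    by (intro prob_spaceI) (simp add: mix_kernel_def)
  then show "subprob_space (mix_kernel X D w x')" by (rule prob_space_imp_subprob_space)
  show "sets (mix_kernel X D w x') = sets (bsp X)" by (simp add: mix_kernel_def)
next
  fix A assume A: "A \<in> sets (bsp X)"
  have [measurable]: "w y \<in> borel_measurable (bsp X)" for y
    by (intro bsp_measurableI mixingD[OF w])
  have "(\<lambda>x'. ennreal (\<Sum>y\<in>D. w y x' * indicator A y)) \<in> borel_measurable (bsp X)"
    by measurable
  then show "(\<lambda>x'. emeasure (mix_kernel X D w x') A) \<in> borel_measurable (bsp X)"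
    by (rule measurable_cong[THEN iffD1, rotated]) (simp add: mix_kernel_emeasure[OF w _ A])
qed

lemma integral_bind_bounded:
  fixes f :: "'b \<Rightarrow> real"
  assumes P: "P \<in> space (prob_algebra M)" and \<kappa>: "\<kappa> \<in> M \<rightarrow>\<^sub>M prob_algebra N"
    and f: "f \<in> borel_measurable N" and B: "\<And>y. y \<in> space N \<Longrightarrow> \<bar>f y\<bar> \<le> B"
  shows "integral\<^sup>L (P \<bind> \<kappa>) f = (\<integral>x. integral\<^sup>L (\<kappa> x) f \<partial>P)"
proof -
  have P': "prob_space P" "sets P = sets M" using P by (auto simp: space_prob_algebra)
  then have \<kappa>': "\<kappa> \<in> P \<rightarrow>\<^sub>M subprob_algebra N"
    using measurable_prob_algebraD[OF \<kappa>] by (simp cong: measurable_cong_sets)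
  interpret prob_space P by fact
  have "AE x in P. emeasure (\<kappa> x) (space (\<kappa> x)) \<le> ennreal 1"
    using subprob_space.emeasure_space_le_1[OF subprob_space_kernel[OF \<kappa>']] by (intro AE_I2) simp
  then show ?thesis
    using B by (intro integral_bind[OF f _ \<kappa>' finite_measure_axioms, where B'=1]) auto
qed

context transport_ball
begin

lemma mix_bind_in_pms:
  assumes "P \<in> pms X" "mixing X D w"
  shows "P \<bind> mix_kernel X D w \<in> pms X"
  using prob_space_bind'[OF assms(1) mix_kernel_measurable[OF assms(2)]]
    sets_bind'[OF assms(1) mix_kernel_measurable[OF assms(2)]]
  by (simp add: space_prob_algebra)

lemma mix_bind_integral:
  assumes P: "P \<in> pms X" and w: "mixing X D w" and \<phi>: "continuous_on X \<phi>"
  shows "integral\<^sup>L (P \<bind> mix_kernel X D w) \<phi> = (\<integral>x'. (\<Sum>y\<in>D. w y x' * \<phi> y) \<partial>P)"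
proof -
  obtain B where B: "\<And>k. k \<in> X \<Longrightarrow> \<bar>\<phi> k\<bar> \<le> B" using compact_abs_bound[OF X(1) \<phi>] by auto
  have "integral\<^sup>L (P \<bind> mix_kernel X D w) \<phi> = (\<integral>x'. integral\<^sup>L (mix_kernel X D w x') \<phi> \<partial>P)"
    using B by (intro integral_bind_bounded[OF P mix_kernel_measurable[OF w] bsp_measurableI[OF \<phi>]]) auto
  also have "\<dots> = (\<integral>x'. (\<Sum>y\<in>D. w y x' * \<phi> y) \<partial>P)"
    using mix_kernel_integral[OF w _ bsp_measurableI[OF \<phi>]] pmsD(3)[OF P]
    by (intro Bochner_Integration.integral_cong) auto
  finally show ?thesis .
qed

text \<open>The kernel \<kappa> keeps the source point as second coordinate, so
  \<open>P \<bind> \<kappa>\<close> is an explicit coupling of the image measure with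
  \<open>P\<close>. Its cost is the integral in \<open>cost\<close> and bounds the infimum over
  couplings.\<close>

lemma mix_bind_wasserstein:
  assumes P: "P \<in> pms X" and w: "mixing X D w"
    and cost: "(\<integral>x'. (\<Sum>y\<in>D. w y x' * norm (x' - y) ^ q) \<partial>P) \<le> e ^ q"
  shows "wasserstein q (P \<bind> mix_kernel X D w) P \<le> e"
proof -
  define Q where "Q = P \<bind> mix_kernel X D w"
  have Q: "Q \<in> pms X" unfolding Q_def by (rule mix_bind_in_pms[OF P w])
  let ?XX = "bsp X \<Otimes>\<^sub>M bsp X"
  define \<kappa> where "\<kappa> x' = distr (mix_kernel X D w x') ?XX (\<lambda>y. (y, x'))" for x'
  have \<kappa>: "\<kappa> \<in> bsp X \<rightarrow>\<^sub>M prob_algebra ?XX"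
    unfolding \<kappa>_def by (rule measurable_distr_prob_space2[OF mix_kernel_measurable[OF w]]) simp
  define \<gamma> where "\<gamma> = P \<bind> \<kappa>"
  have setsP: "sets P = sets (bsp X)" and spP: "space P = X" using pmsD[OF P] by auto
  have setsQ: "sets Q = sets (bsp X)" using pmsD[OF Q] by auto
  have \<kappa>P: "\<kappa> \<in> P \<rightarrow>\<^sub>M subprob_algebra ?XX"
    using measurable_prob_algebraD[OF \<kappa>] setsP by (simp cong: measurable_cong_sets)
  have neP: "space P \<noteq> {}" using spP X by simp
  have mk: "sets (mix_kernel X D w x') = sets (bsp X)" for x' by (simp add: mix_kernel_def)
  have pair: "(\<lambda>y. (y, x')) \<in> mix_kernel X D w x' \<rightarrow>\<^sub>M ?XX" if "x' \<in> X" for x'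
    using that mk by (simp cong: measurable_cong_sets)
  have "distr \<gamma> Q fst = distr \<gamma> (bsp X) fst" using setsQ by (intro distr_cong) auto
  also have "\<dots> = P \<bind> (\<lambda>x'. distr (\<kappa> x') (bsp X) fst)"
    unfolding \<gamma>_def by (rule distr_bind[OF \<kappa>P neP measurable_fst])
  also have "\<dots> = Q"
    unfolding Q_def
  proof (rule bind_cong[OF refl])
    fix x' assume "x' \<in> space P"
    then have x': "x' \<in> X" using spP by simp
    show "distr (\<kappa> x') (bsp X) fst = mix_kernel X D w x'"
      unfolding \<kappa>_def using pair[OF x']
      by (subst distr_distr) (auto simp: o_def mk intro!: distr_id2)
  qed
  finally have d1: "distr \<gamma> Q fst = Q" .
  have "distr \<gamma> P snd = distr \<gamma> (bsp X) snd" using setsP by (intro distr_cong) auto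
  also have "\<dots> = P \<bind> (\<lambda>x'. distr (\<kappa> x') (bsp X) snd)"
    unfolding \<gamma>_def by (rule distr_bind[OF \<kappa>P neP measurable_snd])
  also have "\<dots> = P \<bind> (\<lambda>x'. return (bsp X) x')"
  proof (rule bind_cong[OF refl])
    fix x' assume "x' \<in> space P"
    then have x': "x' \<in> X" using spP by simp
    interpret k: prob_space "mix_kernel X D w x'"
      using measurable_space[OF mix_kernel_measurable[OF w], of x'] x' pmsD(1) by auto
    show "distr (\<kappa> x') (bsp X) snd = return (bsp X) x'"
      unfolding \<kappa>_def using pair[OF x'] x'
      by (subst distr_distr) (auto simp: o_def intro!: k.distr_const)
  qed
  also have "\<dots> = P" using setsP by (rule bind_return'')
  finally have d2: "distr \<gamma> P snd = P" .
  have "\<gamma> \<in> space (prob_algebra ?XX)"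
    using prob_space_bind'[OF P \<kappa>] sets_bind'[OF P \<kappa>] by (simp add: \<gamma>_def space_prob_algebra)
  then have \<gamma>c: "\<gamma> \<in> couplings Q P"
    using d1 d2 setsP setsQ by (auto simp: couplings_def space_prob_algebra cong: sets_pair_measure_cong)
  obtain B where B: "\<And>x y. x \<in> X \<Longrightarrow> y \<in> X \<Longrightarrow> norm (x - y) ^ q \<le> B" using cost_bound by auto
  have "(\<integral>z. norm (fst z - snd z) ^ q \<partial>\<gamma>) = (\<integral>x'. (\<integral>z. norm (fst z - snd z) ^ q \<partial>\<kappa> x') \<partial>P)"
    unfolding \<gamma>_def using B
    by (intro integral_bind_bounded[OF P \<kappa> cost_measurable, where B=B]) (auto simp: space_pair_measure)
  also have "\<dots> = (\<integral>x'. (\<Sum>y\<in>D. w y x' * norm (x' - y) ^ q) \<partial>P)"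
  proof (rule Bochner_Integration.integral_cong[OF refl])
    fix x' assume "x' \<in> space P"
    then have x': "x' \<in> X" using spP by simp
    have "(\<integral>z. norm (fst z - snd z) ^ q \<partial>\<kappa> x') = (\<integral>y. norm (y - x') ^ q \<partial>mix_kernel X D w x')"
      unfolding \<kappa>_def by (subst integral_distr[OF pair[OF x'] cost_measurable]) simp
    also have "\<dots> = (\<Sum>y\<in>D. w y x' * norm (y - x') ^ q)"
      by (intro mix_kernel_integral[OF w x'] bsp_measurableI continuous_intros)
    finally show "(\<integral>z. norm (fst z - snd z) ^ q \<partial>\<kappa> x') = (\<Sum>y\<in>D. w y x' * norm (x' - y) ^ q)"
      by (simp add: norm_minus_commute)
  qed
  finally have c: "(\<integral>z. norm (fst z - snd z) ^ q \<partial>\<gamma>) \<le> e ^ q" using cost by simp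
  have "(INF \<gamma>\<in>couplings Q P. \<integral>z. norm (fst z - snd z) ^ q \<partial>\<gamma>) \<le> (\<integral>z. norm (fst z - snd z) ^ q \<partial>\<gamma>)"
    by (intro cINF_lower \<gamma>c bdd_belowI2[of _ 0]) simp
  with c have "wasserstein q Q P \<le> root q (e ^ q)"
    unfolding wasserstein_def using q by (intro real_root_le_mono) auto
  also have "\<dots> = e" using q e by (simp add: real_root_power_cancel)
  finally show ?thesis unfolding Q_def .
qed

end

text \<open>
  A mixing kernel that is feasible and near-optimal at one point of \<open>Z\<close> remains so on a
  neighbourhood, so a finite subcover of \<open>Z\<close> replaces a measurable selection theorem.
\<close>

locale transport_family = transport_ball X q e
  for X :: "'a::euclidean_space set" and q :: nat and e :: real +
  fixes Z :: "'z::topological_space set" and \<kappa> :: "'z \<Rightarrow> 'a measure" and \<phi> :: "'z \<Rightarrow> 'a \<Rightarrow> real"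
  assumes Z: "compact Z"
    and \<kappa>_weak: "weakly_continuous_on Z X \<kappa>" and \<kappa>: "\<And>z. z \<in> Z \<Longrightarrow> \<kappa> z \<in> pms X"
    and \<phi>: "continuous_on (Z \<times> X) (\<lambda>(z, y). \<phi> z y)"
begin

lemma \<phi>_slice: "z \<in> Z \<Longrightarrow> continuous_on X (\<phi> z)"
  by (rule continuous_on_slice[OF \<phi>])

lemma \<phi>_compose:
  assumes "continuous_on S f" "continuous_on S g" "f ` S \<subseteq> Z" "g ` S \<subseteq> X"
  shows "continuous_on S (\<lambda>s. \<phi> (f s) (g s))"
  using continuous_on_compose2[OF \<phi> continuous_on_Pair[OF assms(1,2)]] assms(3,4) by auto

lemma dual_inf_joint: "continuous_on ((UNIV \<times> Z) \<times> X) (\<lambda>((lam, z), x'). dual_inf X q (\<phi> z) lam x')"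
proof -
  have "continuous_on (((UNIV \<times> Z) \<times> X) \<times> X)
    (\<lambda>(s, y). (\<lambda>((lam, z), x') y. \<phi> z y + lam * norm (x' - y) ^ q) s y)"
    unfolding case_prod_beta'
    by (intro continuous_intros \<phi>_compose) auto
  from continuous_on_INF_compact[OF this X] show ?thesis
    by (simp add: dual_inf_def case_prod_beta')
qed

lemma dual_val_joint: "continuous_on (UNIV \<times> Z) (\<lambda>(lam, z). dual_val X q e (\<kappa> z) (\<phi> z) lam)"
proof -
  have w: "weakly_continuous_on (UNIV \<times> Z) X (\<lambda>p. \<kappa> (snd p))"
    by (intro weakly_continuous_on_compose[OF \<kappa>_weak] continuous_intros) auto
  have "continuous_on ((UNIV \<times> Z) \<times> X) (\<lambda>(p, x'). dual_inf X q (\<phi> (snd p)) (fst p) x')"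
    using dual_inf_joint by (simp add: case_prod_beta')
  then have "continuous_on (UNIV \<times> Z) (\<lambda>p. \<integral>x'. dual_inf X q (\<phi> (snd p)) (fst p) x' \<partial>\<kappa> (snd p))"
    by (rule continuous_on_integral_kernel[OF _ X(1) w]) (auto intro: \<kappa>)
  then show ?thesis
    unfolding dual_val_def case_prod_beta' by (intro continuous_intros)
qed

text \<open>With \<open>\<bar>\<phi>\<bar> \<le> B\<close>, the dual value is at least
  \<open>- B\<close> at 0 and at most \<open>B - e ^ q * lam\<close> elsewhere, so multipliers
  beyond \<open>2 * B / e ^ q\<close> cannot beat 0. The bound is uniform in \<open>z\<close>, as
  continuity of the supremum requires.\<close>

lemma dual_sup_compact:
  "\<exists>L\<ge>0. \<forall>z\<in>Z. dual_sup X q e (\<kappa> z) (\<phi> z) = (SUP lam\<in>{0..L}. dual_val X q e (\<kappa> z) (\<phi> z) lam)"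
proof -
  obtain B where B: "B \<ge> 0" "\<And>p. p \<in> Z \<times> X \<Longrightarrow> \<bar>case p of (z, y) \<Rightarrow> \<phi> z y\<bar> \<le> B"
    using compact_abs_bound[OF compact_Times[OF Z X(1)] \<phi>] by metis
  define L where "L = 2 * B / e ^ q"
  have L: "L \<ge> 0" using B(1) eq_pos by (simp add: L_def)
  show ?thesis
  proof (intro exI[of _ L] conjI ballI L)
    fix z assume z: "z \<in> Z"
    let ?D = "dual_val X q e (\<kappa> z) (\<phi> z)"
    have \<phi>b: "\<bar>\<phi> z y\<bar> \<le> B" if "y \<in> X" for y using B(2)[of "(z, y)"] z that by simp
    have "- B \<le> dual_inf X q (\<phi> z) 0 x'" for x'
      unfolding dual_inf_def using \<phi>b X by (intro cINF_greatest) (auto simp: abs_le_iff minus_le_iff)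
    then have "(\<integral>x'. - B \<partial>\<kappa> z) \<le> (\<integral>x'. dual_inf X q (\<phi> z) 0 x' \<partial>\<kappa> z)"
      by (intro pms_integral_mono[OF \<kappa>[OF z]] pms_integrable[OF \<kappa>[OF z] X(1)] dual_inf_continuous \<phi>_slice z
          continuous_on_const) auto
    then have D0: "- B \<le> ?D 0"
      unfolding dual_val_def pms_integral_const[OF \<kappa>[OF z]] by simp
    have bdd: "bdd_above (?D ` {0..})" by (rule dual_val_bdd_above[OF \<phi>_slice[OF z] \<kappa>[OF z]])
    have bddL: "bdd_above (?D ` {0..L})" by (rule bdd_above_mono[OF bdd]) auto
    have "?D lam \<le> (SUP lam\<in>{0..L}. ?D lam)" if "lam \<ge> 0" for lam
    proof (cases "lam \<le> L")
      case True then show ?thesis using that bddL by (intro cSUP_upper) auto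
    next
      case False
      have "?D lam \<le> B - e ^ q * lam"
        using \<phi>b by (intro dual_val_le \<phi>_slice z \<kappa>) (force simp: abs_le_iff)
      also have "\<dots> \<le> - B"
      proof -
        have "e ^ q * L \<le> e ^ q * lam" using False eq_pos by (intro mult_left_mono) auto
        moreover have "e ^ q * L = 2 * B" using e by (simp add: L_def)
        ultimately show ?thesis by linarith
      qed
      also have "- B \<le> ?D 0" by (rule D0)
      also have "\<dots> \<le> (SUP lam\<in>{0..L}. ?D lam)" using L bddL by (intro cSUP_upper) auto
      finally show ?thesis .
    qed
    then have "dual_sup X q e (\<kappa> z) (\<phi> z) \<le> (SUP lam\<in>{0..L}. ?D lam)"
      unfolding dual_sup_def by (intro cSUP_least) auto
    moreover have "(SUP lam\<in>{0..L}. ?D lam) \<le> dual_sup X q e (\<kappa> z) (\<phi> z)"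
      unfolding dual_sup_def using L by (intro cSUP_subset_mono bdd) auto
    ultimately show "dual_sup X q e (\<kappa> z) (\<phi> z) = (SUP lam\<in>{0..L}. ?D lam)" by simp
  qed
qed

lemma dual_sup_continuous: "continuous_on Z (\<lambda>z. dual_sup X q e (\<kappa> z) (\<phi> z))"
proof -
  obtain L where L: "L \<ge> 0"
    "\<And>z. z \<in> Z \<Longrightarrow> dual_sup X q e (\<kappa> z) (\<phi> z) = (SUP lam\<in>{0..L}. dual_val X q e (\<kappa> z) (\<phi> z) lam)"
    using dual_sup_compact by auto
  have "continuous_on (Z \<times> {0..L}) (\<lambda>(z, lam). dual_val X q e (\<kappa> z) (\<phi> z) lam)"
    unfolding case_prod_beta'
    by (rule continuous_on_compose2[OF dual_val_joint[unfolded case_prod_beta'],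
          where f="\<lambda>p. (snd p, fst p)", simplified]) (auto intro!: continuous_intros)
  from continuous_on_SUP_compact[OF this] L show ?thesis
    by (simp cong: continuous_on_cong)
qed

text \<open>\<open>N\<close> is left abstract because the state-action space carries the product
  sigma-algebra; only its underlying set, measurability of relatively open sets and measurability of
  \<kappa> matter.\<close>

lemma near_optimal_selection:
  assumes \<delta>: "\<delta> > 0"
    and MZ: "space N = Z" "\<And>U. open U \<Longrightarrow> U \<inter> Z \<in> sets N" "\<kappa> \<in> N \<rightarrow>\<^sub>M prob_algebra (bsp X)"
  shows "\<exists>Q. Q \<in> N \<rightarrow>\<^sub>M prob_algebra (bsp X) \<and>
    (\<forall>z\<in>Z. wasserstein q (Q z) (\<kappa> z) \<le> e \<and> integral\<^sup>L (Q z) (\<phi> z) \<le> dual_sup X q e (\<kappa> z) (\<phi> z) + \<delta>)"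
proof (cases "Z = {}")
  case True
  then show ?thesis using MZ by (intro exI[of _ \<kappa>]) auto
next
  case False
  let ?G = "\<lambda>z. dual_sup X q e (\<kappa> z) (\<phi> z)"
  define ok where "ok D w z \<longleftrightarrow> (\<integral>x'. (\<Sum>y\<in>D. w y x' * norm (x' - y) ^ q) \<partial>\<kappa> z) < e ^ q \<and>
    (\<integral>x'. (\<Sum>y\<in>D. w y x' * \<phi> z y) \<partial>\<kappa> z) < ?G z + \<delta>" for D w z
  have "\<exists>U D w. open U \<and> z \<in> U \<and> mixing X D w \<and> (\<forall>z'\<in>U \<inter> Z. ok D w z')" if z: "z \<in> Z" for z
  proof -
    obtain D w where w: "mixing X D w" "ok D w z"
      using strong_duality_mixing[OF \<kappa>[OF z] \<phi>_slice[OF z] \<delta>] unfolding ok_def by blast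
    have c1: "continuous_on Z (\<lambda>z. \<integral>x'. (\<Sum>y\<in>D. w y x' * norm (x' - y) ^ q) \<partial>\<kappa> z)"
      using mixing_sum_continuous[OF w(1) continuous_on_cost] \<kappa>_weak
      unfolding weakly_continuous_on_def by blast
    have "continuous_on (Z \<times> X) (\<lambda>(z, x'). \<Sum>y\<in>D. w y x' * \<phi> z y)"
      unfolding case_prod_beta' using mixingD(2)[OF w(1)]
      by (intro continuous_intros continuous_on_compose2[OF mixingD(3)[OF w(1)] continuous_on_snd]
          \<phi>_compose) auto
    then have c2: "continuous_on Z (\<lambda>z. \<integral>x'. (\<Sum>y\<in>D. w y x' * \<phi> z y) \<partial>\<kappa> z)"
      by (rule continuous_on_integral_kernel[OF _ X(1) \<kappa>_weak \<kappa>])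
    have "\<forall>\<^sub>F z' in at z within Z. ok D w z'"
    proof -
      have "((\<lambda>z'. e ^ q - (\<integral>x'. (\<Sum>y\<in>D. w y x' * norm (x' - y) ^ q) \<partial>\<kappa> z')) \<longlongrightarrow>
             e ^ q - (\<integral>x'. (\<Sum>y\<in>D. w y x' * norm (x' - y) ^ q) \<partial>\<kappa> z)) (at z within Z)"
        using c1 z unfolding continuous_on_def by (intro tendsto_intros) auto
      then have 1: "\<forall>\<^sub>F z' in at z within Z. 0 < e ^ q - (\<integral>x'. (\<Sum>y\<in>D. w y x' * norm (x' - y) ^ q) \<partial>\<kappa> z')"
        by (rule order_tendstoD) (use w(2) in \<open>simp add: ok_def\<close>)
      have "((\<lambda>z'. ?G z' + \<delta> - (\<integral>x'. (\<Sum>y\<in>D. w y x' * \<phi> z' y) \<partial>\<kappa> z')) \<longlongrightarrow>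
             ?G z + \<delta> - (\<integral>x'. (\<Sum>y\<in>D. w y x' * \<phi> z y) \<partial>\<kappa> z)) (at z within Z)"
        using c2 dual_sup_continuous z unfolding continuous_on_def by (intro tendsto_intros) auto
      then have 2: "\<forall>\<^sub>F z' in at z within Z. 0 < ?G z' + \<delta> - (\<integral>x'. (\<Sum>y\<in>D. w y x' * \<phi> z' y) \<partial>\<kappa> z')"
        by (rule order_tendstoD) (use w(2) in \<open>simp add: ok_def\<close>)
      from 1 2 show ?thesis by eventually_elim (simp add: ok_def)
    qed
    then obtain U where U: "open U" "z \<in> U" "\<And>z'. z' \<in> U \<Longrightarrow> z' \<noteq> z \<Longrightarrow> z' \<in> Z \<Longrightarrow> ok D w z'"
      unfolding eventually_at_topological by blast
    then have "\<forall>z'\<in>U \<inter> Z. ok D w z'" using w(2) by blast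
    then show ?thesis using U w(1) by blast
  qed
  then obtain U D w where U: "\<And>z. z \<in> Z \<Longrightarrow> open (U z)" "\<And>z. z \<in> Z \<Longrightarrow> z \<in> U z"
    "\<And>z. z \<in> Z \<Longrightarrow> mixing X (D z) (w z)" "\<And>z z'. z \<in> Z \<Longrightarrow> z' \<in> U z \<Longrightarrow> z' \<in> Z \<Longrightarrow> ok (D z) (w z) z'"
    by (metis IntI)
  obtain C where C: "C \<subseteq> Z" "finite C" "Z \<subseteq> (\<Union>z\<in>C. U z)"
    using compactE_image[OF Z, of Z U] U(1,2) by blast
  have "C \<noteq> {}" using C(3) False by auto
  define n where "n = card C"
  obtain c where c: "bij_betw c {..<n} C"
    using ex_bij_betw_nat_finite[OF C(2)] unfolding n_def atLeast0LessThan by blast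
  have "n > 0" using \<open>C \<noteq> {}\<close> C(2) unfolding n_def by (simp add: card_gt_0_iff)
  \<comment> \<open>Indices from \<open>n\<close> on are never used; they repeat the first centre to make the family total.\<close>
  define d where "d i = (if i < n then c i else c 0)" for i
  have d: "d i \<in> C" for i using c \<open>n > 0\<close> unfolding d_def bij_betw_def by auto
  then have dZ: "d i \<in> Z" for i using C(1) by auto
  \<comment> \<open>Taking the first neighbourhood of the cover that contains \<open>z\<close> makes
    the choice single-valued and measurable, so the selected kernel is pieced together from
    countably many measurable ones.\<close>
  define idx where "idx z = (LEAST i. z \<in> U (d i))" for z
  have idx: "z \<in> U (d (idx z))" if "z \<in> Z" for z
  proof -
    obtain y where y: "y \<in> C" "z \<in> U y" using C(3) \<open>z \<in> Z\<close> by blast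
    then obtain i where "i < n" "c i = y" using c unfolding bij_betw_def by auto
    then have "z \<in> U (d i)" using y by (simp add: d_def)
    then show ?thesis unfolding idx_def by (rule LeastI)
  qed
  define Q where "Q z = \<kappa> z \<bind> mix_kernel X (D (d (idx z))) (w (d (idx z)))" for z
  have "idx \<in> N \<rightarrow>\<^sub>M count_space UNIV"
    unfolding idx_def
  proof (rule measurable_Least)
    fix i
    have "{z \<in> space N. z \<in> U (d i)} = U (d i) \<inter> Z" using MZ(1) by auto
    then show "Measurable.pred N (\<lambda>z. z \<in> U (d i))"
      using MZ(2)[OF U(1)[OF dZ]] by (simp add: pred_def)
  qed
  then have "Q \<in> N \<rightarrow>\<^sub>M prob_algebra (bsp X)"
    unfolding Q_def
    by (rule measurable_compose_countable[rotated])
      (intro measurable_bind_prob_space[OF MZ(3)] mix_kernel_measurable U dZ)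
  moreover have "wasserstein q (Q z) (\<kappa> z) \<le> e \<and> integral\<^sup>L (Q z) (\<phi> z) \<le> ?G z + \<delta>" if z: "z \<in> Z" for z
    using U(4)[OF dZ idx[OF z] z] mix_bind_wasserstein[OF \<kappa>[OF z] U(3)[OF dZ]]
      mix_bind_integral[OF \<kappa>[OF z] U(3)[OF dZ] \<phi>_slice[OF z]]
    unfolding ok_def Q_def by (auto simp: less_imp_le)
  ultimately show ?thesis by blast
qed

end

section \<open>Path laws and backward recursion\<close>

text \<open>The integrand depends on the parameter as well. Pushing \<open>\<kappa> x\<close>
  forward along \<open>y \<mapsto> (x, y)\<close> puts that dependence into the measure and leaves a
  fixed integrand on the product.\<close>

lemma integral_measurable_kernel:
  fixes f :: "'a \<Rightarrow> 'b \<Rightarrow> real"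
  assumes f: "(\<lambda>(x, y). f x y) \<in> borel_measurable (M \<Otimes>\<^sub>M N)" and \<kappa>: "\<kappa> \<in> M \<rightarrow>\<^sub>M prob_algebra N"
  shows "(\<lambda>x. \<integral>y. f x y \<partial>\<kappa> x) \<in> borel_measurable M"
proof -
  have "(\<lambda>x. distr (\<kappa> x) (M \<Otimes>\<^sub>M N) (\<lambda>y. (x, y))) \<in> M \<rightarrow>\<^sub>M prob_algebra (M \<Otimes>\<^sub>M N)"
    by (rule measurable_distr_prob_space2[OF \<kappa>]) simp
  from measurable_compose[OF measurable_prob_algebraD[OF this] integral_measurable_subprob_algebra[OF f]]
  have "(\<lambda>x. integral\<^sup>L (distr (\<kappa> x) (M \<Otimes>\<^sub>M N) (\<lambda>y. (x, y))) (\<lambda>(x, y). f x y)) \<in> borel_measurable M" .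
  then show ?thesis
  proof (rule measurable_cong[THEN iffD1, rotated])
    fix x assume x: "x \<in> space M"
    then have "sets (\<kappa> x) = sets N"
      using measurable_space[OF \<kappa>] by (auto simp: space_prob_algebra)
    then have "(\<lambda>y. (x, y)) \<in> \<kappa> x \<rightarrow>\<^sub>M M \<Otimes>\<^sub>M N"
      using x by (simp cong: measurable_cong_sets)
    then show "integral\<^sup>L (distr (\<kappa> x) (M \<Otimes>\<^sub>M N) (\<lambda>y. (x, y))) (\<lambda>(x, y). f x y) = (\<integral>y. f x y \<partial>\<kappa> x)"
      by (subst integral_distr[OF _ f]) auto
  qed
qed

section \<open>The model with continuous data and its one-step operators\<close>

locale continuous_rmdp =
  fixes M :: "('a::euclidean_space, 'b::euclidean_space, 'c::euclidean_space) rmdp"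
  assumes model: "robust_mdp M"
    and reward_cont: "\<And>s. s < horizon M \<Longrightarrow>
          continuous_on (states M \<times> actions M \<times> states M) (\<lambda>(x, a, y). reward M s x a y)"
    and terminal_cont: "continuous_on (states M) (terminal M)"
    and nominal_cont: "\<And>s. s < horizon M \<Longrightarrow>
          weakly_continuous_on (states M \<times> actions M) (states M) (\<lambda>(x, a). nominal M s x a)"
    and regular: "regular_policy M"
begin

abbreviation "X \<equiv> states M"
abbreviation "A \<equiv> actions M"
abbreviation "T \<equiv> horizon M"
abbreviation "XA \<equiv> bsp X \<Otimes>\<^sub>M bsp A"

lemma compact_X: "compact X" "X \<noteq> {}" and compact_A: "compact A" "A \<noteq> {}"
  and worder: "worder M \<ge> 1" and radius: "radius M > 0"
  using model unfolding robust_mdp_def by auto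

sublocale transport_ball X "worder M" "radius M"
  by standard (rule compact_X worder radius)+

lemma nominal_kernel: "s < T \<Longrightarrow> (\<lambda>(x, a). nominal M s x a) \<in> XA \<rightarrow>\<^sub>M prob_algebra (bsp X)"
  using model unfolding robust_mdp_def transition_kernel_def by auto

lemma kernel_in_pms:
  assumes "transition_kernel M \<kappa>" "x \<in> X" "a \<in> A"
  shows "\<kappa> x a \<in> pms X"
  using measurable_space[OF assms(1)[unfolded transition_kernel_def], of "(x, a)"] assms(2,3)
  by (simp add: space_pair_measure)

lemma nominal_in_pms: "s < T \<Longrightarrow> x \<in> X \<Longrightarrow> a \<in> A \<Longrightarrow> nominal M s x a \<in> pms X"
  using kernel_in_pms[of "nominal M s" x a] nominal_kernel[of s] by (simp add: transition_kernel_def)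

lemma policy_in_pms: "s < T \<Longrightarrow> \<theta> \<in> params M \<Longrightarrow> x \<in> X \<Longrightarrow> policy M s \<theta> x \<in> pms A"
  using model unfolding robust_mdp_def space_prob_algebra by (auto simp: policy_def)

lemma policy_weak:
  assumes "s < T" "\<theta> \<in> params M"
  shows "weakly_continuous_on X A (policy M s \<theta>)"
proof -
  have "weakly_continuous_on (params M \<times> X) A (\<lambda>(\<theta>, x). policy M s \<theta> x)"
    using regular assms(1) unfolding regular_policy_def by blast
  then have "weakly_continuous_on X A (\<lambda>x. (\<lambda>(\<theta>, x). policy M s \<theta> x) (\<theta>, x))"
    by (rule weakly_continuous_on_compose) (use assms(2) in \<open>auto intro!: continuous_intros\<close>)
  then show ?thesis by simp
qed

text \<open>The model asks for measurability of the density in the action only; measurability in the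
  state is drawn from weak continuity.\<close>

lemma policy_kernel: "s < T \<Longrightarrow> \<theta> \<in> params M \<Longrightarrow> policy M s \<theta> \<in> bsp X \<rightarrow>\<^sub>M prob_algebra (bsp A)"
  by (intro weakly_continuous_measurable compact_imp_closed compact_A policy_weak policy_in_pms)

text \<open>Euclidean spaces are second countable, so the product of their Borel sigma-algebras
  contains the open sets of the product.\<close>

lemma XA_open: "open U \<Longrightarrow> U \<inter> (X \<times> A) \<in> sets XA"
proof -
  assume U: "open U"
  have [measurable]: "(\<lambda>x. x) \<in> bsp X \<rightarrow>\<^sub>M borel" "(\<lambda>x. x) \<in> bsp A \<rightarrow>\<^sub>M borel"
    by (intro measurable_restrict_space1; simp)+
  have "(\<lambda>p. (fst p, snd p)) \<in> XA \<rightarrow>\<^sub>M borel \<Otimes>\<^sub>M borel"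
    by (intro measurable_Pair measurable_compose[OF measurable_fst, where g="\<lambda>x. x"]
        measurable_compose[OF measurable_snd, where g="\<lambda>x. x"]) measurable
  then have "(\<lambda>p. p) \<in> XA \<rightarrow>\<^sub>M borel" by (simp add: borel_prod)
  from measurable_sets[OF this, of U] U show ?thesis by (simp add: space_pair_measure vimage_def)
qed

lemma family:
  assumes s: "s < T" and u: "continuous_on X u"
  shows "transport_family X (worder M) (radius M) (X \<times> A) (\<lambda>(x, a). nominal M s x a)
    (\<lambda>(x, a) y. reward M s x a y + u y)"
proof
  show "compact (X \<times> A)" by (intro compact_Times compact_X compact_A)
  show "weakly_continuous_on (X \<times> A) X (\<lambda>(x, a). nominal M s x a)" by (rule nominal_cont[OF s])
  show "(case z of (x, a) \<Rightarrow> nominal M s x a) \<in> pms X" if "z \<in> X \<times> A" for z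
    using that nominal_in_pms[OF s] by auto
  have "continuous_on ((X \<times> A) \<times> X)
      (\<lambda>p. (\<lambda>(x, a, y). reward M s x a y) (fst (fst p), snd (fst p), snd p))"
    by (rule continuous_on_compose2[OF reward_cont[OF s]]) (auto intro!: continuous_intros)
  then have "continuous_on ((X \<times> A) \<times> X) (\<lambda>p. reward M s (fst (fst p)) (snd (fst p)) (snd p))"
    by simp
  then show "continuous_on ((X \<times> A) \<times> X) (\<lambda>(z, y). (case z of (x, a) \<Rightarrow> \<lambda>y. reward M s x a y + u y) y)"
    unfolding case_prod_beta' by (intro continuous_intros continuous_on_compose2[OF u]) auto
qed

lemma integrand_slice:
  assumes "s < T" "continuous_on X u" "x \<in> X" "a \<in> A"
  shows "continuous_on X (\<lambda>y. reward M s x a y + u y)"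
  using transport_family.\<phi>_slice[OF family[OF assms(1,2)], of "(x, a)"] assms(3,4) by simp

text \<open>The operator behind \<open>G\<close> for an arbitrary continuation value
  \<open>u\<close>; it allows the recursion to be set up before \<open>V\<close> is known to satisfy
  it.\<close>

definition Gop :: "('a \<Rightarrow> real) \<Rightarrow> nat \<Rightarrow> 'a \<Rightarrow> 'b \<Rightarrow> real" where
  "Gop u s x a = dual_sup X (worder M) (radius M) (nominal M s x a) (\<lambda>y. reward M s x a y + u y)"

lemma Gop_continuous:
  assumes "s < T" "continuous_on X u"
  shows "continuous_on (X \<times> A) (\<lambda>(x, a). Gop u s x a)"
  using transport_family.dual_sup_continuous[OF family[OF assms]]
  by (simp add: Gop_def case_prod_beta')

lemma F_eq_dual_val:
  "F M s \<theta> lam x a =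
     dual_val X (worder M) (radius M) (nominal M s x a) (\<lambda>y. reward M s x a y + V M (Suc s) \<theta> y) lam"
  by (simp add: F_def inner_obj_def dual_val_def dual_inf_def)

lemma G_eq_Gop: "G M s \<theta> x a = Gop (V M (Suc s) \<theta>) s x a"
  unfolding G_def Gop_def dual_sup_def F_eq_dual_val ..

lemma Gop_cong:
  assumes "\<And>y. y \<in> X \<Longrightarrow> u y = v y"
  shows "Gop u s x a = Gop v s x a"
  using assms by (simp add: Gop_def dual_sup_def dual_val_def dual_inf_def cong: INF_cong)

text \<open>Indexed by the number of remaining transitions, so that backward recursion becomes
  primitive recursion: index \<open>k\<close> belongs to time \<open>T - k\<close>.\<close>

primrec dp_value :: "'c \<Rightarrow> nat \<Rightarrow> 'a \<Rightarrow> real" where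
  "dp_value \<theta> 0 = terminal M"
| "dp_value \<theta> (Suc k) = (\<lambda>x. \<integral>a. Gop (dp_value \<theta> k) (T - Suc k) x a \<partial>policy M (T - Suc k) \<theta> x)"

lemma dp_value_continuous:
  assumes "\<theta> \<in> params M"
  shows "k \<le> T \<Longrightarrow> continuous_on X (dp_value \<theta> k)"
proof (induction k)
  case (Suc k)
  then have s: "T - Suc k < T" and c: "continuous_on X (dp_value \<theta> k)" by auto
  show ?case
    using continuous_on_integral_kernel[OF Gop_continuous[OF s c] compact_A(1) policy_weak[OF s assms]
        policy_in_pms[OF s assms]] by simp
qed (simp add: terminal_cont)

text \<open>Policy evaluation under a fixed choice of kernels, with the same countdown index as
  \<open>dp_value\<close>.\<close>

primrec kernel_value :: "('a, 'b) kernels \<Rightarrow> 'c \<Rightarrow> nat \<Rightarrow> 'a \<Rightarrow> real" where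
  "kernel_value P \<theta> 0 = terminal M"
| "kernel_value P \<theta> (Suc k) = (\<lambda>x. \<integral>a. (\<integral>y. reward M (T - Suc k) x a y + kernel_value P \<theta> k y \<partial>P (T - Suc k) x a)
      \<partial>policy M (T - Suc k) \<theta> x)"

lemma reward_bound: "s < T \<Longrightarrow> \<exists>B. \<forall>x\<in>X. \<forall>a\<in>A. \<forall>y\<in>X. \<bar>reward M s x a y\<bar> \<le> B"
proof -
  assume s: "s < T"
  obtain B where "\<And>k. k \<in> X \<times> A \<times> X \<Longrightarrow> \<bar>case k of (x, a, y) \<Rightarrow> reward M s x a y\<bar> \<le> B"
    using compact_abs_bound[OF _ reward_cont[OF s]] compact_X compact_A by (metis compact_Times)
  then show ?thesis by (intro exI[of _ B]) fastforce
qed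

lemma reward_measurable:
  "s < T \<Longrightarrow> (\<lambda>(x, a, y). reward M s x a y) \<in> borel_measurable (bsp X \<Otimes>\<^sub>M bsp A \<Otimes>\<^sub>M bsp X)"
  using model unfolding robust_mdp_def by auto

lemma step_measurable:
  assumes s: "s < T" and u: "u \<in> borel_measurable (bsp X)"
  shows "(\<lambda>((x, a), y). reward M s x a y + u y) \<in> borel_measurable (XA \<Otimes>\<^sub>M bsp X)"
proof -
  have "(\<lambda>p. (\<lambda>(x, a, y). reward M s x a y) (fst (fst p), snd (fst p), snd p)) \<in> borel_measurable (XA \<Otimes>\<^sub>M bsp X)"
    by (rule measurable_compose[OF _ reward_measurable[OF s]]) simp
  then show ?thesis
    unfolding case_prod_beta'
    by (intro borel_measurable_add measurable_compose[OF measurable_snd u]) (simp add: case_prod_beta')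
qed

lemma step_slice_measurable:
  assumes s: "s < T" and u: "u \<in> borel_measurable (bsp X)" and "x \<in> X" "a \<in> A"
  shows "(\<lambda>y. reward M s x a y + u y) \<in> borel_measurable (bsp X)"
proof -
  have "(x, a) \<in> space XA" using assms(3,4) by (simp add: space_pair_measure)
  from measurable_Pair2[OF step_measurable[OF s u] this] show ?thesis by simp
qed

text \<open>Under merely Borel kernels these values need not be continuous, so measurability and
  boundedness are carried through the induction instead.\<close>

lemma kernel_value_measurable_bounded:
  assumes \<theta>: "\<theta> \<in> params M" and P: "\<forall>l\<in>{T - k..<T}. transition_kernel M (P l)"
  shows "k \<le> T \<Longrightarrow> kernel_value P \<theta> k \<in> borel_measurable (bsp X) \<and> (\<exists>B. \<forall>x\<in>X. \<bar>kernel_value P \<theta> k x\<bar> \<le> B)"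
  using P
proof (induction k)
  case 0
  show ?case
    using bsp_measurableI[OF terminal_cont] compact_abs_bound[OF compact_X(1) terminal_cont] by auto metis
next
  case (Suc k)
  let ?s = "T - Suc k"
  have s: "?s < T" using Suc.prems(1) by simp
  have k: "k \<le> T" using Suc.prems(1) by simp
  have P: "transition_kernel M (P ?s)" using Suc.prems(2) s by simp
  have "kernel_value P \<theta> k \<in> borel_measurable (bsp X) \<and> (\<exists>B. \<forall>x\<in>X. \<bar>kernel_value P \<theta> k x\<bar> \<le> B)"
    using Suc.prems by (intro Suc.IH) auto
  then obtain B where m: "kernel_value P \<theta> k \<in> borel_measurable (bsp X)" and B: "\<And>x. x \<in> X \<Longrightarrow> \<bar>kernel_value P \<theta> k x\<bar> \<le> B"
    by auto
  obtain B' where B': "\<And>x a y. x \<in> X \<Longrightarrow> a \<in> A \<Longrightarrow> y \<in> X \<Longrightarrow> \<bar>reward M ?s x a y\<bar> \<le> B'"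
    using reward_bound[OF s] by auto
  define h where "h x a = (\<integral>y. reward M ?s x a y + kernel_value P \<theta> k y \<partial>P ?s x a)" for x a
  have "(\<lambda>z. \<integral>y. (\<lambda>(x, a) y. reward M ?s x a y + kernel_value P \<theta> k y) z y \<partial>(\<lambda>(x, a). P ?s x a) z) \<in> borel_measurable XA"
    using step_measurable[OF s m] P[unfolded transition_kernel_def]
    by (intro integral_measurable_kernel) (auto simp: case_prod_beta')
  then have hm: "(\<lambda>(x, a). h x a) \<in> borel_measurable XA" by (simp add: h_def case_prod_beta')
  have b: "\<bar>reward M ?s x a y + kernel_value P \<theta> k y\<bar> \<le> B' + B" if "x \<in> X" "a \<in> A" "y \<in> X" for x a y
    using B[OF that(3)] B'[OF that] by linarith
  have hb: "\<bar>h x a\<bar> \<le> B' + B" if "x \<in> X" "a \<in> A" for x a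
    unfolding h_def using b that
    by (intro pms_integral_bound[OF kernel_in_pms[OF P]] pms_integrable_bounded[OF kernel_in_pms[OF P]
          step_slice_measurable[OF s m]]) auto
  have "(\<lambda>x. \<integral>a. h x a \<partial>policy M ?s \<theta> x) \<in> borel_measurable (bsp X)"
    by (rule integral_measurable_kernel[OF hm policy_kernel[OF s \<theta>]])
  moreover have "\<bar>\<integral>a. h x a \<partial>policy M ?s \<theta> x\<bar> \<le> B' + B" if x: "x \<in> X" for x
  proof -
    have "h x \<in> borel_measurable (bsp A)"
      using measurable_Pair2[OF hm, of x] x by simp
    then show ?thesis using hb x
      by (intro pms_integral_bound[OF policy_in_pms[OF s \<theta> x]] pms_integrable_bounded[OF policy_in_pms[OF s \<theta> x]])
  qed
  ultimately show ?case by (auto simp: h_def[symmetric])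
qed


section \<open>Evaluation of the path law for fixed kernels\<close>

lemma traj_state: "i \<in> {t..t + k} \<Longrightarrow> (\<lambda>\<omega>. fst \<omega> i) \<in> traj_space M t k \<rightarrow>\<^sub>M bsp X"
  unfolding traj_space_def by (rule measurable_compose[OF measurable_fst measurable_component_singleton])

lemma traj_action: "i \<in> {t..<t + k} \<Longrightarrow> (\<lambda>\<omega>. snd \<omega> i) \<in> traj_space M t k \<rightarrow>\<^sub>M bsp A"
  unfolding traj_space_def by (rule measurable_compose[OF measurable_snd measurable_component_singleton])

lemma traj_extend:
  "(\<lambda>p. ((fst (fst (fst p)))(t + Suc k := snd p), (snd (fst (fst p)))(t + k := snd (fst p))))
     \<in> (traj_space M t k \<Otimes>\<^sub>M bsp A) \<Otimes>\<^sub>M bsp X \<rightarrow>\<^sub>M traj_space M t (Suc k)"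
proof -
  have 1: "(\<lambda>p. fst (fst (fst p))) \<in> (traj_space M t k \<Otimes>\<^sub>M bsp A) \<Otimes>\<^sub>M bsp X \<rightarrow>\<^sub>M (\<Pi>\<^sub>M i\<in>{t..t + k}. bsp X)"
    unfolding traj_space_def by simp
  have 2: "(\<lambda>p. snd (fst (fst p))) \<in> (traj_space M t k \<Otimes>\<^sub>M bsp A) \<Otimes>\<^sub>M bsp X \<rightarrow>\<^sub>M (\<Pi>\<^sub>M i\<in>{t..<t + k}. bsp A)"
    unfolding traj_space_def by simp
  have 3: "{t..t + Suc k} = {t..t + k} \<union> {t + Suc k}" "{t..<t + Suc k} = {t..<t + k} \<union> {t + k}" by auto
  show ?thesis
    unfolding traj_space_def[of M t "Suc k"]
    by (intro measurable_Pair measurable_fun_upd[OF 3(1) 1] measurable_fun_upd[OF 3(2) 2]) simp_all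
qed

text \<open>The transition inside \<open>path_law\<close>, written with projections in place of a
  pattern on pairs so that measurability and integral rules apply to it as a kernel.\<close>

definition step_kernel ::
  "('a, 'b) kernels \<Rightarrow> 'c \<Rightarrow> nat \<Rightarrow> nat \<Rightarrow> (nat \<Rightarrow> 'a) \<times> (nat \<Rightarrow> 'b) \<Rightarrow> ((nat \<Rightarrow> 'a) \<times> (nat \<Rightarrow> 'b)) measure" where
  "step_kernel P \<theta> t k \<omega> = policy M (t + k) \<theta> (fst \<omega> (t + k)) \<bind> (\<lambda>a.
     P (t + k) (fst \<omega> (t + k)) a \<bind> (\<lambda>y.
       return (traj_space M t (Suc k)) ((fst \<omega>)(t + Suc k := y), (snd \<omega>)(t + k := a))))"

context
  fixes P :: "('a, 'b) kernels" and \<theta> :: 'c and t k :: nat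
  assumes tk: "t + k < T" and \<theta>: "\<theta> \<in> params M" and P: "transition_kernel M (P (t + k))"
begin

lemma step_kernel_inner:
  "(\<lambda>(\<omega>, a). P (t + k) (fst \<omega> (t + k)) a \<bind> (\<lambda>y.
       return (traj_space M t (Suc k)) ((fst \<omega>)(t + Suc k := y), (snd \<omega>)(t + k := a))))
   \<in> traj_space M t k \<Otimes>\<^sub>M bsp A \<rightarrow>\<^sub>M prob_algebra (traj_space M t (Suc k))"
proof -
  have "(\<lambda>p. (fst (fst p) (t + k), snd p)) \<in> traj_space M t k \<Otimes>\<^sub>M bsp A \<rightarrow>\<^sub>M XA"
    by (intro measurable_Pair measurable_compose[OF measurable_fst traj_state] measurable_snd) simp
  from measurable_compose[OF this P[unfolded transition_kernel_def]]
  have 1: "(\<lambda>p. P (t + k) (fst (fst p) (t + k)) (snd p)) \<in> traj_space M t k \<Otimes>\<^sub>M bsp A \<rightarrow>\<^sub>M prob_algebra (bsp X)"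
    by simp
  show ?thesis
    unfolding case_prod_beta'
    by (rule measurable_bind_prob_space2[OF 1])
      (use measurable_compose[OF traj_extend measurable_return_prob_space] in \<open>simp add: case_prod_beta'\<close>)
qed

lemma step_kernel_measurable:
  "step_kernel P \<theta> t k \<in> traj_space M t k \<rightarrow>\<^sub>M prob_algebra (traj_space M t (Suc k))"
  unfolding step_kernel_def[abs_def]
  by (rule measurable_bind_prob_space2[OF measurable_compose[OF traj_state policy_kernel[OF tk \<theta>]] step_kernel_inner])
    simp

lemma step_kernel_integral:
  fixes \<phi> :: "(nat \<Rightarrow> 'a) \<times> (nat \<Rightarrow> 'b) \<Rightarrow> real"
  assumes \<phi>: "\<phi> \<in> borel_measurable (traj_space M t (Suc k))"
    and B: "\<And>\<omega>. \<omega> \<in> space (traj_space M t (Suc k)) \<Longrightarrow> \<bar>\<phi> \<omega>\<bar> \<le> B"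
    and \<omega>: "\<omega> \<in> space (traj_space M t k)"
  shows "integral\<^sup>L (step_kernel P \<theta> t k \<omega>) \<phi> =
    (\<integral>a. (\<integral>y. \<phi> ((fst \<omega>)(t + Suc k := y), (snd \<omega>)(t + k := a)) \<partial>P (t + k) (fst \<omega> (t + k)) a)
      \<partial>policy M (t + k) \<theta> (fst \<omega> (t + k)))"
proof -
  let ?x = "fst \<omega> (t + k)"
  have x: "?x \<in> X" using measurable_space[OF traj_state[of "t + k" t k] \<omega>] by simp
  note pol = policy_in_pms[OF tk \<theta> x]
  have "integral\<^sup>L (step_kernel P \<theta> t k \<omega>) \<phi> =
    (\<integral>a. integral\<^sup>L (P (t + k) ?x a \<bind> (\<lambda>y.
       return (traj_space M t (Suc k)) ((fst \<omega>)(t + Suc k := y), (snd \<omega>)(t + k := a)))) \<phi> \<partial>policy M (t + k) \<theta> ?x)"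
    unfolding step_kernel_def using measurable_Pair2[OF step_kernel_inner \<omega>]
    by (intro integral_bind_bounded[OF pol _ \<phi> B]) simp
  also have "\<dots> = (\<integral>a. (\<integral>y. \<phi> ((fst \<omega>)(t + Suc k := y), (snd \<omega>)(t + k := a)) \<partial>P (t + k) ?x a)
      \<partial>policy M (t + k) \<theta> ?x)"
  proof (rule Bochner_Integration.integral_cong[OF refl])
    fix a assume "a \<in> space (policy M (t + k) \<theta> ?x)"
    then have a: "a \<in> A" using pmsD(3)[OF pol] by simp
    note Pm = kernel_in_pms[OF P x a]
    have \<omega>a: "(\<omega>, a) \<in> space (traj_space M t k \<Otimes>\<^sub>M bsp A)"
      using \<omega> a by (simp add: space_pair_measure)
    have ext: "(\<lambda>y. ((fst \<omega>)(t + Suc k := y), (snd \<omega>)(t + k := a))) \<in> bsp X \<rightarrow>\<^sub>M traj_space M t (Suc k)"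
      using measurable_Pair2[OF traj_extend \<omega>a] by simp
    have "integral\<^sup>L (P (t + k) ?x a \<bind> (\<lambda>y.
        return (traj_space M t (Suc k)) ((fst \<omega>)(t + Suc k := y), (snd \<omega>)(t + k := a)))) \<phi> =
      (\<integral>y. integral\<^sup>L (return (traj_space M t (Suc k)) ((fst \<omega>)(t + Suc k := y), (snd \<omega>)(t + k := a))) \<phi>
        \<partial>P (t + k) ?x a)"
      by (rule integral_bind_bounded[OF Pm measurable_compose[OF ext measurable_return_prob_space] \<phi> B])
    also have "\<dots> = (\<integral>y. \<phi> ((fst \<omega>)(t + Suc k := y), (snd \<omega>)(t + k := a)) \<partial>P (t + k) ?x a)"
      using measurable_space[OF ext] pmsD(3)[OF Pm] \<phi>
      by (intro Bochner_Integration.integral_cong refl integral_return) auto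
    finally show "integral\<^sup>L (P (t + k) ?x a \<bind> (\<lambda>y.
        return (traj_space M t (Suc k)) ((fst \<omega>)(t + Suc k := y), (snd \<omega>)(t + k := a)))) \<phi> =
      (\<integral>y. \<phi> ((fst \<omega>)(t + Suc k := y), (snd \<omega>)(t + k := a)) \<partial>P (t + k) ?x a)" .
  qed
  finally show ?thesis .
qed

end

lemma path_law_Suc:
  "path_law M \<theta> P t x (Suc k) = path_law M \<theta> P t x k \<bind> step_kernel P \<theta> t k"
  by (simp add: step_kernel_def[abs_def] case_prod_beta')

lemma path_law_prob:
  assumes \<theta>: "\<theta> \<in> params M" and P: "\<forall>l\<in>{t..<T}. transition_kernel M (P l)" and x: "x \<in> X"
  shows "t + k \<le> T \<Longrightarrow> path_law M \<theta> P t x k \<in> space (prob_algebra (traj_space M t k))"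
proof (induction k)
  case 0
  have "((\<lambda>i. undefined)(t := x), \<lambda>i. undefined) \<in> space (traj_space M t 0)"
    using x by (auto simp: traj_space_def space_pair_measure space_PiM PiE_def extensional_def)
  then show ?case by (auto simp: space_prob_algebra intro: prob_space_return)
next
  case (Suc k)
  have K: "step_kernel P \<theta> t k \<in> traj_space M t k \<rightarrow>\<^sub>M prob_algebra (traj_space M t (Suc k))"
    using Suc.prems by (intro step_kernel_measurable \<theta> bspec[OF P]) auto
  have IH: "path_law M \<theta> P t x k \<in> space (prob_algebra (traj_space M t k))"
    using Suc by simp
  show ?case
    unfolding path_law_Suc using prob_space_bind'[OF IH K] sets_bind'[OF IH K]
    by (simp add: space_prob_algebra)
qed

definition running :: "('a, 'b) kernels \<Rightarrow> 'c \<Rightarrow> nat \<Rightarrow> nat \<Rightarrow> (nat \<Rightarrow> 'a) \<times> (nat \<Rightarrow> 'b) \<Rightarrow> real" where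
  "running P \<theta> t k \<omega> = (\<Sum>l\<in>{t..<t + k}. reward M l (fst \<omega> l) (snd \<omega> l) (fst \<omega> (Suc l)))
     + kernel_value P \<theta> (T - t - k) (fst \<omega> (t + k))"

lemma running_measurable_bounded:
  assumes \<theta>: "\<theta> \<in> params M" and P: "\<forall>l\<in>{t..<T}. transition_kernel M (P l)" and tk: "t + k \<le> T"
  shows "running P \<theta> t k \<in> borel_measurable (traj_space M t k)"
    and "\<exists>B. \<forall>\<omega>\<in>space (traj_space M t k). \<bar>running P \<theta> t k \<omega>\<bar> \<le> B"
proof -
  have "kernel_value P \<theta> (T - t - k) \<in> borel_measurable (bsp X) \<and> (\<exists>B. \<forall>x\<in>X. \<bar>kernel_value P \<theta> (T - t - k) x\<bar> \<le> B)"
    using tk P by (intro kernel_value_measurable_bounded[OF \<theta>]) auto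
  then obtain B where jm: "kernel_value P \<theta> (T - t - k) \<in> borel_measurable (bsp X)"
    and B: "\<And>x. x \<in> X \<Longrightarrow> \<bar>kernel_value P \<theta> (T - t - k) x\<bar> \<le> B"
    by auto
  have coord: "fst \<omega> i \<in> X" if "\<omega> \<in> space (traj_space M t k)" "i \<in> {t..t + k}" for \<omega> i
    using measurable_space[OF traj_state[OF that(2)] that(1)] by simp
  have acoord: "snd \<omega> i \<in> A" if "\<omega> \<in> space (traj_space M t k)" "i \<in> {t..<t + k}" for \<omega> i
    using measurable_space[OF traj_action[OF that(2)] that(1)] by simp
  have rm: "(\<lambda>\<omega>. reward M l (fst \<omega> l) (snd \<omega> l) (fst \<omega> (Suc l))) \<in> borel_measurable (traj_space M t k)"
    if l: "l \<in> {t..<t + k}" for l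
  proof -
    have "(\<lambda>\<omega>. (fst \<omega> l, snd \<omega> l, fst \<omega> (Suc l))) \<in> traj_space M t k \<rightarrow>\<^sub>M bsp X \<Otimes>\<^sub>M bsp A \<Otimes>\<^sub>M bsp X"
      using l by (intro measurable_Pair traj_state traj_action) auto
    from measurable_compose[OF this reward_measurable[of l]] show ?thesis using l tk by simp
  qed
  show "running P \<theta> t k \<in> borel_measurable (traj_space M t k)"
    unfolding running_def[abs_def]
    by (intro borel_measurable_add borel_measurable_sum rm measurable_compose[OF traj_state jm]) auto
  have "\<forall>l\<in>{t..<t + k}. \<exists>B. \<forall>x\<in>X. \<forall>a\<in>A. \<forall>y\<in>X. \<bar>reward M l x a y\<bar> \<le> B"
    using reward_bound tk by auto
  then obtain b where b: "\<And>l x a y. l \<in> {t..<t + k} \<Longrightarrow> x \<in> X \<Longrightarrow> a \<in> A \<Longrightarrow> y \<in> X \<Longrightarrow> \<bar>reward M l x a y\<bar> \<le> b l"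
    by metis
  have "\<bar>running P \<theta> t k \<omega>\<bar> \<le> (\<Sum>l\<in>{t..<t + k}. b l) + B" if \<omega>: "\<omega> \<in> space (traj_space M t k)" for \<omega>
  proof -
    have "\<bar>\<Sum>l\<in>{t..<t + k}. reward M l (fst \<omega> l) (snd \<omega> l) (fst \<omega> (Suc l))\<bar> \<le> (\<Sum>l\<in>{t..<t + k}. b l)"
      by (intro order_trans[OF sum_abs] sum_mono b coord[OF \<omega>] acoord[OF \<omega>]) auto
    moreover have "\<bar>kernel_value P \<theta> (T - t - k) (fst \<omega> (t + k))\<bar> \<le> B"
      by (intro B coord[OF \<omega>]) simp
    ultimately show ?thesis unfolding running_def by linarith
  qed
  then show "\<exists>B. \<forall>\<omega>\<in>space (traj_space M t k). \<bar>running P \<theta> t k \<omega>\<bar> \<le> B" by blast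
qed

text \<open>
  The rewards collected so far plus the value still to be collected have the same mean at every
  stage; comparing the first stage with the last one evaluates the expected reward.
\<close>

lemma running_step:
  assumes \<theta>: "\<theta> \<in> params M" and P: "\<forall>l\<in>{t..<T}. transition_kernel M (P l)"
    and tk: "t + k < T" and \<omega>: "\<omega> \<in> space (traj_space M t k)"
  shows "integral\<^sup>L (step_kernel P \<theta> t k \<omega>) (running P \<theta> t (Suc k)) = running P \<theta> t k \<omega>"
proof -
  let ?x = "fst \<omega> (t + k)" and ?u = "kernel_value P \<theta> (T - t - Suc k)"
  let ?S = "\<Sum>l\<in>{t..<t + k}. reward M l (fst \<omega> l) (snd \<omega> l) (fst \<omega> (Suc l))"
  have x: "?x \<in> X" using measurable_space[OF traj_state[of "t + k" t k] \<omega>] by simp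
  have Ptk: "transition_kernel M (P (t + k))" using P tk by simp
  \<comment> \<open>Matches the countdown of \<open>kernel_value\<close> with the forward time
    \<open>t + k\<close>.\<close>
  have T1: "T - Suc (T - t - Suc k) = t + k" "T - t - k = Suc (T - t - Suc k)" using tk by auto
  have tk': "t + Suc k \<le> T" using tk by simp
  obtain B where B: "\<And>\<omega>. \<omega> \<in> space (traj_space M t (Suc k)) \<Longrightarrow> \<bar>running P \<theta> t (Suc k) \<omega>\<bar> \<le> B"
    using running_measurable_bounded(2)[OF \<theta> P tk'] by auto
  have ru: "running P \<theta> t (Suc k) ((fst \<omega>)(t + Suc k := y), (snd \<omega>)(t + k := a))
      = ?S + (reward M (t + k) ?x a y + ?u y)" for a y
  proof -
    have "(\<Sum>l\<in>{t..<t + k}. reward M l (((fst \<omega>)(t + Suc k := y)) l) (((snd \<omega>)(t + k := a)) l)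
        (((fst \<omega>)(t + Suc k := y)) (Suc l))) = ?S"
      by (intro sum.cong) auto
    then show ?thesis unfolding running_def by (simp add: sum.atLeastLessThan_Suc)
  qed
  have u: "?u \<in> borel_measurable (bsp X)" "\<exists>B. \<forall>x\<in>X. \<bar>?u x\<bar> \<le> B"
    using kernel_value_measurable_bounded[OF \<theta>, of "T - t - Suc k"] P tk by auto
  then obtain Bu where Bu: "\<And>x. x \<in> X \<Longrightarrow> \<bar>?u x\<bar> \<le> Bu" by auto
  obtain Br where Br: "\<And>x a y. x \<in> X \<Longrightarrow> a \<in> A \<Longrightarrow> y \<in> X \<Longrightarrow> \<bar>reward M (t + k) x a y\<bar> \<le> Br"
    using reward_bound[OF tk] by auto
  define h where "h a = (\<integral>y. reward M (t + k) ?x a y + ?u y \<partial>P (t + k) ?x a)" for a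
  note pol = policy_in_pms[OF tk \<theta> x]
  have int: "integrable (P (t + k) ?x a) (\<lambda>y. reward M (t + k) ?x a y + ?u y)" if a: "a \<in> A" for a
    using Bu Br[OF x a]
    by (intro pms_integrable_bounded[OF kernel_in_pms[OF Ptk x a] step_slice_measurable[OF tk u(1) x a], where B="Br + Bu"])
      (smt (verit))
  have "integral\<^sup>L (step_kernel P \<theta> t k \<omega>) (running P \<theta> t (Suc k)) =
    (\<integral>a. (\<integral>y. ?S + (reward M (t + k) ?x a y + ?u y) \<partial>P (t + k) ?x a) \<partial>policy M (t + k) \<theta> ?x)"
    using step_kernel_integral[where P=P and t=t and k=k, OF tk \<theta> Ptk running_measurable_bounded(1)[OF \<theta> P tk'] B \<omega>]
    unfolding ru .
  also have "\<dots> = (\<integral>a. ?S + h a \<partial>policy M (t + k) \<theta> ?x)"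
  proof (rule Bochner_Integration.integral_cong[OF refl])
    fix a assume "a \<in> space (policy M (t + k) \<theta> ?x)"
    then have a: "a \<in> A" using pmsD(3)[OF pol] by simp
    note Pm = kernel_in_pms[OF Ptk x a]
    interpret prob_space "P (t + k) ?x a" using pmsD(1)[OF Pm] .
    show "(\<integral>y. ?S + (reward M (t + k) ?x a y + ?u y) \<partial>P (t + k) ?x a) = ?S + h a"
      using int[OF a] by (subst Bochner_Integration.integral_add) (simp_all add: h_def prob_space)
  qed
  also have "\<dots> = ?S + (\<integral>a. h a \<partial>policy M (t + k) \<theta> ?x)"
  proof -
    interpret prob_space "policy M (t + k) \<theta> ?x" using pmsD(1)[OF pol] .
    have "(\<lambda>z. \<integral>y. (\<lambda>(x, a) y. reward M (t + k) x a y + ?u y) z y \<partial>(\<lambda>(x, a). P (t + k) x a) z) \<in> borel_measurable XA"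
      using step_measurable[OF tk u(1)] Ptk[unfolded transition_kernel_def]
      by (intro integral_measurable_kernel) (auto simp: case_prod_beta')
    from measurable_Pair2[OF this, of ?x] have "h \<in> borel_measurable (bsp A)"
      using x by (simp add: h_def[abs_def])
    moreover have "\<bar>h a\<bar> \<le> Br + Bu" if a: "a \<in> A" for a
      unfolding h_def using Bu Br[OF x a]
      by (intro pms_integral_bound[OF kernel_in_pms[OF Ptk x a] int[OF a]]) (smt (verit))
    ultimately have "integrable (policy M (t + k) \<theta> ?x) h"
      by (intro pms_integrable_bounded[OF pol])
    then show ?thesis by (subst Bochner_Integration.integral_add) (simp_all add: prob_space)
  qed
  also have "\<dots> = running P \<theta> t k \<omega>"
    unfolding running_def T1(2) kernel_value.simps T1(1) h_def ..
  finally show ?thesis .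
qed

lemma expected_reward_eq_kernel_value:
  assumes \<theta>: "\<theta> \<in> params M" and P: "\<forall>l\<in>{t..<T}. transition_kernel M (P l)"
    and x: "x \<in> X" and t: "t \<le> T"
  shows "expected_reward M \<theta> P t x = kernel_value P \<theta> (T - t) x"
proof -
  have "t + k \<le> T \<Longrightarrow> integral\<^sup>L (path_law M \<theta> P t x k) (running P \<theta> t k) = kernel_value P \<theta> (T - t) x" for k
  proof (induction k)
    case 0
    have "((\<lambda>i. undefined)(t := x), \<lambda>i. undefined) \<in> space (traj_space M t 0)"
      using x by (auto simp: traj_space_def space_pair_measure space_PiM PiE_def extensional_def)
    moreover have "t + 0 \<le> T" using t by simp
    ultimately show ?case
      using integral_return[OF _ running_measurable_bounded(1)[where k=0, OF \<theta> P]]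
      by (simp add: running_def)
  next
    case (Suc k)
    have tk: "t + k < T" using Suc.prems by simp
    obtain B where B: "\<And>\<omega>. \<omega> \<in> space (traj_space M t (Suc k)) \<Longrightarrow> \<bar>running P \<theta> t (Suc k) \<omega>\<bar> \<le> B"
      using running_measurable_bounded(2)[OF \<theta> P Suc.prems] by auto
    have pl: "path_law M \<theta> P t x k \<in> space (prob_algebra (traj_space M t k))"
      using tk by (intro path_law_prob \<theta> P x) auto
    have K: "step_kernel P \<theta> t k \<in> traj_space M t k \<rightarrow>\<^sub>M prob_algebra (traj_space M t (Suc k))"
      using tk by (intro step_kernel_measurable \<theta> bspec[OF P]) auto
    have sp: "space (path_law M \<theta> P t x k) = space (traj_space M t k)"
      using pl sets_eq_imp_space_eq by (auto simp: space_prob_algebra)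
    have "integral\<^sup>L (path_law M \<theta> P t x (Suc k)) (running P \<theta> t (Suc k))
        = (\<integral>\<omega>. integral\<^sup>L (step_kernel P \<theta> t k \<omega>) (running P \<theta> t (Suc k)) \<partial>path_law M \<theta> P t x k)"
      unfolding path_law_Suc
      by (rule integral_bind_bounded[OF pl K running_measurable_bounded(1)[OF \<theta> P Suc.prems] B])
    also have "\<dots> = integral\<^sup>L (path_law M \<theta> P t x k) (running P \<theta> t k)"
      using running_step[OF \<theta> P tk] sp by (intro Bochner_Integration.integral_cong) auto
    also have "\<dots> = kernel_value P \<theta> (T - t) x" using Suc by simp
    finally show ?case .
  qed
  \<comment> \<open>At \<open>k = T - t\<close> nothing remains but \<open>terminal M\<close>, so
    \<open>running\<close> is the total reward of the trajectory.\<close>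
  from this[of "T - t"] t show ?thesis
    unfolding expected_reward_def by (simp add: running_def[abs_def] case_prod_beta')
qed

end

section \<open>Dynamic programming\<close>

context continuous_rmdp
begin

lemma admissible_transition:
  "P \<in> admissible_kernels M s \<Longrightarrow> \<forall>l\<in>{s..<T}. transition_kernel M (P l)"
  by (simp add: admissible_kernels_def)

lemma step_integrals:
  assumes s: "s < T" and \<theta>: "\<theta> \<in> params M" and P: "transition_kernel M P"
    and u: "u \<in> borel_measurable (bsp X)" and b: "\<forall>x\<in>X. \<bar>u x\<bar> \<le> B" and x: "x \<in> X"
  shows "a \<in> A \<Longrightarrow> integrable (P x a) (\<lambda>y. reward M s x a y + u y)"
    and "integrable (policy M s \<theta> x) (\<lambda>a. \<integral>y. reward M s x a y + u y \<partial>P x a)"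
proof -
  obtain Br where Br: "\<And>x a y. x \<in> X \<Longrightarrow> a \<in> A \<Longrightarrow> y \<in> X \<Longrightarrow> \<bar>reward M s x a y\<bar> \<le> Br"
    using reward_bound[OF s] by auto
  have bd: "\<bar>reward M s x a y + u y\<bar> \<le> Br + B" if "a \<in> A" "y \<in> X" for a y
    using bspec[OF b that(2)] Br[OF x that] by linarith
  show int: "integrable (P x a) (\<lambda>y. reward M s x a y + u y)" if a: "a \<in> A" for a
    using bd[OF a] by (intro pms_integrable_bounded[OF kernel_in_pms[OF P x a] step_slice_measurable[OF s u x a]])
  have "(\<lambda>z. \<integral>y. (\<lambda>(x, a) y. reward M s x a y + u y) z y \<partial>(\<lambda>(x, a). P x a) z) \<in> borel_measurable XA"
    using step_measurable[OF s u] P[unfolded transition_kernel_def]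
    by (intro integral_measurable_kernel) (auto simp: case_prod_beta')
  from measurable_Pair2[OF this, of x]
  have "(\<lambda>a. \<integral>y. reward M s x a y + u y \<partial>P x a) \<in> borel_measurable (bsp A)"
    using x by simp
  then show "integrable (policy M s \<theta> x) (\<lambda>a. \<integral>y. reward M s x a y + u y \<partial>P x a)"
    using bd by (intro pms_integrable_bounded[OF policy_in_pms[OF s \<theta> x]]
        pms_integral_bound[OF kernel_in_pms[OF P x] int]) auto
qed

lemma Gop_integrable:
  assumes "s < T" "\<theta> \<in> params M" "x \<in> X" "continuous_on X u"
  shows "integrable (policy M s \<theta> x) (\<lambda>a. Gop u s x a)"
  using pms_integrable[OF policy_in_pms[OF assms(1-3)] compact_A(1)
      continuous_on_slice[OF Gop_continuous[OF assms(1,4)] assms(3)]] .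

text \<open>At each stage weak duality bounds \<open>Gop\<close> by the integral under any kernel in
  the ball; the induction hypothesis replaces the continuation value and averaging over the policy
  preserves the order.\<close>

lemma kernel_value_ge_dp_value:
  assumes \<theta>: "\<theta> \<in> params M" and P: "P \<in> admissible_kernels M s"
  shows "k \<le> T - s \<Longrightarrow> x \<in> X \<Longrightarrow> dp_value \<theta> k x \<le> kernel_value P \<theta> k x"
proof (induction k arbitrary: x)
  case (Suc k)
  let ?l = "T - Suc k"
  have l: "?l < T" "s \<le> ?l" and k: "k \<le> T - s" using Suc.prems(1) by auto
  have tk: "transition_kernel M (P ?l)" using admissible_transition[OF P] l by simp
  have ball: "wasserstein (worder M) (P ?l x a) (nominal M ?l x a) \<le> radius M" if "a \<in> A" for a
    using P l that Suc.prems(2) by (auto simp: admissible_kernels_def ambiguity_ball_def)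
  have c: "continuous_on X (dp_value \<theta> k)" using dp_value_continuous[OF \<theta>, of k] k by simp
  have "kernel_value P \<theta> k \<in> borel_measurable (bsp X) \<and> (\<exists>B. \<forall>x\<in>X. \<bar>kernel_value P \<theta> k x\<bar> \<le> B)"
    using admissible_transition[OF P] k by (intro kernel_value_measurable_bounded[OF \<theta>]) auto
  then obtain B where m: "kernel_value P \<theta> k \<in> borel_measurable (bsp X)" and B: "\<forall>x\<in>X. \<bar>kernel_value P \<theta> k x\<bar> \<le> B"
    by auto
  note int = step_integrals[OF l(1) \<theta> tk m B Suc.prems(2)]
  have "Gop (dp_value \<theta> k) ?l x a \<le> (\<integral>y. reward M ?l x a y + kernel_value P \<theta> k y \<partial>P ?l x a)" if a: "a \<in> A" for a
  proof -
    note Pm = kernel_in_pms[OF tk Suc.prems(2) a]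
    have cc: "continuous_on X (\<lambda>y. reward M ?l x a y + dp_value \<theta> k y)"
      by (rule integrand_slice[OF l(1) c Suc.prems(2) a])
    have "Gop (dp_value \<theta> k) ?l x a \<le> (\<integral>y. reward M ?l x a y + dp_value \<theta> k y \<partial>P ?l x a)"
      unfolding Gop_def
      by (rule weak_duality[OF nominal_in_pms[OF l(1) Suc.prems(2) a] Pm ball[OF a] cc])
    also have "\<dots> \<le> (\<integral>y. reward M ?l x a y + kernel_value P \<theta> k y \<partial>P ?l x a)"
      using Suc.IH[OF k] by (intro pms_integral_mono[OF Pm pms_integrable[OF Pm compact_X(1) cc] int(1)[OF a]]) auto
    finally show ?thesis .
  qed
  then show ?case
    using int(2) by (auto intro!: pms_integral_mono[OF policy_in_pms[OF l(1) \<theta> Suc.prems(2)]]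
        Gop_integrable l(1) \<theta> Suc.prems(2) c)
qed simp

text \<open>Each \<open>Q l\<close> is near-optimal against \<open>dp_value\<close>, not against the
  value produced by the later kernels, so the stages are chosen independently and one family serves
  all starting times. Every stage adds an error \<delta>, hence \<open>k * \<delta>\<close>.\<close>

lemma near_optimal_kernels:
  assumes \<theta>: "\<theta> \<in> params M" and \<delta>: "(\<delta> :: real) > 0"
  shows "\<exists>P. (\<forall>s. P \<in> admissible_kernels M s) \<and> (\<forall>k\<le>T. \<forall>x\<in>X. kernel_value P \<theta> k x \<le> dp_value \<theta> k x + k * \<delta>)"
proof -
  define ok where "ok l Q \<longleftrightarrow> Q \<in> XA \<rightarrow>\<^sub>M prob_algebra (bsp X) \<and>
      (\<forall>z\<in>X \<times> A. wasserstein (worder M) (Q z) (case z of (x, a) \<Rightarrow> nominal M l x a) \<le> radius M \<and>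
         integral\<^sup>L (Q z) (case z of (x, a) \<Rightarrow> \<lambda>y. reward M l x a y + dp_value \<theta> (T - Suc l) y)
           \<le> dual_sup X (worder M) (radius M) (case z of (x, a) \<Rightarrow> nominal M l x a)
               (case z of (x, a) \<Rightarrow> \<lambda>y. reward M l x a y + dp_value \<theta> (T - Suc l) y) + \<delta>)" for l Q
  have "\<exists>Q. ok l Q" if l: "l < T" for l
  proof -
    have c: "continuous_on X (dp_value \<theta> (T - Suc l))" using dp_value_continuous[OF \<theta>, of "T - Suc l"] by simp
    have sp: "space XA = X \<times> A" by (simp add: space_pair_measure)
    show ?thesis
      unfolding ok_def
      by (rule transport_family.near_optimal_selection[OF family[OF l c] \<delta> sp XA_open nominal_kernel[OF l]])
  qed
  then have "\<exists>Q. \<forall>l. l < T \<longrightarrow> ok l (Q l)" by (intro choice) blast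
  then obtain Q where okQ: "\<And>l. l < T \<Longrightarrow> ok l (Q l)" by blast
  have Q: "Q l \<in> XA \<rightarrow>\<^sub>M prob_algebra (bsp X)"
    "x \<in> X \<Longrightarrow> a \<in> A \<Longrightarrow> wasserstein (worder M) (Q l (x, a)) (nominal M l x a) \<le> radius M"
    "x \<in> X \<Longrightarrow> a \<in> A \<Longrightarrow>
       (\<integral>y. reward M l x a y + dp_value \<theta> (T - Suc l) y \<partial>Q l (x, a)) \<le> Gop (dp_value \<theta> (T - Suc l)) l x a + \<delta>"
    if "l < T" for l x a
    using okQ[OF that] unfolding ok_def Gop_def by fastforce+
  define P where "P l x a = Q l (x, a)" for l x a
  have tk: "transition_kernel M (P l)" if "l < T" for l
    using Q(1)[OF that] by (simp add: transition_kernel_def P_def)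
  have "P \<in> admissible_kernels M s" for s
    using tk Q(2) kernel_in_pms[OF tk]
    by (auto simp: admissible_kernels_def ambiguity_ball_def P_def)
  moreover have "k \<le> T \<Longrightarrow> x \<in> X \<Longrightarrow> kernel_value P \<theta> k x \<le> dp_value \<theta> k x + k * \<delta>" for k x
  proof (induction k arbitrary: x)
    case (Suc k)
    let ?l = "T - Suc k"
    have l: "?l < T" "T - Suc ?l = k" and k: "k \<le> T" using Suc.prems(1) by auto
    have c: "continuous_on X (dp_value \<theta> k)" using dp_value_continuous[OF \<theta> k] .
    have "kernel_value P \<theta> k \<in> borel_measurable (bsp X) \<and> (\<exists>B. \<forall>x\<in>X. \<bar>kernel_value P \<theta> k x\<bar> \<le> B)"
      using tk k by (intro kernel_value_measurable_bounded[OF \<theta>]) auto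
    then obtain B where m: "kernel_value P \<theta> k \<in> borel_measurable (bsp X)" and B: "\<forall>x\<in>X. \<bar>kernel_value P \<theta> k x\<bar> \<le> B"
      by auto
    note int = step_integrals[OF l(1) \<theta> tk[OF l(1)] m B Suc.prems(2)]
    note pol = policy_in_pms[OF l(1) \<theta> Suc.prems(2)]
    have le: "(\<integral>y. reward M ?l x a y + kernel_value P \<theta> k y \<partial>P ?l x a) \<le> Gop (dp_value \<theta> k) ?l x a + (Suc k * \<delta>)" if a: "a \<in> A" for a
    proof -
      note Pm = kernel_in_pms[OF tk[OF l(1)] Suc.prems(2) a]
      interpret prob_space "P ?l x a" using pmsD(1)[OF Pm] .
      have cc: "continuous_on X (\<lambda>y. reward M ?l x a y + dp_value \<theta> k y)"
        by (rule integrand_slice[OF l(1) c Suc.prems(2) a])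
      note i = pms_integrable[OF Pm compact_X(1) cc]
      have "(\<integral>y. reward M ?l x a y + kernel_value P \<theta> k y \<partial>P ?l x a)
          \<le> (\<integral>y. (reward M ?l x a y + dp_value \<theta> k y) + k * \<delta> \<partial>P ?l x a)"
        using Suc.IH[OF k]
        by (intro pms_integral_mono[OF Pm int(1)[OF a]] Bochner_Integration.integrable_add[OF i] integrable_const)
          (simp add: add.assoc)
      also have "\<dots> = (\<integral>y. reward M ?l x a y + dp_value \<theta> k y \<partial>P ?l x a) + k * \<delta>"
        using i by (subst Bochner_Integration.integral_add) (simp_all add: prob_space)
      also have "\<dots> \<le> Gop (dp_value \<theta> k) ?l x a + \<delta> + k * \<delta>"
        using Q(3)[OF l(1) Suc.prems(2) a] l(2) by (simp add: P_def)
      finally show ?thesis by (simp add: algebra_simps)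
    qed
    interpret prob_space "policy M ?l \<theta> x" using pmsD(1)[OF pol] .
    note iG = Gop_integrable[OF l(1) \<theta> Suc.prems(2) c]
    have "kernel_value P \<theta> (Suc k) x \<le> (\<integral>a. Gop (dp_value \<theta> k) ?l x a + (Suc k * \<delta>) \<partial>policy M ?l \<theta> x)"
      unfolding kernel_value.simps using le iG by (intro pms_integral_mono[OF pol int(2)]) auto
    also have "\<dots> = dp_value \<theta> (Suc k) x + Suc k * \<delta>"
      using iG by (subst Bochner_Integration.integral_add) (simp_all add: prob_space)
    finally show ?case .
  qed simp
  ultimately show ?thesis by blast
qed

lemma V_eq_dp_value:
  assumes \<theta>: "\<theta> \<in> params M" and s: "s \<le> T" and x: "x \<in> X"
  shows "V M s \<theta> x = dp_value \<theta> (T - s) x"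
proof -
  have J: "expected_reward M \<theta> P s x = kernel_value P \<theta> (T - s) x" if "P \<in> admissible_kernels M s" for P
    by (rule expected_reward_eq_kernel_value[OF \<theta> admissible_transition[OF that] x s])
  have V: "V M s \<theta> x = (INF P\<in>admissible_kernels M s. kernel_value P \<theta> (T - s) x)"
    unfolding V_def using J by (intro INF_cong) auto
  have lower: "dp_value \<theta> (T - s) x \<le> kernel_value P \<theta> (T - s) x" if "P \<in> admissible_kernels M s" for P
    by (rule kernel_value_ge_dp_value[OF \<theta> that order.refl x])
  \<comment> \<open>Serves only to show that the infimum runs over a nonempty set.\<close>
  obtain P1 where P1: "P1 \<in> admissible_kernels M s"
    using near_optimal_kernels[OF \<theta>, of 1] by auto
  have "dp_value \<theta> (T - s) x \<le> V M s \<theta> x"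
    unfolding V using P1 lower by (intro cINF_greatest) auto
  moreover have "V M s \<theta> x \<le> dp_value \<theta> (T - s) x"
  proof (rule field_le_epsilon)
    fix e :: real assume e: "e > 0"
    \<comment> \<open>At most \<open>T\<close> stages contribute an error, and the divisor is
      positive.\<close>
    define d where "d = e / (T + 1)"
    have d: "d > 0" using e by (simp add: d_def)
    have "(T - s) * d \<le> (T + 1) * d" using d by (intro mult_right_mono) auto
    then have de: "(T - s) * d \<le> e" by (simp add: d_def)
    obtain P where P: "P \<in> admissible_kernels M s" "kernel_value P \<theta> (T - s) x \<le> dp_value \<theta> (T - s) x + (T - s) * d"
      using near_optimal_kernels[OF \<theta> d] x by (metis diff_le_self)
    have "V M s \<theta> x \<le> kernel_value P \<theta> (T - s) x"
      unfolding V using lower by (intro cINF_lower P(1) bdd_belowI2)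
    then show "V M s \<theta> x \<le> dp_value \<theta> (T - s) x + e" using P(2) de by linarith
  qed
  ultimately show ?thesis by simp
qed

lemma V_continuous:
  assumes "\<theta> \<in> params M" "s \<le> T"
  shows "continuous_on X (V M s \<theta>)"
  using dp_value_continuous[OF assms(1), of "T - s"] V_eq_dp_value[OF assms] by (simp cong: continuous_on_cong)

lemma V_terminal: "\<theta> \<in> params M \<Longrightarrow> x \<in> X \<Longrightarrow> V M T \<theta> x = terminal M x"
  by (simp add: V_eq_dp_value)

lemma V_recursion:
  assumes \<theta>: "\<theta> \<in> params M" and s: "s < T" and x: "x \<in> X"
  shows "V M s \<theta> x = (\<integral>a. G M s \<theta> x a \<partial>policy M s \<theta> x)"
proof -
  have T1: "T - s = Suc (T - Suc s)" "T - Suc (T - Suc s) = s" using s by auto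
  have "V M s \<theta> x = (\<integral>a. Gop (dp_value \<theta> (T - Suc s)) s x a \<partial>policy M s \<theta> x)"
    using V_eq_dp_value[OF \<theta> less_imp_le[OF s] x] unfolding T1(1) by (simp add: T1(2))
  also have "\<dots> = (\<integral>a. G M s \<theta> x a \<partial>policy M s \<theta> x)"
    unfolding G_eq_Gop using V_eq_dp_value[OF \<theta>, of "Suc s"] s
    by (intro Bochner_Integration.integral_cong refl Gop_cong) auto
  finally show ?thesis .
qed

end

section \<open>One-sided derivatives of suprema and infima\<close>

text \<open>Finitely many balls on which all members of the family vary by less than
  \<open>e'\<close> cover \<open>S\<close>. Convergence at the centres is then enough, because the
  limit \<open>D\<close> inherits the same modulus of continuity.\<close>

lemma equicontinuous_uniform_limit:
  fixes q :: "nat \<Rightarrow> 'k::metric_space \<Rightarrow> real"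
  assumes S: "compact S" and eq: "equicontinuous_on S \<F>" and q: "\<And>n. q n \<in> \<F>"
    and lim: "\<And>x. x \<in> S \<Longrightarrow> (\<lambda>n. q n x) \<longlonglongrightarrow> D x"
  shows "uniform_limit S q D sequentially"
  unfolding uniform_limit_iff
proof (intro allI impI)
  fix e :: real assume e: "e > 0"
  define e' where "e' = e / 4"
  have e': "e' > 0" using e by (simp add: e'_def)
  have "\<forall>x\<in>S. \<exists>d>0. \<forall>n. \<forall>y\<in>S. dist y x < d \<longrightarrow> dist (q n y) (q n x) < e'"
    using eq e' q unfolding equicontinuous_on_def by meson
  then obtain d where d: "\<And>x. x \<in> S \<Longrightarrow> d x > 0"
    "\<And>x n y. x \<in> S \<Longrightarrow> y \<in> S \<Longrightarrow> dist y x < d x \<Longrightarrow> dist (q n y) (q n x) < e'"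
    by metis
  have "S \<subseteq> (\<Union>x\<in>S. ball x (d x))" using d(1) by auto
  then obtain C where C: "C \<subseteq> S" "finite C" "S \<subseteq> (\<Union>x\<in>C. ball x (d x))"
    using compactE_image[OF S, of S "\<lambda>x. ball x (d x)"] by blast
  have "\<forall>\<^sub>F n in sequentially. \<forall>x\<in>C. dist (q n x) (D x) < e'"
    using C lim e' by (intro eventually_ball_finite ballI) (auto simp: tendsto_iff)
  then show "\<forall>\<^sub>F n in sequentially. \<forall>y\<in>S. dist (q n y) (D y) < e"
  proof eventually_elim
    case (elim n)
    show ?case
    proof
      fix y assume y: "y \<in> S"
      then obtain x where x: "x \<in> C" "dist x y < d x" using C(3) by auto
      have xS: "x \<in> S" using x C by auto
      have close: "dist (q m y) (q m x) < e'" for m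
        using d(2)[OF xS y] x(2) by (simp add: dist_commute)
      have "(\<lambda>m. dist (q m y) (q m x)) \<longlonglongrightarrow> dist (D y) (D x)"
        by (intro tendsto_dist lim y xS)
      then have "dist (D y) (D x) \<le> e'"
        by (rule LIMSEQ_le_const2) (use close in \<open>auto intro: less_imp_le\<close>)
      moreover have "dist (q n x) (D x) < e'" using elim x(1) by auto
      ultimately have "\<bar>q n y - D y\<bar> < 3 * e'"
        using close[of n] unfolding dist_real_def by linarith
      then show "dist (q n y) (D y) < e" using e by (simp add: dist_real_def e'_def)
    qed
  qed
qed

text \<open>The tail stays within 1 of a bounded limit and the head consists of finitely many
  bounded functions. Supplies the constant for dominated convergence.\<close>

lemma uniform_limit_bounded:
  fixes q :: "nat \<Rightarrow> 'k::topological_space \<Rightarrow> real"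
  assumes K: "compact K" and q: "\<And>n. continuous_on K (q n)" and D: "uniform_limit K q D sequentially"
  shows "\<exists>C. \<forall>n. \<forall>k\<in>K. \<bar>q n k\<bar> \<le> C"
proof -
  have Dc: "continuous_on K D" using D q by (intro uniform_limit_theorem) auto
  obtain B where B: "B \<ge> 0" "\<And>k. k \<in> K \<Longrightarrow> \<bar>D k\<bar> \<le> B" using compact_abs_bound[OF K Dc] by auto
  have "\<forall>n. \<exists>b\<ge>0. \<forall>k\<in>K. \<bar>q n k\<bar> \<le> b"
    using compact_abs_bound[OF K q] by metis
  then obtain b where b: "\<And>n. b n \<ge> 0" "\<And>n k. k \<in> K \<Longrightarrow> \<bar>q n k\<bar> \<le> b n" by metis
  have "\<forall>\<^sub>F n in sequentially. \<forall>k\<in>K. dist (q n k) (D k) < 1"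
    using D unfolding uniform_limit_iff by simp
  then obtain N where N: "\<And>n k. n \<ge> N \<Longrightarrow> k \<in> K \<Longrightarrow> dist (q n k) (D k) < 1"
    unfolding eventually_sequentially by auto
  have "\<bar>q n k\<bar> \<le> (\<Sum>i<N. b i) + B + 1" if k: "k \<in> K" for n k
  proof (cases "n < N")
    case True
    then have "b n \<le> (\<Sum>i<N. b i)" using b(1) by (intro member_le_sum) auto
    then show ?thesis using b(2)[OF k, of n] B(1) by linarith
  next
    case False
    then have "\<bar>q n k\<bar> \<le> B + 1" using N[of n k] B(2)[OF k] k by (auto simp: dist_real_def)
    moreover have "0 \<le> (\<Sum>i<N. b i)" using b(1) by (simp add: sum_nonneg)
    ultimately show ?thesis by linarith
  qed
  then show ?thesis by blast
qed

text \<open>The perturbed function is written exactly as \<open>f + h n * q n\<close>, with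
  \<open>q n\<close> its difference quotient, so that uniform convergence of \<open>q n\<close> is
  the only smoothness needed. Lower bound: evaluate at a maximiser of \<open>f\<close> where
  \<open>D\<close> is nearly largest. Upper bound: where \<open>D\<close> is not too large the
  quotient is controlled directly; elsewhere \<open>f\<close> falls short of its maximum by a fixed
  gap.\<close>

lemma danskin_SUP:
  fixes f :: "'k::topological_space \<Rightarrow> real"
  assumes K: "compact K" "K \<noteq> {}" and f: "continuous_on K f" and q: "\<And>n. continuous_on K (q n)"
    and D: "uniform_limit K q D sequentially" and h: "\<And>n. h n > 0" "h \<longlonglongrightarrow> 0"
  shows "(\<lambda>n. ((SUP k\<in>K. f k + h n * q n k) - (SUP k\<in>K. f k)) / h n)
     \<longlonglongrightarrow> (SUP k\<in>{k\<in>K. \<forall>k'\<in>K. f k' \<le> f k}. D k)"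
proof -
  define Ks where "Ks = {k\<in>K. \<forall>k'\<in>K. f k' \<le> f k}"
  define m where "m = (SUP k\<in>K. f k)"
  define d where "d = (SUP k\<in>Ks. D k)"
  define Q where "Q n = (SUP k\<in>K. f k + h n * q n k)" for n
  have Dc: "continuous_on K D" using D q by (intro uniform_limit_theorem) auto
  obtain B where B: "B \<ge> 0" "\<And>k. k \<in> K \<Longrightarrow> \<bar>D k\<bar> \<le> B" using compact_abs_bound[OF K(1) Dc] by auto
  have fm: "f k \<le> m" if "k \<in> K" for k
    unfolding m_def by (intro cSUP_upper that bdd_above_image_compact K f)
  have Ks_m: "f k = m" "k \<in> K" if "k \<in> Ks" for k
    using that fm[of k] cSUP_least[OF K(2), of f "f k"] unfolding Ks_def m_def by fastforce+
  have Ks_ne: "Ks \<noteq> {}"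
    using continuous_attains_sup[OF K f] unfolding Ks_def by auto
  have Ks_mem: "k \<in> Ks" if "k \<in> K" "f k = m" for k
    using that fm unfolding Ks_def by auto
  have bddKs: "bdd_above (D ` Ks)"
    by (rule bdd_aboveI2[of _ _ B]) (use B(2) Ks_m(2) in \<open>force simp: abs_le_iff\<close>)
  have QU: "f k + h n * q n k \<le> Q n" if "k \<in> K" for k n
    unfolding Q_def by (intro cSUP_upper that bdd_above_image_compact K continuous_intros f q)
  have "(\<lambda>n. (Q n - m) / h n) \<longlonglongrightarrow> d"
    unfolding tendsto_iff
  proof (intro allI impI)
    fix e :: real assume e: "e > 0"
    define e' where "e' = e / 4"
    have e': "e' > 0" using e by (simp add: e'_def)
    \<comment> \<open>The points whose derivative is too large for the claimed limit.
      \<open>W\<close> is compact and misses the maximisers of \<open>f\<close>, which gives the gap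
      \<open>g\<close>.\<close>
    define W where "W = {k\<in>K. d + e' \<le> D k}"
    have "compact W"
    proof -
      have "closedin (top_of_set K) (K \<inter> D -` {d + e'..})"
        by (rule continuous_closedin_preimage[OF Dc]) simp
      moreover have "K \<inter> D -` {d + e'..} = W" unfolding W_def by auto
      ultimately show ?thesis using K(1) closedin_compact by metis
    qed
    have Wlt: "f k < m" if "k \<in> W" for k
    proof (rule ccontr)
      assume "\<not> f k < m"
      then have "k \<in> Ks" using that fm[of k] by (intro Ks_mem) (auto simp: W_def)
      then have "D k \<le> d" unfolding d_def by (intro cSUP_upper bddKs)
      then show False using that e' by (simp add: W_def)
    qed
    have "\<exists>g>0. \<forall>k\<in>W. f k \<le> m - g"
    proof (cases "W = {}")
      case False
      have "continuous_on W f" by (rule continuous_on_subset[OF f]) (auto simp: W_def)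
      then obtain k where k: "k \<in> W" "\<And>k'. k' \<in> W \<Longrightarrow> f k' \<le> f k"
        using continuous_attains_sup[OF \<open>compact W\<close> False] by blast
      then show ?thesis using Wlt[OF k(1)] by (intro exI[of _ "m - f k"]) auto
    qed (auto intro: exI[of _ 1])
    then obtain g where g: "g > 0" "\<And>k. k \<in> W \<Longrightarrow> f k \<le> m - g" by auto
    have ev1: "\<forall>\<^sub>F n in sequentially. \<forall>k\<in>K. dist (q n k) (D k) < e'"
      using D e' unfolding uniform_limit_iff by blast
    \<comment> \<open>On \<open>W\<close> the gap must outweigh both the perturbation, at most
      \<open>h n * (B + e')\<close>, and a possibly negative target \<open>h n * d\<close>; hence
      the summand \<open>\<bar>d\<bar>\<close>.\<close>
    have "(\<lambda>n. h n * (B + e' + \<bar>d\<bar>)) \<longlonglongrightarrow> 0 * (B + e' + \<bar>d\<bar>)"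
      by (intro tendsto_intros h)
    then have ev2: "\<forall>\<^sub>F n in sequentially. h n * (B + e' + \<bar>d\<bar>) < g"
      by (rule order_tendstoD) (use g in simp)
    obtain ks where ks: "ks \<in> Ks" "d - e' < D ks"
      using less_cSUP_iff[OF Ks_ne bddKs, of "d - e'"] e' unfolding d_def by auto
    from ev1 ev2 show "\<forall>\<^sub>F n in sequentially. dist ((Q n - m) / h n) d < e"
    proof eventually_elim
      case (elim n)
      have close: "\<bar>q n k - D k\<bar> < e'" if "k \<in> K" for k
        using elim(1) that by (simp add: dist_real_def)
      have "f k + h n * q n k \<le> m + h n * (d + 2 * e')" if k: "k \<in> K" for k
      proof (cases "k \<in> W")
        case False
        then have "q n k \<le> d + 2 * e'" using k close[OF k] by (auto simp: W_def)
        then have "h n * q n k \<le> h n * (d + 2 * e')" using h(1)[of n] by simp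
        then show ?thesis using fm[OF k] by linarith
      next
        case True
        have "q n k \<le> B + e'" using close[OF k] B(2)[OF k] by linarith
        then have "h n * q n k \<le> h n * (B + e')" using h(1)[of n] by simp
        moreover have "h n * (- \<bar>d\<bar>) \<le> h n * (d + 2 * e')" using h(1)[of n] e' by (intro mult_left_mono) auto
        ultimately show ?thesis using g(2)[OF True] elim(2) by (simp add: algebra_simps)
      qed
      then have "Q n \<le> m + h n * (d + 2 * e')" unfolding Q_def using K(2) by (intro cSUP_least)
      then have up: "(Q n - m) / h n \<le> d + 2 * e'"
        using h(1)[of n] by (simp add: divide_le_eq mult.commute)
      have "m + h n * q n ks \<le> Q n" using QU[of ks n] Ks_m[OF ks(1)] by simp
      then have "q n ks \<le> (Q n - m) / h n"
        using h(1)[of n] by (simp add: le_divide_eq mult.commute)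
      then have "d - 2 * e' < (Q n - m) / h n" using close[OF Ks_m(2)[OF ks(1)]] ks(2) by linarith
      with up e show ?case by (simp add: dist_real_def e'_def abs_less_iff)
    qed
  qed
  then show ?thesis unfolding Q_def m_def d_def Ks_def .
qed

lemma danskin_INF:
  fixes f :: "'k::topological_space \<Rightarrow> real"
  assumes K: "compact K" "K \<noteq> {}" and f: "continuous_on K f" and q: "\<And>n. continuous_on K (q n)"
    and D: "uniform_limit K q D sequentially" and h: "\<And>n. h n > 0" "h \<longlonglongrightarrow> 0"
  shows "(\<lambda>n. ((INF k\<in>K. f k + h n * q n k) - (INF k\<in>K. f k)) / h n)
     \<longlonglongrightarrow> (INF k\<in>{k\<in>K. \<forall>k'\<in>K. f k \<le> f k'}. D k)"
proof -
  have "(\<lambda>n. ((SUP k\<in>K. - f k + h n * (- q n k)) - (SUP k\<in>K. - f k)) / h n)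
     \<longlonglongrightarrow> (SUP k\<in>{k\<in>K. \<forall>k'\<in>K. - f k' \<le> - f k}. - D k)"
    using D by (intro danskin_SUP K h continuous_intros f q uniform_limit_uminus)
  moreover have "(SUP k\<in>K. - f k + h n * (- q n k)) = - (INF k\<in>K. f k + h n * q n k)" for n
    by (simp add: uminus_cINF)
  ultimately have "(\<lambda>n. (- (INF k\<in>K. f k + h n * q n k) - - (INF k\<in>K. f k)) / h n)
     \<longlonglongrightarrow> - (INF k\<in>{k\<in>K. \<forall>k'\<in>K. f k \<le> f k'}. D k)"
    by (simp add: uminus_cINF)
  from tendsto_minus[OF this] show ?thesis
    by (simp add: minus_divide_left)
qed

text \<open>For negative \<open>x\<close>:
  \<open>1 - exp x \<le> - x \<le> exp (- x) - 1\<close>.\<close>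

lemma abs_exp_diff_one_le: "\<bar>exp x - 1\<bar> \<le> exp \<bar>x\<bar> - (1::real)"
proof (cases "x \<ge> 0")
  case False
  then show ?thesis using exp_ge_add_one_self[of x] exp_ge_add_one_self[of "- x"] by (simp del: exp_ge_add_one_self)
qed simp

lemma dderiv_right_sequentially:
  assumes "b > (0::real)"
    and "\<And>h. (\<And>n. 0 < h n) \<Longrightarrow> (\<And>n. h n < b) \<Longrightarrow> h \<longlonglongrightarrow> 0 \<Longrightarrow> (\<lambda>n. diff_quot \<phi> \<theta> r (h n)) \<longlonglongrightarrow> l"
  shows "(diff_quot \<phi> \<theta> r \<longlongrightarrow> l) (at_right 0)"
  using assms by (intro tendsto_at_right_sequentially[of 0 b]) auto

section \<open>Difference quotients of the dual objects along a fixed direction\<close>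

locale rmdp_direction = continuous_rmdp M
  for M :: "('a::euclidean_space, 'b::euclidean_space, 'c::euclidean_space) rmdp" +
  fixes L h0 :: real and \<theta> r :: 'c
  assumes bound: "multiplier_bound M L"
    and \<theta>: "\<theta> \<in> params M"
    and h0: "h0 > 0"
    and V_equicont: "\<And>s. s \<le> horizon M \<Longrightarrow>
          equicontinuous_on (states M)
            {(\<lambda>x. diff_quot (\<lambda>\<theta>. V M s \<theta> x) \<theta> r h) | h.
               0 < \<bar>h\<bar> \<and> \<bar>h\<bar> \<le> h0 \<and> \<theta> + h *\<^sub>R r \<in> params M}"
    and F_equicont: "\<And>s. s < horizon M \<Longrightarrow>
          equicontinuous_on (states M \<times> actions M \<times> {0..L})
            {(\<lambda>(x, a, lam). diff_quot (\<lambda>\<theta>. F M s \<theta> lam x a) \<theta> r h) | h.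
               0 < \<bar>h\<bar> \<and> \<bar>h\<bar> \<le> h0 \<and> \<theta> + h *\<^sub>R r \<in> params M}"
    and feasible: "right_feasible (params M) \<theta> r"
begin

lemma L: "L \<ge> 0"
  using bound by (simp add: multiplier_bound_def)

lemma F_continuous:
  assumes "\<theta>' \<in> params M" "s < T" "x \<in> X" "a \<in> A"
  shows "continuous_on UNIV (\<lambda>lam. F M s \<theta>' lam x a)"
proof -
  have c: "continuous_on X (V M (Suc s) \<theta>')" using V_continuous[OF assms(1)] assms(2) by simp
  have "continuous_on UNIV (\<lambda>lam. (\<lambda>(lam, z). dual_val X (worder M) (radius M) (case z of (x, a) \<Rightarrow> nominal M s x a)
      (case z of (x, a) \<Rightarrow> \<lambda>y. reward M s x a y + V M (Suc s) \<theta>' y) lam) (lam, (x, a)))"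
    by (rule continuous_on_compose2[OF transport_family.dual_val_joint[OF family[OF assms(2) c]]])
      (use assms in \<open>auto intro!: continuous_intros\<close>)
  then show ?thesis unfolding F_eq_dual_val by simp
qed

lemma Lstar_eq:
  assumes "\<theta>' \<in> params M" "s < T" "x \<in> X" "a \<in> A"
  shows "Lstar M s \<theta>' x a = {lam\<in>{0..L}. \<forall>lam'\<in>{0..L}. F M s \<theta>' lam' x a \<le> F M s \<theta>' lam x a}"
  using bound assms unfolding multiplier_bound_def is_arg_max_linorder by auto

text \<open>A maximiser over the compact interval exists by continuity, and
  \<open>multiplier_bound\<close> declares it a maximiser over the whole half-line.\<close>

lemma G_eq_SUP:
  assumes "\<theta>' \<in> params M" "s < T" "x \<in> X" "a \<in> A"
  shows "G M s \<theta>' x a = (SUP lam\<in>{0..L}. F M s \<theta>' lam x a)"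
proof -
  have "continuous_on {0..L} (\<lambda>lam. F M s \<theta>' lam x a)"
    using F_continuous[OF assms] continuous_on_subset by blast
  then obtain l where l: "l \<in> {0..L}" "\<And>l'. l' \<in> {0..L} \<Longrightarrow> F M s \<theta>' l' x a \<le> F M s \<theta>' l x a"
    using continuous_attains_sup[of "{0..L}" "\<lambda>lam. F M s \<theta>' lam x a"] L by auto
  then have "l \<in> Lstar M s \<theta>' x a" unfolding Lstar_eq[OF assms] by auto
  then have g: "F M s \<theta>' l' x a \<le> F M s \<theta>' l x a" if "l' \<ge> 0" for l'
    using that unfolding Lstar_def is_arg_max_linorder by auto
  have "G M s \<theta>' x a = F M s \<theta>' l x a"
    unfolding G_def using l g by (intro cSup_eq_maximum) auto
  moreover have "(SUP lam\<in>{0..L}. F M s \<theta>' lam x a) = F M s \<theta>' l x a"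
    using l by (intro cSup_eq_maximum) auto
  ultimately show ?thesis by simp
qed

text \<open>Turns eventual feasibility into a concrete step bound that also stays inside the window
  \<open>h0\<close> of the equicontinuity hypotheses.\<close>

definition b0 :: real where
  "b0 = (SOME b. 0 < b \<and> b \<le> h0 \<and> (\<forall>u. 0 < u \<longrightarrow> u < b \<longrightarrow> \<theta> + u *\<^sub>R r \<in> params M))"

lemma b0: "0 < b0" "b0 \<le> h0" "0 < u \<Longrightarrow> u < b0 \<Longrightarrow> \<theta> + u *\<^sub>R r \<in> params M"
proof -
  obtain b where "b > 0" "\<And>u. 0 < u \<Longrightarrow> u < b \<Longrightarrow> \<theta> + u *\<^sub>R r \<in> params M"
    using feasible unfolding right_feasible_def eventually_at_right_field by auto
  then have "\<exists>b. 0 < b \<and> b \<le> h0 \<and> (\<forall>u. 0 < u \<longrightarrow> u < b \<longrightarrow> \<theta> + u *\<^sub>R r \<in> params M)"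
    using h0 by (intro exI[of _ "min b h0"]) auto
  from someI_ex[OF this] show "0 < b0" "b0 \<le> h0" "0 < u \<Longrightarrow> u < b0 \<Longrightarrow> \<theta> + u *\<^sub>R r \<in> params M"
    unfolding b0_def by blast+
qed

text \<open>Dominated convergence and measurability of pointwise limits are applied along sequences;
  \<open>admissible_steps_limit\<close> recovers the limit at \<open>at_right 0\<close> from all of
  them.\<close>

definition admissible_steps :: "(nat \<Rightarrow> real) \<Rightarrow> bool" where
  "admissible_steps h \<longleftrightarrow> (\<forall>n. 0 < h n \<and> h n < b0) \<and> h \<longlonglongrightarrow> 0"

lemma admissible_stepsD:
  assumes "admissible_steps h"
  shows "0 < h n" "h \<longlonglongrightarrow> 0" "\<theta> + h n *\<^sub>R r \<in> params M"
    "0 < \<bar>h n\<bar> \<and> \<bar>h n\<bar> \<le> h0 \<and> \<theta> + h n *\<^sub>R r \<in> params M"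
proof -
  have 1: "0 < h n" "h n < b0" using assms unfolding admissible_steps_def by auto
  then show "0 < h n" "\<theta> + h n *\<^sub>R r \<in> params M" using b0(3) by auto
  then show "0 < \<bar>h n\<bar> \<and> \<bar>h n\<bar> \<le> h0 \<and> \<theta> + h n *\<^sub>R r \<in> params M" using 1 b0(2) by auto
  show "h \<longlonglongrightarrow> 0" using assms unfolding admissible_steps_def by simp
qed

lemma admissible_steps_limit:
  assumes "\<And>h. admissible_steps h \<Longrightarrow> (\<lambda>n. diff_quot \<phi> \<theta> r (h n)) \<longlonglongrightarrow> l"
  shows "(diff_quot \<phi> \<theta> r \<longlongrightarrow> l) (at_right 0)"
  using assms by (intro dderiv_right_sequentially[OF b0(1)]) (auto simp: admissible_steps_def)

lemma at_right_admissible_steps: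
  assumes "(g \<longlongrightarrow> l) (at_right (0::real))" "admissible_steps h"
  shows "(\<lambda>n. g (h n)) \<longlonglongrightarrow> l"
proof -
  have "filterlim h (at_right 0) sequentially"
    using admissible_stepsD[OF assms(2)] by (auto simp: filterlim_at)
  from filterlim_compose[OF assms(1) this] show ?thesis .
qed

text \<open>\<open>D\<close> stands for the derivative of the next value function. Keeping it a
  parameter lets the formulas be used inside the induction that establishes existence of that
  derivative.\<close>

definition Finf :: "nat \<Rightarrow> ('a \<Rightarrow> real) \<Rightarrow> real \<Rightarrow> 'a \<Rightarrow> 'b \<Rightarrow> 'a \<Rightarrow> real" where
  "Finf s D lam x a x' = (INF y\<in>Ystar M s \<theta> lam x a x'. D y)"

definition Fderiv :: "nat \<Rightarrow> ('a \<Rightarrow> real) \<Rightarrow> real \<Rightarrow> 'a \<Rightarrow> 'b \<Rightarrow> real" where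
  "Fderiv s D lam x a = (\<integral>x'. Finf s D lam x a x' \<partial>nominal M s x a)"

definition Gderiv :: "nat \<Rightarrow> ('a \<Rightarrow> real) \<Rightarrow> 'a \<Rightarrow> 'b \<Rightarrow> real" where
  "Gderiv s D x a = (SUP lam\<in>Lstar M s \<theta> x a. Fderiv s D lam x a)"

context
  fixes s :: nat and D :: "'a \<Rightarrow> real"
  assumes s: "s < T"
    and D: "\<And>y. y \<in> X \<Longrightarrow> (diff_quot (\<lambda>\<theta>. V M (Suc s) \<theta> y) \<theta> r \<longlongrightarrow> D y) (at_right 0)"
begin

context
  fixes h :: "nat \<Rightarrow> real"
  assumes h: "admissible_steps h"
begin

abbreviation "\<theta>n n \<equiv> \<theta> + h n *\<^sub>R r"
abbreviation "Vq n y \<equiv> diff_quot (\<lambda>\<theta>. V M (Suc s) \<theta> y) \<theta> r (h n)"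

lemma h_pos: "h n > 0" and \<theta>n: "\<theta>n n \<in> params M"
  using admissible_stepsD[OF h] by auto

lemma VS_continuous: "\<theta>' \<in> params M \<Longrightarrow> continuous_on X (V M (Suc s) \<theta>')"
  using V_continuous s by simp

lemma Vq_continuous: "continuous_on X (Vq n)"
  unfolding diff_quot_def using h_pos[of n]
  by (intro continuous_intros VS_continuous \<theta>n \<theta>) auto

lemma V_shift: "V M (Suc s) (\<theta>n n) y = V M (Suc s) \<theta> y + h n * Vq n y"
  using h_pos[of n] by (simp add: diff_quot_def)

lemma Vq_uniform: "uniform_limit X Vq D sequentially"
proof (rule equicontinuous_uniform_limit[OF compact_X(1) V_equicont[of "Suc s"]])
  show "Suc s \<le> T" using s by simp
  show "Vq n \<in> {(\<lambda>x. diff_quot (\<lambda>\<theta>. V M (Suc s) \<theta> x) \<theta> r h) | h.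
      0 < \<bar>h\<bar> \<and> \<bar>h\<bar> \<le> h0 \<and> \<theta> + h *\<^sub>R r \<in> params M}" for n
    using admissible_stepsD(4)[OF h, of n] by blast
  show "(\<lambda>n. Vq n x) \<longlonglongrightarrow> D x" if "x \<in> X" for x
    by (rule at_right_admissible_steps[OF D[OF that] h])
qed

lemma Vq_bounded: "\<exists>C\<ge>0. \<forall>n. \<forall>y\<in>X. \<bar>Vq n y\<bar> \<le> C"
proof -
  obtain C where C: "\<And>n y. y \<in> X \<Longrightarrow> \<bar>Vq n y\<bar> \<le> C"
    using uniform_limit_bounded[OF compact_X(1) Vq_continuous Vq_uniform] by auto
  obtain y where "y \<in> X" using compact_X(2) by auto
  then have "C \<ge> 0" using C[of y 0] by linarith
  then show ?thesis using C by blast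
qed

context
  fixes x :: 'a and a :: 'b
  assumes x: "x \<in> X" and a: "a \<in> A"
begin

abbreviation "dinf \<theta>' \<equiv> dual_inf X (worder M) (\<lambda>y. reward M s x a y + V M (Suc s) \<theta>' y)"

lemma dinf_continuous: "\<theta>' \<in> params M \<Longrightarrow> continuous_on X (dinf \<theta>' lam)"
  by (intro dual_inf_continuous integrand_slice s VS_continuous x a)

lemma integrand_x'_continuous:
  assumes "\<theta>' \<in> params M" "x' \<in> X"
  shows "continuous_on X (\<lambda>y. reward M s x a y + V M (Suc s) \<theta>' y + lam * norm (x' - y) ^ worder M)"
  by (intro continuous_intros integrand_slice s VS_continuous x a assms)

lemma dinf_quotient_limit:
  assumes x': "x' \<in> X"
  shows "(\<lambda>n. (dinf (\<theta>n n) lam x' - dinf \<theta> lam x') / h n) \<longlonglongrightarrow> Finf s D lam x a x'"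
proof -
  have "Ystar M s \<theta> lam x a x' = {y\<in>X. \<forall>y'\<in>X.
      reward M s x a y + V M (Suc s) \<theta> y + lam * norm (x' - y) ^ worder M
      \<le> reward M s x a y' + V M (Suc s) \<theta> y' + lam * norm (x' - y') ^ worder M}"
    by (auto simp: Ystar_def is_arg_min_linorder inner_obj_def)
  then show ?thesis
    using danskin_INF[OF compact_X integrand_x'_continuous[OF \<theta> x', of lam] Vq_continuous Vq_uniform
        h_pos admissible_stepsD(2)[OF h]]
    unfolding Finf_def dual_inf_def V_shift by (simp add: algebra_simps)
qed

lemma dinf_quotient_bound:
  assumes x': "x' \<in> X" and C: "\<And>y. y \<in> X \<Longrightarrow> \<bar>Vq n y\<bar> \<le> C"
  shows "\<bar>(dinf (\<theta>n n) lam x' - dinf \<theta> lam x') / h n\<bar> \<le> C"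
proof -
  have "\<bar>dinf (\<theta>n n) lam x' - dinf \<theta> lam x'\<bar> \<le> h n * C"
    unfolding dual_inf_def
  proof (intro abs_INF_diff_le compact_X bdd_below_image_compact integrand_x'_continuous \<theta> \<theta>n x')
    fix y assume y: "y \<in> X"
    have "\<bar>h n * Vq n y\<bar> \<le> h n * C"
      using C[OF y] h_pos[of n] by (simp add: abs_mult)
    then show "\<bar>reward M s x a y + V M (Suc s) (\<theta>n n) y + lam * norm (x' - y) ^ worder M -
        (reward M s x a y + V M (Suc s) \<theta> y + lam * norm (x' - y) ^ worder M)\<bar> \<le> h n * C"
      unfolding V_shift by simp
  qed
  then show ?thesis using h_pos[of n] by (simp add: divide_le_eq mult.commute)
qed

lemma dinf_integrable: "\<theta>' \<in> params M \<Longrightarrow> integrable (nominal M s x a) (dinf \<theta>' lam)"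
  by (intro pms_integrable[OF nominal_in_pms[OF s x a] compact_X(1)] dinf_continuous)

lemma F_quotient:
  "diff_quot (\<lambda>\<theta>. F M s \<theta> lam x a) \<theta> r (h n) =
     (\<integral>x'. (dinf (\<theta>n n) lam x' - dinf \<theta> lam x') / h n \<partial>nominal M s x a)"
  unfolding diff_quot_def F_eq_dual_val dual_val_def
  using dinf_integrable[OF \<theta>n, of n lam] dinf_integrable[OF \<theta>, of lam] by simp

lemma F_quotient_bound:
  assumes "\<And>y. y \<in> X \<Longrightarrow> \<bar>Vq n y\<bar> \<le> C"
  shows "\<bar>diff_quot (\<lambda>\<theta>. F M s \<theta> lam x a) \<theta> r (h n)\<bar> \<le> C"
  unfolding F_quotient
  by (intro pms_integral_bound[OF nominal_in_pms[OF s x a]] dinf_quotient_bound assms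
      integrable_divide Bochner_Integration.integrable_diff dinf_integrable \<theta>n \<theta>)

text \<open>Integrability is part of the conclusion because \<open>Finf\<close> is an infimum over a
  set moving with \<open>x'\<close>: its measurability is inherited from the quotients, which
  converge pointwise by the inner Danskin step.\<close>

lemma F_quotient_limit:
  "integrable (nominal M s x a) (Finf s D lam x a) \<and>
   (\<lambda>n. diff_quot (\<lambda>\<theta>. F M s \<theta> lam x a) \<theta> r (h n)) \<longlonglongrightarrow> Fderiv s D lam x a"
proof -
  let ?N = "nominal M s x a"
  note N = nominal_in_pms[OF s x a]
  interpret prob_space ?N using pmsD(1)[OF N] .
  obtain C where C: "\<And>n y. y \<in> X \<Longrightarrow> \<bar>Vq n y\<bar> \<le> C" using Vq_bounded by auto
  define g where "g n x' = (dinf (\<theta>n n) lam x' - dinf \<theta> lam x') / h n" for n x'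
  have gm: "g n \<in> borel_measurable ?N" for n
    unfolding g_def[abs_def]
    by (intro borel_measurable_integrable integrable_divide Bochner_Integration.integrable_diff dinf_integrable \<theta>n \<theta>)
  have lim: "(\<lambda>n. g n x') \<longlonglongrightarrow> Finf s D lam x a x'" if "x' \<in> space ?N" for x'
    using dinf_quotient_limit that pmsD(3)[OF N] unfolding g_def by simp
  have Fm: "Finf s D lam x a \<in> borel_measurable ?N"
    by (rule borel_measurable_LIMSEQ_real[OF lim gm])
  have bd: "AE x' in ?N. norm (g n x') \<le> C" for n
    using dinf_quotient_bound[OF _ C] pmsD(3)[OF N] unfolding g_def by (intro AE_I2) auto
  have "integrable ?N (Finf s D lam x a)"
    by (rule integrable_dominated_convergence[where s=g and w="\<lambda>_. C"]) (use Fm gm lim bd in auto)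
  moreover have "(\<lambda>n. integral\<^sup>L ?N (g n)) \<longlonglongrightarrow> integral\<^sup>L ?N (Finf s D lam x a)"
    by (rule integral_dominated_convergence[where w="\<lambda>_. C"]) (use Fm gm lim bd in auto)
  ultimately show ?thesis unfolding F_quotient Fderiv_def g_def by simp
qed

text \<open>Points \<open>(x, a, lam)\<close> with the same \<open>x\<close> and \<open>a\<close>
  are as far apart as their multipliers, so joint equicontinuity restricts to the slice and upgrades
  the pointwise limit.\<close>

lemma F_quotient_uniform:
  "uniform_limit {0..L} (\<lambda>n lam. diff_quot (\<lambda>\<theta>. F M s \<theta> lam x a) \<theta> r (h n)) (\<lambda>lam. Fderiv s D lam x a) sequentially"
proof (rule equicontinuous_uniform_limit)
  let ?\<F> = "{(\<lambda>lam. diff_quot (\<lambda>\<theta>. F M s \<theta> lam x a) \<theta> r h) | h.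
      0 < \<bar>h\<bar> \<and> \<bar>h\<bar> \<le> h0 \<and> \<theta> + h *\<^sub>R r \<in> params M}"
  show "equicontinuous_on {0..L} ?\<F>"
    unfolding equicontinuous_on_def
  proof (intro ballI allI impI)
    fix lam e :: real assume lam: "lam \<in> {0..L}" and e: "e > 0"
    have "(x, a, lam) \<in> X \<times> A \<times> {0..L}" using x a lam by auto
    then obtain d where d: "d > 0" "\<And>\<phi> y. \<phi> \<in> {(\<lambda>(x, a, lam). diff_quot (\<lambda>\<theta>. F M s \<theta> lam x a) \<theta> r h) | h.
        0 < \<bar>h\<bar> \<and> \<bar>h\<bar> \<le> h0 \<and> \<theta> + h *\<^sub>R r \<in> params M} \<Longrightarrow> y \<in> X \<times> A \<times> {0..L} \<Longrightarrow> dist y (x, a, lam) < d \<Longrightarrow>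
        dist (\<phi> y) (\<phi> (x, a, lam)) < e"
      using F_equicont[OF s] e unfolding equicontinuous_on_def by meson
    show "\<exists>d>0. \<forall>\<phi>\<in>?\<F>. \<forall>y\<in>{0..L}. dist y lam < d \<longrightarrow> dist (\<phi> y) (\<phi> lam) < e"
    proof (intro exI[of _ d] conjI ballI impI d(1))
      fix \<phi> y assume "\<phi> \<in> ?\<F>" and y: "y \<in> {0..L}" "dist y lam < d"
      then obtain k where k: "0 < \<bar>k\<bar> \<and> \<bar>k\<bar> \<le> h0 \<and> \<theta> + k *\<^sub>R r \<in> params M"
        "\<phi> = (\<lambda>lam. diff_quot (\<lambda>\<theta>. F M s \<theta> lam x a) \<theta> r k)" by blast
      have "dist (x, a, y) (x, a, lam) < d" using y by (simp add: dist_Pair_Pair)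
      then show "dist (\<phi> y) (\<phi> lam) < e"
        using d(2)[of "\<lambda>(x, a, lam). diff_quot (\<lambda>\<theta>. F M s \<theta> lam x a) \<theta> r k" "(x, a, y)"] k x a y by auto
    qed
  qed
  show "(\<lambda>lam. diff_quot (\<lambda>\<theta>. F M s \<theta> lam x a) \<theta> r (h n)) \<in> ?\<F>" for n
    using admissible_stepsD(4)[OF h, of n] by blast
qed (use F_quotient_limit in auto)

lemma F_quotient_continuous: "continuous_on {0..L} (\<lambda>lam. diff_quot (\<lambda>\<theta>. F M s \<theta> lam x a) \<theta> r (h n))"
  unfolding diff_quot_def using h_pos[of n]
  by (intro continuous_intros continuous_on_subset[OF F_continuous] \<theta> \<theta>n s x a) auto

lemma F_shift: "F M s (\<theta>n n) lam x a = F M s \<theta> lam x a + h n * diff_quot (\<lambda>\<theta>. F M s \<theta> lam x a) \<theta> r (h n)"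
  using h_pos[of n] by (simp add: diff_quot_def)

lemma G_quotient_limit: "(\<lambda>n. diff_quot (\<lambda>\<theta>. G M s \<theta> x a) \<theta> r (h n)) \<longlonglongrightarrow> Gderiv s D x a"
proof -
  have "(\<lambda>n. ((SUP lam\<in>{0..L}. F M s \<theta> lam x a + h n * diff_quot (\<lambda>\<theta>. F M s \<theta> lam x a) \<theta> r (h n)) -
      (SUP lam\<in>{0..L}. F M s \<theta> lam x a)) / h n)
     \<longlonglongrightarrow> (SUP lam\<in>{lam\<in>{0..L}. \<forall>lam'\<in>{0..L}. F M s \<theta> lam' x a \<le> F M s \<theta> lam x a}. Fderiv s D lam x a)"
    using L by (intro danskin_SUP F_quotient_continuous F_quotient_uniform h_pos admissible_stepsD(2)[OF h]
        continuous_on_subset[OF F_continuous] \<theta> s x a) auto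
  then show ?thesis
    unfolding F_shift[symmetric] Lstar_eq[OF \<theta> s x a, symmetric] Gderiv_def[symmetric]
      G_eq_SUP[OF \<theta> s x a, symmetric] G_eq_SUP[OF \<theta>n s x a, symmetric]
    by (simp add: diff_quot_def)
qed

text \<open>Infimum over \<open>y\<close>, averaging over \<open>x'\<close> and supremum over
  \<open>lam\<close> are all nonexpansive, so the bound on the quotients of the value function
  survives unchanged and uniformly in the action.\<close>

lemma G_quotient_bound:
  assumes "\<And>y. y \<in> X \<Longrightarrow> \<bar>Vq n y\<bar> \<le> C"
  shows "\<bar>diff_quot (\<lambda>\<theta>. G M s \<theta> x a) \<theta> r (h n)\<bar> \<le> C"
proof -
  have "\<bar>G M s (\<theta>n n) x a - G M s \<theta> x a\<bar> \<le> h n * C"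
    unfolding G_eq_SUP[OF \<theta> s x a] G_eq_SUP[OF \<theta>n s x a]
  proof (intro abs_SUP_diff_le bdd_above_image_compact continuous_on_subset[OF F_continuous] \<theta> \<theta>n s x a)
    fix lam
    show "\<bar>F M s (\<theta>n n) lam x a - F M s \<theta> lam x a\<bar> \<le> h n * C"
      unfolding F_shift using F_quotient_bound[OF assms, of lam] h_pos[of n] by (simp add: abs_mult)
  qed (use L in auto)
  then show ?thesis using h_pos[of n] by (simp add: diff_quot_def divide_le_eq mult.commute)
qed

end

end

end

end

section \<open>Directional derivatives of the value functions\<close>

context rmdp_direction
begin

lemma segment_params: "0 \<le> u \<Longrightarrow> u < b0 \<Longrightarrow> \<theta> + u *\<^sub>R r \<in> params M"
  using b0(3)[of u] \<theta> by (cases "u = 0") auto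

text \<open>The bounded score makes the log-density Lipschitz along the segment, with constant the
  score bound times \<open>norm r\<close>. Exponentiating bounds the likelihood ratio uniformly in
  the action.\<close>

lemma pdens_ratio:
  assumes s: "s < T" and x: "x \<in> X"
  shows "\<exists>C. \<forall>u a. 0 < u \<longrightarrow> u < b0 \<longrightarrow> a \<in> A \<longrightarrow> 0 < pdens M s \<theta> x a \<and>
    \<bar>pdens M s (\<theta> + u *\<^sub>R r) x a / pdens M s \<theta> x a - 1\<bar> \<le> exp (C * u) - 1"
proof -
  obtain score C where sc: "\<And>\<theta>' a. \<theta>' \<in> params M \<Longrightarrow> a \<in> A \<Longrightarrow> 0 < pdens M s \<theta>' x a"
    "\<And>\<theta>' a. \<theta>' \<in> params M \<Longrightarrow> a \<in> A \<Longrightarrow>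
      ((\<lambda>\<theta>'. ln (pdens M s \<theta>' x a)) has_derivative (\<lambda>v. score s \<theta>' x a \<bullet> v)) (at \<theta>' within params M)"
    "\<And>\<theta>' a. \<theta>' \<in> params M \<Longrightarrow> a \<in> A \<Longrightarrow> norm (score s \<theta>' x a) \<le> C"
    using regular s x unfolding regular_policy_def by blast
  have "\<bar>pdens M s (\<theta> + u *\<^sub>R r) x a / pdens M s \<theta> x a - 1\<bar> \<le> exp (C * norm r * u) - 1"
    if u: "0 < u" "u < b0" and a: "a \<in> A" for u a
  proof -
    define f where "f = (\<lambda>v. ln (pdens M s (\<theta> + v *\<^sub>R r) x a))"
    have "norm (f u - f 0) \<le> (C * norm r) * norm (u - 0)"
    proof (rule field_differentiable_bound[of "{0..u}"])
      fix v assume v: "v \<in> {0..u}"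
      have vp: "\<theta> + w *\<^sub>R r \<in> params M" if "w \<in> {0..u}" for w
        using that u by (intro segment_params) auto
      have g: "((\<lambda>w. \<theta> + w *\<^sub>R r) has_derivative (\<lambda>w. w *\<^sub>R r)) (at v within {0..u})"
        by (auto intro!: derivative_eq_intros)
      have "((\<lambda>\<theta>'. ln (pdens M s \<theta>' x a)) has_derivative (\<lambda>w. score s (\<theta> + v *\<^sub>R r) x a \<bullet> w))
          (at (\<theta> + v *\<^sub>R r) within (\<lambda>w. \<theta> + w *\<^sub>R r) ` {0..u})"
        by (rule has_derivative_subset[OF sc(2)[OF vp[OF v] a]]) (use vp in auto)
      from diff_chain_within[OF g this]
      have "(f has_derivative (\<lambda>w. score s (\<theta> + v *\<^sub>R r) x a \<bullet> (w *\<^sub>R r))) (at v within {0..u})"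
        by (simp add: f_def o_def)
      then show "(f has_field_derivative (score s (\<theta> + v *\<^sub>R r) x a \<bullet> r)) (at v within {0..u})"
        unfolding has_field_derivative_def by (rule has_derivative_eq_rhs) (auto simp: fun_eq_iff)
      have "\<bar>score s (\<theta> + v *\<^sub>R r) x a \<bullet> r\<bar> \<le> norm (score s (\<theta> + v *\<^sub>R r) x a) * norm r"
        by (rule Cauchy_Schwarz_ineq2)
      also have "\<dots> \<le> C * norm r"
        by (intro mult_right_mono sc(3) vp v a) simp
      finally show "norm (score s (\<theta> + v *\<^sub>R r) x a \<bullet> r) \<le> C * norm r" by simp
    qed (use u in auto)
    then have "\<bar>f u - f 0\<bar> \<le> C * norm r * u" using u by simp
    moreover have p: "0 < pdens M s (\<theta> + u *\<^sub>R r) x a" "0 < pdens M s \<theta> x a"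
      using u by (auto intro!: sc(1) a \<theta> segment_params)
    then have "pdens M s (\<theta> + u *\<^sub>R r) x a / pdens M s \<theta> x a = exp (f u - f 0)"
      by (simp add: f_def exp_diff)
    ultimately show ?thesis
      using abs_exp_diff_one_le[of "f u - f 0"] by (simp add: order_trans)
  qed
  then show ?thesis using sc(1)[OF \<theta>] by blast
qed

text \<open>Rewriting the shifted integral with the likelihood ratio \<rho> leaves the integral of
  \<open>(\<rho> a - 1) * \<phi> a\<close> under the unshifted policy. As \<open>C\<close> does not
  depend on \<phi>, this is a total variation estimate.\<close>

lemma policy_integral_shift:
  assumes s: "s < T" and x: "x \<in> X"
  shows "\<exists>C. \<forall>u \<phi> B. 0 < u \<longrightarrow> u < b0 \<longrightarrow> \<phi> \<in> borel_measurable (bsp A) \<longrightarrow> (\<forall>a\<in>A. \<bar>\<phi> a\<bar> \<le> B) \<longrightarrow>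
    \<bar>(\<integral>a. \<phi> a \<partial>policy M s (\<theta> + u *\<^sub>R r) x) - (\<integral>a. \<phi> a \<partial>policy M s \<theta> x)\<bar> \<le> B * (exp (C * u) - 1)"
proof -
  obtain C where C: "\<And>u a. 0 < u \<Longrightarrow> u < b0 \<Longrightarrow> a \<in> A \<Longrightarrow> 0 < pdens M s \<theta> x a"
    "\<And>u a. 0 < u \<Longrightarrow> u < b0 \<Longrightarrow> a \<in> A \<Longrightarrow>
    \<bar>pdens M s (\<theta> + u *\<^sub>R r) x a / pdens M s \<theta> x a - 1\<bar> \<le> exp (C * u) - 1"
    using pdens_ratio[OF s x] by auto
  have ref: "sets (refmeas M) = sets (bsp A)" using model unfolding robust_mdp_def by auto
  have spref: "space (refmeas M) = A" using sets_eq_imp_space_eq[OF ref] by simp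
  have pm: "pdens M s \<theta>' x \<in> borel_measurable (refmeas M)" "\<And>a. a \<in> A \<Longrightarrow> 0 \<le> pdens M s \<theta>' x a"
    if "\<theta>' \<in> params M" for \<theta>'
    using model s x that unfolding robust_mdp_def by auto
  show ?thesis
  proof (intro exI[of _ C] allI impI)
    fix u B :: real and \<phi> :: "'b \<Rightarrow> real"
    assume u: "0 < u" "u < b0" and \<phi>: "\<phi> \<in> borel_measurable (bsp A)" and B: "\<forall>a\<in>A. \<bar>\<phi> a\<bar> \<le> B"
    define \<theta>' where "\<theta>' = \<theta> + u *\<^sub>R r"
    have \<theta>': "\<theta>' \<in> params M" unfolding \<theta>'_def using u by (intro segment_params) auto
    define \<rho> where "\<rho> a = pdens M s \<theta>' x a / pdens M s \<theta> x a" for a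
    have \<rho>: "\<bar>\<rho> a - 1\<bar> \<le> exp (C * u) - 1" if "a \<in> A" for a
      using C(2)[OF u that] by (simp add: \<rho>_def \<theta>'_def)
    have \<rho>m: "\<rho> \<in> borel_measurable (bsp A)"
      unfolding \<rho>_def[abs_def] using pm(1)[OF \<theta>'] pm(1)[OF \<theta>] ref by (auto cong: measurable_cong_sets)
    have \<phi>m: "\<phi> \<in> borel_measurable (refmeas M)" "(\<lambda>a. \<rho> a * \<phi> a) \<in> borel_measurable (refmeas M)"
      using \<phi> \<rho>m ref by (auto cong: measurable_cong_sets)
    have dens: "(\<integral>a. \<psi> a \<partial>policy M s \<theta>'' x) = (\<integral>a. pdens M s \<theta>'' x a * \<psi> a \<partial>refmeas M)"
      if "\<theta>'' \<in> params M" "\<psi> \<in> borel_measurable (refmeas M)" for \<theta>'' and \<psi> :: "'b \<Rightarrow> real"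
      unfolding policy_def using pm[OF that(1)] that(2) spref by (subst integral_density) (auto intro!: AE_I2)
    have shift: "(\<integral>a. \<phi> a \<partial>policy M s \<theta>' x) = (\<integral>a. \<rho> a * \<phi> a \<partial>policy M s \<theta> x)"
      unfolding dens[OF \<theta>' \<phi>m(1)] dens[OF \<theta> \<phi>m(2)]
    proof (rule Bochner_Integration.integral_cong[OF refl])
      fix a assume "a \<in> space (refmeas M)"
      then have "pdens M s \<theta> x a \<noteq> 0" using C(1)[OF u, of a] spref by simp
      then show "pdens M s \<theta>' x a * \<phi> a = pdens M s \<theta> x a * (\<rho> a * \<phi> a)" by (simp add: \<rho>_def)
    qed
    note pol = policy_in_pms[OF s \<theta> x]
    have bd: "\<bar>(\<rho> a - 1) * \<phi> a\<bar> \<le> B * (exp (C * u) - 1)" if "a \<in> A" for a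
    proof -
      \<comment> \<open>The sign of \<open>C\<close> is not known; nonnegativity is read off from
        the bound on \<rho>.\<close>
      have "0 \<le> exp (C * u) - 1" using \<rho>[OF that] abs_ge_zero[of "\<rho> a - 1"] by linarith
      from mult_mono[OF \<rho>[OF that] bspec[OF B that] this abs_ge_zero] show ?thesis
        by (simp add: abs_mult mult.commute)
    qed
    have i\<phi>: "integrable (policy M s \<theta> x) \<phi>"
      using B by (intro pms_integrable_bounded[OF pol \<phi>]) auto
    have i2: "integrable (policy M s \<theta> x) (\<lambda>a. (\<rho> a - 1) * \<phi> a)"
      using bd \<phi> \<rho>m by (intro pms_integrable_bounded[OF pol]) auto
    have "(\<integral>a. \<rho> a * \<phi> a \<partial>policy M s \<theta> x) = (\<integral>a. (\<rho> a - 1) * \<phi> a + \<phi> a \<partial>policy M s \<theta> x)"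
      by (simp add: algebra_simps)
    also have "\<dots> = (\<integral>a. (\<rho> a - 1) * \<phi> a \<partial>policy M s \<theta> x) + (\<integral>a. \<phi> a \<partial>policy M s \<theta> x)"
      using i2 i\<phi> by simp
    finally have "(\<integral>a. \<rho> a * \<phi> a \<partial>policy M s \<theta> x) - (\<integral>a. \<phi> a \<partial>policy M s \<theta> x)
        = (\<integral>a. (\<rho> a - 1) * \<phi> a \<partial>policy M s \<theta> x)" by simp
    then show "\<bar>(\<integral>a. \<phi> a \<partial>policy M s (\<theta> + u *\<^sub>R r) x) - (\<integral>a. \<phi> a \<partial>policy M s \<theta> x)\<bar> \<le> B * (exp (C * u) - 1)"
      using pms_integral_bound[OF pol i2 bd] shift unfolding \<theta>'_def by simp
  qed
qed

text \<open>The chain rule along the line through \<theta>, taken within the set \<open>S\<close> of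
  feasible step sizes, reduces the derivative within \<open>params M\<close> to a scalar one. Every
  admissible sequence stays in \<open>S\<close>, so the limit does not depend on it.\<close>

lemma policy_derivative:
  assumes s: "s < T" and x: "x \<in> X" and \<phi>: "continuous_on A \<phi>"
  shows "\<exists>l. \<forall>h. admissible_steps h \<longrightarrow>
    (\<lambda>n. diff_quot (\<lambda>\<theta>. \<integral>a. \<phi> a \<partial>policy M s \<theta> x) \<theta> r (h n)) \<longlonglongrightarrow> l"
proof -
  obtain D where D: "\<And>\<theta>' x. \<theta>' \<in> params M \<Longrightarrow> x \<in> X \<Longrightarrow>
      ((\<lambda>\<theta>'. \<integral>a. \<phi> a \<partial>policy M s \<theta>' x) has_derivative (\<lambda>v. D \<theta>' x \<bullet> v)) (at \<theta>' within params M)"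
    using regular s \<phi> unfolding regular_policy_def by blast
  define f where "f = (\<lambda>v. \<integral>a. \<phi> a \<partial>policy M s (\<theta> + v *\<^sub>R r) x)"
  define S where "S = {v. \<theta> + v *\<^sub>R r \<in> params M}"
  have g: "((\<lambda>w. \<theta> + w *\<^sub>R r) has_derivative (\<lambda>w. w *\<^sub>R r)) (at 0 within S)"
    by (auto intro!: derivative_eq_intros)
  have "((\<lambda>\<theta>'. \<integral>a. \<phi> a \<partial>policy M s \<theta>' x) has_derivative (\<lambda>v. D \<theta> x \<bullet> v))
      (at (\<theta> + 0 *\<^sub>R r) within (\<lambda>w. \<theta> + w *\<^sub>R r) ` S)"
    using has_derivative_subset[OF D[OF \<theta> x], of "(\<lambda>w. \<theta> + w *\<^sub>R r) ` S"] by (auto simp: S_def)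
  from diff_chain_within[OF g this]
  have "(f has_derivative (\<lambda>w. D \<theta> x \<bullet> (w *\<^sub>R r))) (at 0 within S)"
    by (simp add: f_def o_def)
  then have "(f has_field_derivative (D \<theta> x \<bullet> r)) (at 0 within S)"
    unfolding has_field_derivative_def by (rule has_derivative_eq_rhs) (auto simp: fun_eq_iff)
  then have lim: "((\<lambda>v. (f v - f 0) / (v - 0)) \<longlongrightarrow> D \<theta> x \<bullet> r) (at 0 within S)"
    by (simp add: has_field_derivative_iff)
  have "(\<lambda>n. diff_quot (\<lambda>\<theta>. \<integral>a. \<phi> a \<partial>policy M s \<theta> x) \<theta> r (h n)) \<longlonglongrightarrow> D \<theta> x \<bullet> r" if h: "admissible_steps h" for h
  proof -
    have "filterlim h (at 0 within S) sequentially"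
      using admissible_stepsD[OF h]
      by (auto simp: filterlim_at S_def less_imp_neq[THEN not_sym] intro!: always_eventually)
    from filterlim_compose[OF lim this] show ?thesis by (simp add: diff_quot_def f_def)
  qed
  then show ?thesis by blast
qed

text \<open>
  The limit of the difference quotients of \<open>G\<close> need not be continuous in the action, so weak
  continuity of the policy does not suffice to pass to the limit. The bounded score gives
  convergence of the policies in total variation, which does.
\<close>

lemma V_step:
  assumes s: "s < T"
    and D: "\<And>y. y \<in> X \<Longrightarrow> (diff_quot (\<lambda>\<theta>. V M (Suc s) \<theta> y) \<theta> r \<longlongrightarrow> D y) (at_right 0)"
    and x: "x \<in> X"
  shows "\<exists>l. (diff_quot (\<lambda>\<theta>. V M s \<theta> x) \<theta> r \<longlongrightarrow> l) (at_right 0)"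
proof -
  have Gc: "continuous_on A (G M s \<theta>' x)" if "\<theta>' \<in> params M" for \<theta>'
    using continuous_on_slice[OF Gop_continuous[OF s V_continuous[OF that Suc_leI[OF s]]] x]
    unfolding G_eq_Gop[abs_def] .
  obtain l where l: "\<And>h. admissible_steps h \<Longrightarrow>
      (\<lambda>n. diff_quot (\<lambda>\<theta>'. \<integral>a. G M s \<theta> x a \<partial>policy M s \<theta>' x) \<theta> r (h n)) \<longlonglongrightarrow> l"
    using policy_derivative[OF s x Gc[OF \<theta>]] by auto
  define g where "g = (\<integral>a. Gderiv s D x a \<partial>policy M s \<theta> x)"
  have "(\<lambda>n. diff_quot (\<lambda>\<theta>. V M s \<theta> x) \<theta> r (h n)) \<longlonglongrightarrow> g + l" if h: "admissible_steps h" for h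
  proof -
    note hD = admissible_stepsD[OF h]
    define gn where "gn n a = diff_quot (\<lambda>\<theta>. G M s \<theta> x a) \<theta> r (h n)" for n a
    note pol = policy_in_pms[OF s \<theta> x]
    obtain C where C: "C \<ge> 0" "\<And>n y. y \<in> X \<Longrightarrow> \<bar>diff_quot (\<lambda>\<theta>. V M (Suc s) \<theta> y) \<theta> r (h n)\<bar> \<le> C"
      using Vq_bounded[OF s D h] by auto
    have gnb: "\<bar>gn n a\<bar> \<le> C" if "a \<in> A" for n a
      unfolding gn_def by (rule G_quotient_bound[OF s D h x that C(2)])
    have gnc: "continuous_on A (gn n)" for n
      unfolding gn_def[abs_def] diff_quot_def using hD(1)[of n]
      by (intro continuous_intros Gc \<theta> hD(3)) auto
    have gnl: "(\<lambda>n. gn n a) \<longlonglongrightarrow> Gderiv s D x a" if "a \<in> A" for a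
      unfolding gn_def by (rule G_quotient_limit[OF s D h x that])
    have gm: "gn n \<in> borel_measurable (policy M s \<theta> x)" for n
      using bsp_measurableI[OF gnc[of n]] pmsD(2)[OF pol] by (simp cong: measurable_cong_sets)
    have gl: "(\<lambda>n. \<integral>a. gn n a \<partial>policy M s \<theta> x) \<longlonglongrightarrow> g"
      unfolding g_def
    proof (rule integral_dominated_convergence[where w="\<lambda>_. C"])
      interpret prob_space "policy M s \<theta> x" using pmsD(1)[OF pol] .
      show "integrable (policy M s \<theta> x) (\<lambda>_. C)" by simp
      show "Gderiv s D x \<in> borel_measurable (policy M s \<theta> x)"
        by (rule borel_measurable_LIMSEQ_real[OF _ gm]) (use gnl pmsD(3)[OF pol] in auto)
    qed (use gm gnl gnb pmsD(3)[OF pol] in auto)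
    obtain C' where C': "\<forall>u \<phi> B. 0 < u \<longrightarrow> u < b0 \<longrightarrow> \<phi> \<in> borel_measurable (bsp A) \<longrightarrow> (\<forall>a\<in>A. \<bar>\<phi> a\<bar> \<le> B) \<longrightarrow>
        \<bar>(\<integral>a. \<phi> a \<partial>policy M s (\<theta> + u *\<^sub>R r) x) - (\<integral>a. \<phi> a \<partial>policy M s \<theta> x)\<bar> \<le> B * (exp (C' * u) - 1)"
      using policy_integral_shift[OF s x] by blast
    have "(\<lambda>n. C * (exp (C' * h n) - 1)) \<longlonglongrightarrow> C * (exp (C' * 0) - 1)"
      by (intro tendsto_intros hD(2))
    then have z: "(\<lambda>n. C * (exp (C' * h n) - 1)) \<longlonglongrightarrow> 0" by simp
    \<comment> \<open>The quotients \<open>gn n\<close> share the bound \<open>C\<close>, so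
      replacing the shifted policy by the fixed one costs at most
      \<open>C * (exp (C' * h n) - 1)\<close>.\<close>
    have "(\<lambda>n. (\<integral>a. gn n a \<partial>policy M s (\<theta> + h n *\<^sub>R r) x) - (\<integral>a. gn n a \<partial>policy M s \<theta> x)) \<longlonglongrightarrow> 0"
    proof (rule Lim_null_comparison[OF always_eventually z], rule allI)
      fix n
      have "h n < b0" using h unfolding admissible_steps_def by auto
      then show "norm ((\<integral>a. gn n a \<partial>policy M s (\<theta> + h n *\<^sub>R r) x) - (\<integral>a. gn n a \<partial>policy M s \<theta> x))
          \<le> C * (exp (C' * h n) - 1)"
        using C' hD(1)[of n] bsp_measurableI[OF gnc[of n]] gnb by (simp add: real_norm_def)
    qed
    from tendsto_add[OF tendsto_add[OF this gl] l[OF h]]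
    have "(\<lambda>n. (\<integral>a. gn n a \<partial>policy M s (\<theta> + h n *\<^sub>R r) x) +
        diff_quot (\<lambda>\<theta>'. \<integral>a. G M s \<theta> x a \<partial>policy M s \<theta>' x) \<theta> r (h n)) \<longlonglongrightarrow> g + l" by simp
    \<comment> \<open>Exact splitting without a cross term: \<open>G\<close> changes under the new
      policy, then the policy changes under the old \<open>G\<close>.\<close>
    moreover have "diff_quot (\<lambda>\<theta>. V M s \<theta> x) \<theta> r (h n) = (\<integral>a. gn n a \<partial>policy M s (\<theta> + h n *\<^sub>R r) x) +
        diff_quot (\<lambda>\<theta>'. \<integral>a. G M s \<theta> x a \<partial>policy M s \<theta>' x) \<theta> r (h n)" for n
    proof -
      note pn = policy_in_pms[OF s hD(3)[of n] x]
      have i: "integrable (policy M s (\<theta> + h n *\<^sub>R r) x) (G M s \<theta>' x)" if "\<theta>' \<in> params M" for \<theta>'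
        by (intro pms_integrable[OF pn compact_A(1)] Gc that)
      show ?thesis
        unfolding gn_def diff_quot_def V_recursion[OF hD(3) s x] V_recursion[OF \<theta> s x]
        using i[OF hD(3)[of n]] i[OF \<theta>] hD(1)[of n] by (simp add: field_simps)
    qed
    ultimately show ?thesis by simp
  qed
  then show ?thesis using admissible_steps_limit by blast
qed

lemma V_right_dderiv_exists:
  "k \<le> T \<Longrightarrow> y \<in> X \<Longrightarrow> \<exists>l. (diff_quot (\<lambda>\<theta>. V M (T - k) \<theta> y) \<theta> r \<longlongrightarrow> l) (at_right 0)"
proof (induction k arbitrary: y)
  case 0
  \<comment> \<open>The terminal value does not depend on the policy parameter.\<close>
  have "(diff_quot (\<lambda>\<theta>. V M T \<theta> y) \<theta> r \<longlongrightarrow> 0) (at_right 0)"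
  proof (rule admissible_steps_limit)
    fix h assume "admissible_steps h"
    then show "(\<lambda>n. diff_quot (\<lambda>\<theta>. V M T \<theta> y) \<theta> r (h n)) \<longlonglongrightarrow> 0"
      using V_terminal[OF _ 0(2)] \<theta> admissible_stepsD(3) by (simp add: diff_quot_def)
  qed
  then show ?case by auto
next
  case (Suc k)
  have "\<exists>D. \<forall>y\<in>X. (diff_quot (\<lambda>\<theta>. V M (T - k) \<theta> y) \<theta> r \<longlongrightarrow> D y) (at_right 0)"
    using Suc.IH Suc.prems(1) by (intro bchoice) auto
  then obtain D where D: "\<And>y. y \<in> X \<Longrightarrow> (diff_quot (\<lambda>\<theta>. V M (Suc (T - Suc k)) \<theta> y) \<theta> r \<longlongrightarrow> D y) (at_right 0)"
    using Suc.prems(1) by (auto simp: Suc_diff_Suc)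
  show ?case using V_step[OF _ D Suc.prems(2)] Suc.prems(1) by simp
qed

lemma right_derivative_G:
  assumes t: "t < T" and x: "x \<in> X" and a: "a \<in> A"
  defines "D \<equiv> \<lambda>y. right_dderiv (\<lambda>\<theta>. V M (Suc t) \<theta> y) \<theta> r"
  shows "\<forall>y\<in>X. has_right_dderiv (\<lambda>\<theta>. V M (Suc t) \<theta> y) \<theta> r"
    and "\<forall>lam\<in>Lstar M t \<theta> x a. integrable (nominal M t x a) (\<lambda>x'. INF y\<in>Ystar M t \<theta> lam x a x'. D y)"
    and "(diff_quot (\<lambda>\<theta>. G M t \<theta> x a) \<theta> r \<longlongrightarrow>
      (SUP lam\<in>Lstar M t \<theta> x a. \<integral>x'. (INF y\<in>Ystar M t \<theta> lam x a x'. D y) \<partial>nominal M t x a)) (at_right 0)"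
proof -
  have ex: "\<exists>l. (diff_quot (\<lambda>\<theta>. V M (Suc t) \<theta> y) \<theta> r \<longlongrightarrow> l) (at_right 0)" if "y \<in> X" for y
    using V_right_dderiv_exists[of "T - Suc t" y] that t by simp
  then show "\<forall>y\<in>X. has_right_dderiv (\<lambda>\<theta>. V M (Suc t) \<theta> y) \<theta> r"
    by (simp add: has_right_dderiv_def)
  have D: "(diff_quot (\<lambda>\<theta>. V M (Suc t) \<theta> y) \<theta> r \<longlongrightarrow> D y) (at_right 0)" if y: "y \<in> X" for y
  proof -
    obtain l where "(diff_quot (\<lambda>\<theta>. V M (Suc t) \<theta> y) \<theta> r \<longlongrightarrow> l) (at_right 0)" using ex[OF y] by auto
    then show ?thesis
      using tendsto_Lim[OF trivial_limit_at_right_real] unfolding D_def right_dderiv_def by metis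
  qed
  \<comment> \<open>Integrability of the limit does not mention a sequence, but its proof needs some
    admissible one. The double successor keeps every step strictly below \<open>b0\<close>.\<close>
  define h where "h n = b0 * inverse (real (Suc (Suc n)))" for n
  have h: "admissible_steps h"
    unfolding admissible_steps_def
  proof (intro conjI allI)
    show "0 < h n" for n
      using b0(1) by (simp add: h_def)
    have "inverse (real (Suc (Suc n))) < 1" for n
      by (simp add: field_simps)
    then show "h n < b0" for n
      using mult_strict_left_mono[OF _ b0(1), of "inverse (real (Suc (Suc n)))" 1] by (simp add: h_def)
    show "h \<longlonglongrightarrow> 0"
      unfolding h_def[abs_def] by (intro tendsto_mult_right_zero LIMSEQ_Suc LIMSEQ_inverse_real_of_nat)
  qed
  show "\<forall>lam\<in>Lstar M t \<theta> x a. integrable (nominal M t x a) (\<lambda>x'. INF y\<in>Ystar M t \<theta> lam x a x'. D y)"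
    using F_quotient_limit[OF t D h x a] unfolding Finf_def[abs_def] by auto
  show "(diff_quot (\<lambda>\<theta>. G M t \<theta> x a) \<theta> r \<longlongrightarrow>
      (SUP lam\<in>Lstar M t \<theta> x a. \<integral>x'. (INF y\<in>Ystar M t \<theta> lam x a x'. D y) \<partial>nominal M t x a)) (at_right 0)"
    using admissible_steps_limit[OF G_quotient_limit[OF t D _ x a]]
    unfolding Gderiv_def Fderiv_def Finf_def by simp
qed

end

section \<open>Reflection of the direction and the final statement\<close>

lemma diff_quot_uminus: "diff_quot \<phi> \<theta> (- r) h = - diff_quot \<phi> \<theta> r (- h)"
  by (simp add: diff_quot_def)

lemma left_limit_iff:
  "(diff_quot \<phi> \<theta> r \<longlongrightarrow> l) (at_left 0) \<longleftrightarrow> (diff_quot \<phi> \<theta> (- r) \<longlongrightarrow> - l) (at_right 0)"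
  unfolding filterlim_at_left_to_right diff_quot_uminus[abs_def] by (simp add: tendsto_minus_cancel_left)

lemma left_feasible_iff: "left_feasible \<Theta> \<theta> r \<longleftrightarrow> right_feasible \<Theta> \<theta> (- r)"
  unfolding left_feasible_def right_feasible_def eventually_at_left_to_right by simp

lemma left_dderiv_eqI:
  "(diff_quot \<phi> \<theta> (- r) \<longlongrightarrow> l) (at_right 0) \<Longrightarrow> left_dderiv \<phi> \<theta> r = - l"
  unfolding left_dderiv_def
  by (rule tendsto_Lim[OF trivial_limit_at_left_real]) (simp add: left_limit_iff)

lemma equicontinuous_on_uminus:
  fixes \<F> :: "('k::metric_space \<Rightarrow> real) set"
  assumes "equicontinuous_on S \<F>" "\<And>\<phi>. \<phi> \<in> \<F>' \<Longrightarrow> (\<lambda>x. - \<phi> x) \<in> \<F>"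
  shows "equicontinuous_on S \<F>'"
  unfolding equicontinuous_on_def
proof (intro ballI allI impI)
  fix x and e :: real assume "x \<in> S" "e > 0"
  then obtain d where d: "d > 0" "\<And>\<phi> y. \<phi> \<in> \<F> \<Longrightarrow> y \<in> S \<Longrightarrow> dist y x < d \<Longrightarrow> dist (\<phi> y) (\<phi> x) < e"
    using assms(1) unfolding equicontinuous_on_def by meson
  then show "\<exists>d>0. \<forall>\<phi>\<in>\<F>'. \<forall>y\<in>S. dist y x < d \<longrightarrow> dist (\<phi> y) (\<phi> x) < e"
    using d(2)[OF assms(2)] by (intro exI[of _ d]) (auto simp: dist_minus)
qed

text \<open>Existence of the derivatives and integrability are stated alongside the formulas because
  \<open>Lim\<close> and the Bochner integral are total: the equations alone could hold between
  default values.\<close>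

theorem theorem3p1:
  fixes M :: "('a::euclidean_space, 'b::euclidean_space, 'c::euclidean_space) rmdp"
    and L h0 :: real and \<theta> r :: 'c and t :: nat and x :: 'a and a :: 'b
  assumes model: "robust_mdp M"
    and reward_cont: "\<And>s. s < horizon M \<Longrightarrow>
          continuous_on (states M \<times> actions M \<times> states M) (\<lambda>(x, a, y). reward M s x a y)"
    and terminal_cont: "continuous_on (states M) (terminal M)"
    and nominal_cont: "\<And>s. s < horizon M \<Longrightarrow>
          weakly_continuous_on (states M \<times> actions M) (states M) (\<lambda>(x, a). nominal M s x a)"
    and regular: "regular_policy M"
    and bound: "multiplier_bound M L"
    and \<theta>: "\<theta> \<in> params M" and t: "t < horizon M" and x: "x \<in> states M" and a: "a \<in> actions M"
    and h0: "h0 > 0"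
    and V_equicont: "\<And>s. s \<le> horizon M \<Longrightarrow>
          equicontinuous_on (states M)
            {(\<lambda>x. diff_quot (\<lambda>\<theta>. V M s \<theta> x) \<theta> r h) | h.
               0 < \<bar>h\<bar> \<and> \<bar>h\<bar> \<le> h0 \<and> \<theta> + h *\<^sub>R r \<in> params M}"
    and F_equicont: "\<And>s. s < horizon M \<Longrightarrow>
          equicontinuous_on (states M \<times> actions M \<times> {0..L})
            {(\<lambda>(x, a, lam). diff_quot (\<lambda>\<theta>. F M s \<theta> lam x a) \<theta> r h) | h.
               0 < \<bar>h\<bar> \<and> \<bar>h\<bar> \<le> h0 \<and> \<theta> + h *\<^sub>R r \<in> params M}"
  shows
    "(right_feasible (params M) \<theta> r \<longrightarrow>
        (\<forall>y\<in>states M. has_right_dderiv (\<lambda>\<theta>. V M (Suc t) \<theta> y) \<theta> r) \<and>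
        (\<forall>lam\<in>Lstar M t \<theta> x a. integrable (nominal M t x a)
           (\<lambda>x'. INF y\<in>Ystar M t \<theta> lam x a x'. right_dderiv (\<lambda>\<theta>. V M (Suc t) \<theta> y) \<theta> r)) \<and>
        has_right_dderiv (\<lambda>\<theta>. G M t \<theta> x a) \<theta> r \<and>
        right_dderiv (\<lambda>\<theta>. G M t \<theta> x a) \<theta> r =
          (SUP lam\<in>Lstar M t \<theta> x a. \<integral>x'.
             (INF y\<in>Ystar M t \<theta> lam x a x'. right_dderiv (\<lambda>\<theta>. V M (Suc t) \<theta> y) \<theta> r)
             \<partial>nominal M t x a)) \<and>
     (left_feasible (params M) \<theta> r \<longrightarrow>
        (\<forall>y\<in>states M. has_left_dderiv (\<lambda>\<theta>. V M (Suc t) \<theta> y) \<theta> r) \<and>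
        (\<forall>lam\<in>Lstar M t \<theta> x a. integrable (nominal M t x a)
           (\<lambda>x'. SUP y\<in>Ystar M t \<theta> lam x a x'. left_dderiv (\<lambda>\<theta>. V M (Suc t) \<theta> y) \<theta> r)) \<and>
        has_left_dderiv (\<lambda>\<theta>. G M t \<theta> x a) \<theta> r \<and>
        left_dderiv (\<lambda>\<theta>. G M t \<theta> x a) \<theta> r =
          (INF lam\<in>Lstar M t \<theta> x a. \<integral>x'.
             (SUP y\<in>Ystar M t \<theta> lam x a x'. left_dderiv (\<lambda>\<theta>. V M (Suc t) \<theta> y) \<theta> r)
             \<partial>nominal M t x a))"
proof (intro conjI[of "_ \<longrightarrow> _" "_ \<longrightarrow> _"] impI)
  assume "right_feasible (params M) \<theta> r"
  then interpret rmdp_direction M L h0 \<theta> r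
    using model reward_cont terminal_cont nominal_cont regular bound \<theta> h0 V_equicont F_equicont
    by unfold_locales
  note R = right_derivative_G[OF t x a]
  show "(\<forall>y\<in>states M. has_right_dderiv (\<lambda>\<theta>. V M (Suc t) \<theta> y) \<theta> r) \<and>
        (\<forall>lam\<in>Lstar M t \<theta> x a. integrable (nominal M t x a)
           (\<lambda>x'. INF y\<in>Ystar M t \<theta> lam x a x'. right_dderiv (\<lambda>\<theta>. V M (Suc t) \<theta> y) \<theta> r)) \<and>
        has_right_dderiv (\<lambda>\<theta>. G M t \<theta> x a) \<theta> r \<and>
        right_dderiv (\<lambda>\<theta>. G M t \<theta> x a) \<theta> r =
          (SUP lam\<in>Lstar M t \<theta> x a. \<integral>x'.
             (INF y\<in>Ystar M t \<theta> lam x a x'. right_dderiv (\<lambda>\<theta>. V M (Suc t) \<theta> y) \<theta> r)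
             \<partial>nominal M t x a)"
    using R(1,2) R(3) tendsto_Lim[OF trivial_limit_at_right_real R(3)]
    unfolding has_right_dderiv_def[of "\<lambda>\<theta>. G M t \<theta> x a"] right_dderiv_def[of "\<lambda>\<theta>. G M t \<theta> x a"]
    by blast
next
  assume feas: "left_feasible (params M) \<theta> r"
  interpret rmdp_direction M L h0 \<theta> "- r"
  proof (unfold_locales)
    \<comment> \<open>A step \<open>h\<close> in direction \<open>- r\<close> is the step
      \<open>- h\<close> in direction \<open>r\<close>, with the quotient negated. The hypothesis
      covers both signs of \<open>h\<close>, so it contains the negated family.\<close>
    show "equicontinuous_on (states M) {(\<lambda>x. diff_quot (\<lambda>\<theta>. V M s \<theta> x) \<theta> (- r) h) | h.
        0 < \<bar>h\<bar> \<and> \<bar>h\<bar> \<le> h0 \<and> \<theta> + h *\<^sub>R (- r) \<in> params M}" if "s \<le> horizon M" for s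
      by (rule equicontinuous_on_uminus[OF V_equicont[OF that]])
        (force simp: diff_quot_uminus intro: exI[of _ "- _"])
    show "equicontinuous_on (states M \<times> actions M \<times> {0..L})
        {(\<lambda>(x, a, lam). diff_quot (\<lambda>\<theta>. F M s \<theta> lam x a) \<theta> (- r) h) | h.
           0 < \<bar>h\<bar> \<and> \<bar>h\<bar> \<le> h0 \<and> \<theta> + h *\<^sub>R (- r) \<in> params M}" if "s < horizon M" for s
      by (rule equicontinuous_on_uminus[OF F_equicont[OF that]])
        (force simp: diff_quot_uminus case_prod_beta' intro: exI[of _ "- _"])
    show "right_feasible (params M) \<theta> (- r)" using feas by (simp add: left_feasible_iff)
  qed (fact model reward_cont terminal_cont nominal_cont regular bound \<theta> h0)+
  let ?D = "\<lambda>y. right_dderiv (\<lambda>\<theta>. V M (Suc t) \<theta> y) \<theta> (- r)"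
  note R = right_derivative_G[OF t x a]
  have lim: "(diff_quot (\<lambda>\<theta>. V M (Suc t) \<theta> y) \<theta> (- r) \<longlongrightarrow> ?D y) (at_right 0)" if "y \<in> states M" for y
    using R(1) that tendsto_Lim[OF trivial_limit_at_right_real]
    unfolding has_right_dderiv_def right_dderiv_def by metis
  have D: "left_dderiv (\<lambda>\<theta>. V M (Suc t) \<theta> y) \<theta> r = - ?D y" if "y \<in> states M" for y
    by (rule left_dderiv_eqI[OF lim[OF that]])
  have "(SUP y\<in>Ystar M t \<theta> lam x a x'. left_dderiv (\<lambda>\<theta>. V M (Suc t) \<theta> y) \<theta> r)
      = - (INF y\<in>Ystar M t \<theta> lam x a x'. ?D y)" for lam x'
    unfolding uminus_cINF by (intro SUP_cong D) (auto simp: Ystar_def is_arg_min_linorder)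
  note sup = this
  have Glim: "(diff_quot (\<lambda>\<theta>. G M t \<theta> x a) \<theta> r \<longlongrightarrow>
      - (SUP lam\<in>Lstar M t \<theta> x a. \<integral>x'. (INF y\<in>Ystar M t \<theta> lam x a x'. ?D y) \<partial>nominal M t x a)) (at_left 0)"
    using R(3) by (simp add: left_limit_iff)
  have "has_left_dderiv (\<lambda>\<theta>. V M (Suc t) \<theta> y) \<theta> r" if "y \<in> states M" for y
    using lim[OF that] unfolding has_left_dderiv_def left_limit_iff by (metis minus_minus)
  moreover have "\<forall>lam\<in>Lstar M t \<theta> x a. integrable (nominal M t x a)
      (\<lambda>x'. SUP y\<in>Ystar M t \<theta> lam x a x'. left_dderiv (\<lambda>\<theta>. V M (Suc t) \<theta> y) \<theta> r)"
    unfolding sup using R(2) by auto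
  moreover have "has_left_dderiv (\<lambda>\<theta>. G M t \<theta> x a) \<theta> r"
    using Glim unfolding has_left_dderiv_def by blast
  moreover have "left_dderiv (\<lambda>\<theta>. G M t \<theta> x a) \<theta> r =
          (INF lam\<in>Lstar M t \<theta> x a. \<integral>x'.
             (SUP y\<in>Ystar M t \<theta> lam x a x'. left_dderiv (\<lambda>\<theta>. V M (Suc t) \<theta> y) \<theta> r)
             \<partial>nominal M t x a)"
    unfolding left_dderiv_def[of "\<lambda>\<theta>. G M t \<theta> x a"] tendsto_Lim[OF trivial_limit_at_left_real Glim]
    by (simp add: sup uminus_cSUP)
  ultimately show "(\<forall>y\<in>states M. has_left_dderiv (\<lambda>\<theta>. V M (Suc t) \<theta> y) \<theta> r) \<and>
        (\<forall>lam\<in>Lstar M t \<theta> x a. integrable (nominal M t x a)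
           (\<lambda>x'. SUP y\<in>Ystar M t \<theta> lam x a x'. left_dderiv (\<lambda>\<theta>. V M (Suc t) \<theta> y) \<theta> r)) \<and>
        has_left_dderiv (\<lambda>\<theta>. G M t \<theta> x a) \<theta> r \<and>
        left_dderiv (\<lambda>\<theta>. G M t \<theta> x a) \<theta> r =
          (INF lam\<in>Lstar M t \<theta> x a. \<integral>x'.
             (SUP y\<in>Ystar M t \<theta> lam x a x'. left_dderiv (\<lambda>\<theta>. V M (Suc t) \<theta> y) \<theta> r)
             \<partial>nominal M t x a)" by blast
qed

end
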